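(* Let $T\curvearrowright V$ be a Calabi-Yau toric GIT problem (with non-zero weights and distinct rays) in which the torus $T$ has rank 2, i.e. $\operatorname{rank} L=2$. Let $W\subset L^\vee_{\mathbb R}$ be a wall of the secondary fan, let $\Gamma$ be a minimal face of the polytope $\Pi$, and let $H=H_{\Gamma^c}$ be the corresponding relevant subspace. Assume $H\subseteq\langle W\rangle$. Then $n_{\Gamma,W}=m_{\Gamma,W}$, where $n_{\Gamma,W}$ is the multiplicity of $D^b(Z_H)$ in $D^b(Z_W)$ and $m_{\Gamma,W}$ is the intersection multiplicity of $\overline\nabla_\Gamma$ with the toric curve $C_W$ in the secondary toric variety $\mathfrak F$.
   Context: **Toric data.** $T=L\otimes\mathbb C^*$ is a torus with lattice of one-parameter subgroups $L$, acting diagonally on $V=\mathbb C^n$ with weights $q_1,\dots,q_n\in L^\vee$. Let $Q:\mathbb Z^n\to L^\vee$, $e_i\mapsto q_i$, assumed to have finite cokernel. $N$ is the cokernel of $Q^\vee:L\to\mathbb Z^n$ modulo torsion, $A:\mathbb Z^n\to N$ the projection, and $a_i=A(e_i)$ are the rays. Calabi-Yau means $\det V:=\sum q_i=0$; then all $a_i$ lie in an affine hyperplane of height 1, and $\Pi\subset N_{\mathbb R}$ is the convex hull of the $a_i$. Assume all $q_i\ne0$ and all $a_i$ distinct. **Secondary fan and algorithm.** For any toric GIT problem with weights $q_i\in L^\vee$ (not necessarily Calabi-Yau): for $\theta\in L^\vee_{\mathbb R}$, $V^{ss}_\theta$ is the set of $v$ with $\theta\in\mathrm{cone}(q_i:v_i\ne0)$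 and $X_\theta=[V_\theta^{ss}/T]$. The secondary fan has support $\mathrm{cone}(q_1,\dots,q_n)$ and its cones are, for $\theta$ in the support, the intersections of all cones $\mathrm{cone}(q_i:i\in I)$ containing $\theta$. Chambers are top-dimensional cones, with corresponding phases $X_\theta$ ($\theta$ interior); walls are codimension 1 cones; outside the support the phase is empty. For a subspace $H$ spanned by the weights it contains, the Higgs GIT problem of $H$ is given by the weights in $H$, in the lattice $L^\vee\cap H$. For a wall $W$ with linear span $\langle W\rangle$, $Z_W$ is the phase of the Higgs GIT problem of $\langle W\rangle$ whose chamber contains the relative interior of $W$. If $W$ is a facet of the chamber of $X_+$, $X_-$ is the (possibly empty) phase across $W$, and $\lambda_W\in L$ is the primitive normal non-negative on the chamber of $X_+$, with $\kappa=(\det V)(\lambda_W)\ge0$, then $D^b(X_+)=\langle D^b(X_-),D^b(Z_W),\dots,D^b(Z_W)\rangle$ with $\kappa$ copies of $D^b(Z_W)$. The wall-crossing algorithm decomposes $D^b$ of a phase by repeatedly crossing walls with $\kappa>0$ until a minimal phase is reached (one whose closed chamber contains $-\det V$, or the empty phase), then recursively decomposing each $D^b(Z_W)$. Each non-zero final factor is $D^b(Z_H)$, with $Z_H$ the non-empty minimal phase (unique up to derived equivalence) of the Higgs GIT problem of some subspace $H$. Such $H$ are exactly of the following kind: $H$ is relevant if the cone spanned by the weights in $H$ is all of $H$. The multiplicity of $D^b(Z_H)$ is the number of final factors indexed by $H$; it is independent of choices. $n_{\Gamma,W}$ is computed by applying the algorithm to the phase $Z_W$ of the Higgs GIT problem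 of $\langle W\rangle$. **Minimal faces.** A face $\Gamma$ of $\Pi$ is identified with the set $\Gamma\subset\{1,\dots,n\}$ of all $i$ with $a_i$ in the face. It is minimal if for every $i\in\Gamma$, $a_i$ is in the linear span of $\{a_j:j\in\Gamma\setminus i\}$. $H_{\Gamma^c}\subset L^\vee_{\mathbb R}$ is the span of $\{q_i:i\notin\Gamma\}$; $\Gamma\mapsto H_{\Gamma^c}$ is a bijection from minimal faces to relevant subspaces. **Discriminants.** For a non-empty face $\Gamma$, let $N_\Gamma\subset N$ be the sublattice spanned by $\{a_i\}_{i\in\Gamma}$, $M^\Gamma$ its dual, and $L_\Gamma=\{\ell\in L: Q^\vee(\ell)\in\mathbb Z^\Gamma\}$. For $c\in\mathbb C^\Gamma$ let $W_c=\sum_{i\in\Gamma}c_i\chi^{a_i}$, a function on the torus $M^\Gamma_{\mathbb C^*}=M^\Gamma\otimes\mathbb C^*$, where $\chi^{a_i}$ is the character given by $a_i$. Let $D_\Gamma\subset\mathbb C^\Gamma$ be the set of $c$ such that $W_c(x)=0$ and $dW_c(x)=0$ for some $x\in M^\Gamma_{\mathbb C^*}$. Let $\nabla'_\Gamma\subset(L_\Gamma^\vee)_{\mathbb C^*}$ be the image of $D_\Gamma\cap(\mathbb C^* )^\Gamma$ under the map $(\mathbb C^* )^\Gamma\to(L_\Gamma^\vee)_{\mathbb C^*}$ dual to $L_\Gamma\hookrightarrow\mathbb Z^\Gamma$, and let $\nabla_\Gamma\subset L^\vee_{\mathbb C^*}$ be the preimage of $\nabla'_\Gamma$ under the projection $L^\vee_{\mathbb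 C^*}\to(L^\vee_\Gamma)_{\mathbb C^*}$ dual to $L_\Gamma\hookrightarrow L$. The secondary toric variety $\mathfrak F$ is the toric variety of the secondary fan in $L^\vee$, a compactification of $L^\vee_{\mathbb C^*}$; $\overline\nabla_\Gamma$ is the closure of $\nabla_\Gamma$ in $\mathfrak F$ (with reduced structure), and $C_W\subset\mathfrak F$ is the toric rational curve corresponding to the codimension 1 cone $W$. $m_{\Gamma,W}$ is the total intersection multiplicity $\overline\nabla_\Gamma\cdot C_W$ (and is $0$ if $\nabla_\Gamma$ is not a hypersurface). *)

theory Defs
  imports
    "HOL-Complex_Analysis.Complex_Analysis"
    "HOL-Library.Multiset"
    "HOL-Library.Poly_Mapping"
begin

section \<open>Toric data\<close>

text \<open>
  A basis of the lattice of one-parameter subgroups is fixed, so that \<open>L\<close> and its dual are both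
  \<^typ>\<open>int ^ 'r\<close>, paired by \<open>pairing\<close>; the real vector space of the dual of \<open>L\<close> is
  \<^typ>\<open>real ^ 'r\<close>. The coordinates of \<open>V\<close> are indexed by the finite type \<^typ>\<open>'n\<close>.
\<close>

definition pairing :: "int ^ 'r \<Rightarrow> int ^ 'r::finite \<Rightarrow> int" where
  "pairing u v = (\<Sum>j\<in>UNIV. u $ j * v $ j)"

definition rvec :: "int ^ 'r \<Rightarrow> real ^ 'r::finite" where
  "rvec v = (\<chi> j. of_int (v $ j))"

definition lincomb :: "('n::finite \<Rightarrow> int ^ 'k) \<Rightarrow> int ^ 'n \<Rightarrow> int ^ 'k::finite" where
  "lincomb b k = (\<Sum>i\<in>UNIV. k $ i *s b i)"

text \<open>The map \<open>Q\<close> is \<open>lincomb q\<close>; its dual sends \<open>l\<close> to \<open>coweights q l\<close>.\<close>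

definition coweights :: "('n::finite \<Rightarrow> int ^ 'r) \<Rightarrow> int ^ 'r::finite \<Rightarrow> int ^ 'n" where
  "coweights q l = (\<chi> i. pairing (q i) l)"

definition toric_git_problem :: "('n::finite \<Rightarrow> int ^ 'r::finite) \<Rightarrow> bool" where
  "toric_git_problem q \<longleftrightarrow>
     finite (UNIV // {(u, v). u - v \<in> range (lincomb q)})"

definition calabi_yau :: "('n::finite \<Rightarrow> int ^ 'r::finite) \<Rightarrow> bool" where
  "calabi_yau q \<longleftrightarrow> (\<Sum>i\<in>UNIV. q i) = 0"

text \<open>
  \<open>is_rays q a\<close>: the map \<open>lincomb a\<close> presents \<^typ>\<open>int ^ 'd\<close> as the cokernel modulo torsion
  of \<open>coweights q\<close>, that is, it is onto and its kernel is the saturation of the image of \<open>L\<close>.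
\<close>

definition is_rays ::
    "('n::finite \<Rightarrow> int ^ 'r::finite) \<Rightarrow> ('n \<Rightarrow> int ^ 'd::finite) \<Rightarrow> bool" where
  "is_rays q a \<longleftrightarrow>
     surj (lincomb a) \<and>
     (\<forall>k. lincomb a k = 0 \<longleftrightarrow> (\<exists>m>0. \<exists>l. m *s k = coweights q l))"


section \<open>The secondary fan of a Higgs GIT problem\<close>

definition weight_cone :: "('n \<Rightarrow> int ^ 'r) \<Rightarrow> 'n set \<Rightarrow> (real ^ 'r::finite) set" where
  "weight_cone q I = convex_cone hull ((\<lambda>i. rvec (q i)) ` I)"

text \<open>
  The Higgs GIT problem of a subspace \<open>H\<close> is represented by the pair of \<open>q\<close> and \<open>H\<close>, with the
  weights \<open>higgs_weights q H\<close> and the lattice of integral points of \<open>H\<close>. The original GIT problem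
  is the case \<open>H = UNIV\<close>.
\<close>

definition higgs_weights :: "('n \<Rightarrow> int ^ 'r) \<Rightarrow> (real ^ 'r::finite) set \<Rightarrow> 'n set" where
  "higgs_weights q H = {i. rvec (q i) \<in> H}"

definition higgs_det :: "('n::finite \<Rightarrow> int ^ 'r) \<Rightarrow> (real ^ 'r::finite) set \<Rightarrow> int ^ 'r" where
  "higgs_det q H = (\<Sum>i\<in>higgs_weights q H. q i)"

definition secondary_cone ::
    "('n \<Rightarrow> int ^ 'r) \<Rightarrow> (real ^ 'r::finite) set \<Rightarrow> real ^ 'r \<Rightarrow> (real ^ 'r) set" where
  "secondary_cone q H \<theta> =
     \<Inter>{weight_cone q I | I. I \<subseteq> higgs_weights q H \<and> \<theta> \<in> weight_cone q I}"

definition secondary_fan ::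
    "('n \<Rightarrow> int ^ 'r) \<Rightarrow> (real ^ 'r::finite) set \<Rightarrow> (real ^ 'r) set set" where
  "secondary_fan q H = secondary_cone q H ` weight_cone q (higgs_weights q H)"

definition chambers :: "('n \<Rightarrow> int ^ 'r) \<Rightarrow> (real ^ 'r::finite) set \<Rightarrow> (real ^ 'r) set set" where
  "chambers q H = {C \<in> secondary_fan q H. dim C = dim H}"

definition walls :: "('n \<Rightarrow> int ^ 'r) \<Rightarrow> (real ^ 'r::finite) set \<Rightarrow> (real ^ 'r) set set" where
  "walls q H = {W \<in> secondary_fan q H. dim W + 1 = dim H}"


section \<open>The wall-crossing algorithm\<close>

text \<open>A phase is represented by its closed chamber, the empty phase by \<^const>\<open>None\<close>.\<close>

definition phase_across ::
    "('n \<Rightarrow> int ^ 'r) \<Rightarrow> (real ^ 'r::finite) set \<Rightarrow> (real ^ 'r) set \<Rightarrow> (real ^ 'r) set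
      \<Rightarrow> (real ^ 'r) set option" where
  "phase_across q H C W =
     (if \<exists>C'\<in>chambers q H. C' \<noteq> C \<and> W facet_of C'
      then Some (THE C'. C' \<in> chambers q H \<and> C' \<noteq> C \<and> W facet_of C')
      else None)"

text \<open>The chamber of the phase \<open>Z_W\<close> of the Higgs GIT problem of the span of \<open>W\<close>.\<close>

definition wall_phase :: "('n \<Rightarrow> int ^ 'r) \<Rightarrow> (real ^ 'r::finite) set \<Rightarrow> (real ^ 'r) set" where
  "wall_phase q W = (THE Z. Z \<in> chambers q (span W) \<and> rel_interior W \<subseteq> Z)"

text \<open>
  The normal of \<open>W\<close> lives in the dual of the lattice of integral points of \<open>H\<close>, which is a
  quotient of \<open>L\<close>; here it is given by a representative in \<open>L\<close>. It is primitive iff it maps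
  the integral points of \<open>H\<close> onto the integers.
\<close>

definition primitive_normal ::
    "(real ^ 'r::finite) set \<Rightarrow> (real ^ 'r) set \<Rightarrow> (real ^ 'r) set \<Rightarrow> int ^ 'r \<Rightarrow> bool" where
  "primitive_normal H C W l \<longleftrightarrow>
     (\<forall>w\<in>W. rvec l \<bullet> w = 0) \<and> (\<forall>v\<in>C. rvec l \<bullet> v \<ge> 0) \<and>
     (\<lambda>v. pairing v l) ` {v. rvec v \<in> H} = UNIV"

text \<open>
  \<open>decomposes q H X M\<close>: some run of the algorithm on the phase \<open>X\<close> of the Higgs GIT problem
  of \<open>H\<close> produces \<open>M\<close> as the multiset of its final factors, where \<open>K \<in># M\<close> stands for a
  factor given by the derived category of the non-empty minimal phase of the problem of \<open>K\<close>.
\<close>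

inductive decomposes ::
    "('n::finite \<Rightarrow> int ^ 'r::finite) \<Rightarrow> (real ^ 'r) set \<Rightarrow> (real ^ 'r) set option
      \<Rightarrow> (real ^ 'r) set multiset \<Rightarrow> bool" for q where
  empty: "decomposes q H None {#}"
| minimal: "decomposes q H (Some C) {#H#}"
    if "C \<in> chambers q H" "- rvec (higgs_det q H) \<in> C"
| cross: "decomposes q H (Some C) (M + repeat_mset (nat \<kappa>) M')"
    if "C \<in> chambers q H" "- rvec (higgs_det q H) \<notin> C"
       "W \<in> walls q H" "W facet_of C" "primitive_normal H C W l"
       "\<kappa> = pairing (higgs_det q H) l" "\<kappa> > 0"
       "decomposes q H (phase_across q H C W) M"
       "decomposes q (span W) (Some (wall_phase q W)) M'"

definition multiplicity_in_phase ::
    "('n::finite \<Rightarrow> int ^ 'r::finite) \<Rightarrow> (real ^ 'r) set \<Rightarrow> (real ^ 'r) set option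
      \<Rightarrow> (real ^ 'r) set \<Rightarrow> nat" where
  "multiplicity_in_phase q H X K = (THE m. \<exists>M. decomposes q H X M \<and> count M K = m)"


section \<open>Faces of the polytope\<close>

definition ray_polytope :: "('n \<Rightarrow> int ^ 'd) \<Rightarrow> (real ^ 'd::finite) set" where
  "ray_polytope a = convex hull (range (\<lambda>i. rvec (a i)))"

definition is_face :: "('n \<Rightarrow> int ^ 'd::finite) \<Rightarrow> 'n set \<Rightarrow> bool" where
  "is_face a \<Gamma> \<longleftrightarrow> (\<exists>F. F face_of ray_polytope a \<and> \<Gamma> = {i. rvec (a i) \<in> F})"

definition minimal_face :: "('n \<Rightarrow> int ^ 'd::finite) \<Rightarrow> 'n set \<Rightarrow> bool" where
  "minimal_face a \<Gamma> \<longleftrightarrow>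
     is_face a \<Gamma> \<and> (\<forall>i\<in>\<Gamma>. rvec (a i) \<in> span ((\<lambda>j. rvec (a j)) ` (\<Gamma> - {i})))"

definition face_subspace :: "('n \<Rightarrow> int ^ 'r) \<Rightarrow> 'n set \<Rightarrow> (real ^ 'r::finite) set" where
  "face_subspace q \<Gamma> = span ((\<lambda>i. rvec (q i)) ` (- \<Gamma>))"

definition n_mult :: "('n::finite \<Rightarrow> int ^ 'r::finite) \<Rightarrow> 'n set \<Rightarrow> (real ^ 'r) set \<Rightarrow> nat" where
  "n_mult q \<Gamma> W =
     multiplicity_in_phase q (span W) (Some (wall_phase q W)) (face_subspace q \<Gamma>)"


section \<open>Discriminants\<close>

text \<open>Points of the torus dual to a lattice \<open>G\<close>: homomorphisms from \<open>G\<close> to the non-zero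
  complex numbers; the values outside \<open>G\<close> are irrelevant.\<close>

definition torus_point :: "(int ^ 'k::finite) set \<Rightarrow> (int ^ 'k \<Rightarrow> complex) \<Rightarrow> bool" where
  "torus_point G x \<longleftrightarrow>
     (\<forall>u\<in>G. x u \<noteq> 0) \<and> (\<forall>u\<in>G. \<forall>v\<in>G. x (u + v) = x u * x v)"

definition face_lattice :: "('n::finite \<Rightarrow> int ^ 'd) \<Rightarrow> 'n set \<Rightarrow> (int ^ 'd::finite) set" where
  "face_lattice a \<Gamma> = {lincomb a k | k. \<forall>i. i \<notin> \<Gamma> \<longrightarrow> k $ i = 0}"

definition face_relations ::
    "('n::finite \<Rightarrow> int ^ 'r) \<Rightarrow> 'n set \<Rightarrow> (int ^ 'r::finite) set" where
  "face_relations q \<Gamma> = {l. \<forall>i. i \<notin> \<Gamma> \<longrightarrow> coweights q l $ i = 0}"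

definition potential ::
    "('n \<Rightarrow> int ^ 'd::finite) \<Rightarrow> 'n::finite set \<Rightarrow> ('n \<Rightarrow> complex) \<Rightarrow> (int ^ 'd \<Rightarrow> complex) \<Rightarrow> complex"
  where "potential a \<Gamma> c x = (\<Sum>i\<in>\<Gamma>. c i * x (a i))"

text \<open>
  The tangent space of the torus at \<open>x\<close> consists of the homomorphisms \<open>\<phi>\<close> from the lattice to
  the complex numbers, so the differential of the potential vanishes at \<open>x\<close> iff its derivative
  along each curve \<open>t \<mapsto> x exp (t \<phi>)\<close> vanishes at \<open>t = 0\<close>. Only the values of \<open>c\<close> on \<open>\<Gamma>\<close> matter.
\<close>

definition discriminant_locus ::
    "('n::finite \<Rightarrow> int ^ 'd::finite) \<Rightarrow> 'n set \<Rightarrow> ('n \<Rightarrow> complex) set" where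
  "discriminant_locus a \<Gamma> =
     {c. \<exists>x. torus_point (face_lattice a \<Gamma>) x \<and> potential a \<Gamma> c x = 0 \<and>
          (\<forall>\<phi>. (\<forall>u\<in>face_lattice a \<Gamma>. \<forall>v\<in>face_lattice a \<Gamma>. \<phi> (u + v) = \<phi> u + \<phi> v) \<longrightarrow>
            ((\<lambda>t. potential a \<Gamma> c (\<lambda>u. x u * exp (t * \<phi> u))) has_field_derivative 0) (at 0))}"

definition nabla' ::
    "('n::finite \<Rightarrow> int ^ 'r::finite) \<Rightarrow> ('n \<Rightarrow> int ^ 'd::finite) \<Rightarrow> 'n set
      \<Rightarrow> (int ^ 'r \<Rightarrow> complex) set" where
  "nabla' q a \<Gamma> =
     {restrict (\<lambda>l. \<Prod>i\<in>\<Gamma>. c i powi (coweights q l $ i)) (face_relations q \<Gamma>) | c.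
        c \<in> discriminant_locus a \<Gamma> \<and> (\<forall>i\<in>\<Gamma>. c i \<noteq> 0)}"

definition nabla ::
    "('n::finite \<Rightarrow> int ^ 'r::finite) \<Rightarrow> ('n \<Rightarrow> int ^ 'd::finite) \<Rightarrow> 'n set
      \<Rightarrow> (int ^ 'r \<Rightarrow> complex) set" where
  "nabla q a \<Gamma> = {y. torus_point UNIV y \<and> restrict y (face_relations q \<Gamma>) \<in> nabla' q a \<Gamma>}"

text \<open>
  Regular functions on the torus with character lattice \<open>L\<close> are Laurent polynomials, that is
  elements of the group ring \<^typ>\<open>(int ^ 'r) \<Rightarrow>\<^sub>0 complex\<close>. The set \<open>nabla\<close> need not be closed in the
  torus; it counts as a hypersurface if its Zariski closure is one.
\<close>

definition laurent_eval ::
    "((int ^ 'r) \<Rightarrow>\<^sub>0 complex) \<Rightarrow> (int ^ 'r::finite \<Rightarrow> complex) \<Rightarrow> complex" where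
  "laurent_eval f y = (\<Sum>m\<in>Poly_Mapping.keys f. Poly_Mapping.lookup f m * y m)"

definition torus_closure ::
    "(int ^ 'r::finite \<Rightarrow> complex) set \<Rightarrow> (int ^ 'r \<Rightarrow> complex) set" where
  "torus_closure Y =
     {y. torus_point UNIV y \<and> (\<forall>f. (\<forall>z\<in>Y. laurent_eval f z = 0) \<longrightarrow> laurent_eval f y = 0)}"

definition is_hypersurface :: "(int ^ 'r::finite \<Rightarrow> complex) set \<Rightarrow> bool" where
  "is_hypersurface Y \<longleftrightarrow>
     (\<exists>f. f \<noteq> 0 \<and> \<not> f dvd 1 \<and> torus_closure Y = {y. torus_point UNIV y \<and> laurent_eval f y = 0})"


section \<open>Intersection numbers in the secondary toric variety\<close>

text \<open>
  For a cone \<open>\<tau>\<close> of the fan, the affine chart \<open>U_\<tau>\<close> is the spectrum of the ring of Laurent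
  polynomials with exponents in \<open>dual_monoid \<tau>\<close>. The points of the torus orbit of \<open>\<tau>\<close> are the
  homomorphisms from \<open>perp_lattice \<tau>\<close> to the non-zero complex numbers; extended by zero they
  become points of \<open>U_\<tau>\<close>.
\<close>

definition dual_monoid :: "(real ^ 'r::finite) set \<Rightarrow> (int ^ 'r) set" where
  "dual_monoid \<tau> = {m. \<forall>u\<in>\<tau>. rvec m \<bullet> u \<ge> 0}"

definition perp_lattice :: "(real ^ 'r::finite) set \<Rightarrow> (int ^ 'r) set" where
  "perp_lattice \<tau> = {m. \<forall>u\<in>\<tau>. rvec m \<bullet> u = 0}"

definition torus_orbit :: "(real ^ 'r::finite) set \<Rightarrow> (int ^ 'r \<Rightarrow> complex) set" where
  "torus_orbit \<tau> =
     {x. torus_point (perp_lattice \<tau>) x \<and> (\<forall>m. m \<notin> perp_lattice \<tau> \<longrightarrow> x m = 0)}"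

text \<open>The orbit closure \<open>C_W\<close>: the union of the orbits of the cones of the fan containing \<open>W\<close>.
  A point is a pair of a cone and a point of its orbit.\<close>

definition toric_curve ::
    "('n \<Rightarrow> int ^ 'r::finite) \<Rightarrow> (real ^ 'r) set \<Rightarrow> ((real ^ 'r) set \<times> (int ^ 'r \<Rightarrow> complex)) set" where
  "toric_curve q W =
     {(\<tau>, x). \<tau> \<in> secondary_fan q UNIV \<and> W \<subseteq> \<tau> \<and> x \<in> torus_orbit \<tau>}"

text \<open>The ideal, in the coordinate ring of \<open>U_\<tau>\<close>, of the closure of \<open>Y\<close> with its reduced
  structure.\<close>

definition closure_ideal ::
    "(int ^ 'r::finite \<Rightarrow> complex) set \<Rightarrow> (real ^ 'r) set \<Rightarrow> ((int ^ 'r) \<Rightarrow>\<^sub>0 complex) set" where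
  "closure_ideal Y \<tau> = {f. Poly_Mapping.keys f \<subseteq> dual_monoid \<tau> \<and> (\<forall>y\<in>Y. laurent_eval f y = 0)}"

text \<open>
  The functions on the part of \<open>C_W\<close> in \<open>U_\<tau>\<close> have exponents in the intersection of
  \<open>dual_monoid \<tau>\<close> and \<open>perp_lattice W\<close>, which for a wall \<open>W\<close> is generated, as a monoid or
  (if \<open>\<tau> = W\<close>) as a group, by a single exponent. That exponent is the coordinate on this part of
  the curve, which is a copy of the affine line or of the punctured affine line.
\<close>

definition curve_coordinate :: "(real ^ 'r::finite) set \<Rightarrow> (real ^ 'r) set \<Rightarrow> int ^ 'r" where
  "curve_coordinate W \<tau> =
     (SOME l. perp_lattice W = range (\<lambda>k. k *s l) \<and> l \<in> dual_monoid \<tau>)"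

text \<open>Restricting to \<open>C_W\<close> kills the monomials with exponent outside \<open>perp_lattice W\<close>.\<close>

definition curve_restriction ::
    "int ^ 'r::finite \<Rightarrow> ((int ^ 'r) \<Rightarrow>\<^sub>0 complex) \<Rightarrow> complex \<Rightarrow> complex" where
  "curve_restriction l f s = (\<Sum>k | k *s l \<in> Poly_Mapping.keys f. Poly_Mapping.lookup f (k *s l) * s powi k)"

definition curve_order ::
    "int ^ 'r::finite \<Rightarrow> ((int ^ 'r) \<Rightarrow>\<^sub>0 complex) \<Rightarrow> complex \<Rightarrow> enat" where
  "curve_order l f s =
     (if \<forall>k. k *s l \<notin> Poly_Mapping.keys f then \<infinity> else enat (nat (zorder (curve_restriction l f) s)))"

text \<open>
  The local multiplicity is the colength of the ideal of the closure of \<open>Y\<close> in the local ring of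
  the smooth curve \<open>C_W\<close>, that is, the least order of vanishing of its elements; it is infinite if
  the closure contains \<open>C_W\<close>. This is the length of the scheme-theoretic intersection at the point,
  also at the torus-fixed points, where the variety may be singular. (If the closure is a Cartier
  divisor at the point, the colength is the order of vanishing of a local equation on \<open>C_W\<close>.)
\<close>

definition local_multiplicity ::
    "(int ^ 'r::finite \<Rightarrow> complex) set \<Rightarrow> (real ^ 'r) set
      \<Rightarrow> (real ^ 'r) set \<times> (int ^ 'r \<Rightarrow> complex) \<Rightarrow> enat" where
  "local_multiplicity Y W = (\<lambda>(\<tau>, x).
     let l = curve_coordinate W \<tau> in INF f\<in>closure_ideal Y \<tau>. curve_order l f (x l))"

definition intersection_number ::
    "('n \<Rightarrow> int ^ 'r::finite) \<Rightarrow> (int ^ 'r \<Rightarrow> complex) set \<Rightarrow> (real ^ 'r) set \<Rightarrow> enat" where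
  "intersection_number q Y W =
     (SUP P\<in>{P. finite P \<and> P \<subseteq> toric_curve q W}. \<Sum>p\<in>P. local_multiplicity Y W p)"

definition m_mult ::
    "('n::finite \<Rightarrow> int ^ 'r::finite) \<Rightarrow> ('n \<Rightarrow> int ^ 'd::finite) \<Rightarrow> 'n set \<Rightarrow> (real ^ 'r) set \<Rightarrow> enat"
  where
  "m_mult q a \<Gamma> W =
     (if is_hypersurface (nabla q a \<Gamma>) then intersection_number q (nabla q a \<Gamma>) W else 0)"

end

theory Submission
  imports Defs "HOL-Computational_Algebra.Fundamental_Theorem_Algebra"
begin

text \<open>
  Both multiplicities can be computed. Let \<open>p\<close> be the primitive integral vector on the wall \<open>W\<close>, let
  \<open>lam\<close> generate the annihilator of \<open>p\<close> in \<open>L\<close>, and let \<open>\<kappa>\<close> be the integer such that the weights on the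
  line \<open>\<langle>W\<rangle>\<close> add up to \<open>\<kappa> p\<close>. A relevant subspace contained in \<open>\<langle>W\<rangle>\<close> is either \<open>0\<close> or the whole line.

  On the side of the algorithm the Higgs problem of the line has rank one. Its chamber \<open>W\<close> is minimal
  unless \<open>\<kappa> > 0\<close>; if \<open>\<kappa> > 0\<close>, crossing the origin splits off \<open>\<kappa>\<close> copies of the factor of the zero
  subspace and leads to the opposite ray, whose phase is minimal or empty. So the multiplicity is
  \<open>max \<kappa> 0\<close> for \<open>H = 0\<close> (\<open>multiplicity_of_origin\<close>), and it is \<open>1\<close> for the line if there are weights on
  both sides of the origin (\<open>multiplicity_of_line\<close>), which holds for the line of a minimal face
  (\<open>face_outside_line\<close>).

  If \<open>H\<close> is the line, the face consists of the weights off the line, \<open>L_\<Gamma>\<close> is generated by \<open>lam\<close>, and by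
  Gale duality the reduced discriminant is one point. Its preimage is a coset \<open>y lam = \<rho>\<close> of a subtorus
  (\<open>nabla_outside_line\<close>), which meets \<open>C_W\<close> transversally in one point (\<open>coset_locus_intersection\<close>).

  If \<open>H = 0\<close>, the face is the whole polytope. By Horn and Kapranov its discriminant is the image of the
  map sending \<open>s\<close> to \<open>y l = (\<Prod>i. \<langle>q i, s\<rangle> powi \<langle>q i, l\<rangle>)\<close> (\<open>nabla_UNIV\<close>), which by the Calabi-Yau
  condition depends on \<open>s\<close> only as a point of a projective line. At the point \<open>s = lam\<close> the weights on
  \<open>\<langle>W\<rangle>\<close> vanish. There \<open>u = y lam\<close> takes the value \<open>\<rho>\<close>, a transversal coordinate \<open>v\<close> has order \<open>\<kappa>\<close>, and the
  logarithmic derivative of \<open>u\<close> is \<open>- \<kappa>\<close>, again because the weights add up to zero. If \<open>\<kappa> > 0\<close>, then \<open>u\<close> is a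
  local parameter, and the restriction to \<open>C_W\<close> of any function vanishing on the discriminant has
  order at least \<open>\<kappa>\<close> at \<open>\<rho>\<close> (\<open>horn_locus_lower_bound\<close>).

  The matching upper bound comes from elimination (\<open>horn_elimination\<close>). The product over the parameters
  \<open>t\<close> with \<open>v t = V\<close> of the numerators of \<open>u t - U\<close> is a polynomial \<open>G (U, V)\<close>. At \<open>V = 0\<close> the product runs
  over the zeros of \<open>v\<close>. The pair of orders of \<open>u\<close> and \<open>v\<close> at the point of a weight line is the sum of the weights on
  that line, so at a zero of \<open>v\<close> off \<open>\<langle>W\<rangle>\<close> the coordinate \<open>u\<close> is \<open>0\<close> or \<open>\<infinity>\<close>, and \<open>G (U, 0)\<close> is
  a constant times \<open>U ^ j * (U - \<rho>) ^ max \<kappa> 0\<close>. The zero set of \<open>G\<close> in the torus is the closure of the discriminant, which makes it a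
  hypersurface if \<open>\<kappa> > 0\<close>. At a torus-fixed point of \<open>C_W\<close> the same construction, with \<open>v\<close> replaced by the
  normal of the other edge of an empty sector around the chamber, gives a function with non-zero
  constant term, because no weight lies inside the sector (\<open>chambers_isolate_fixed_points\<close>). Hence the
  intersection number is \<open>max \<kappa> 0\<close>.
\<close>

section \<open>Polynomials in two variables and elimination\<close>
definition bipoly :: "complex poly poly \<Rightarrow> complex \<Rightarrow> complex \<Rightarrow> complex" where
  "bipoly G U V = poly (poly G [:V:]) U"

lemma bipoly_expand: "bipoly G U V = (\<Sum>j\<le>degree G. poly (coeff G j) U * V ^ j)"
  by (simp add: bipoly_def poly_altdef[of G] poly_sum poly_power)

lemma bipoly_zero_right: "bipoly G U 0 = poly (coeff G 0) U"
  by (simp add: bipoly_def poly_0_coeff_0)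

lemma poly_prod_mset_image: "poly (\<Prod>t\<in>#M. f t) x = (\<Prod>t\<in>#M. poly (f t) x)"
  for f :: "'b \<Rightarrow> 'a::comm_ring_1 poly"
  by (induction M) auto

lemma degree_prod_mset_linear:
  fixes f :: "'b \<Rightarrow> 'a::idom poly"
  assumes "\<And>t. degree (f t) \<le> 1"
  shows "degree (\<Prod>t\<in>#M. f t) \<le> size M"
proof (induction M)
  case (add x M)
  have "degree (f x * (\<Prod>t\<in>#M. f t)) \<le> degree (f x) + degree (\<Prod>t\<in>#M. f t)"
    by (rule degree_mult_le)
  also have "\<dots> \<le> 1 + size M" using add assms[of x] by linarith
  finally show ?case by simp
qed auto

lemma lagrange_interpolation_complex:
  fixes d :: nat
  obtains e :: "nat \<Rightarrow> complex poly"
  where "\<And>p V. degree p \<le> d \<Longrightarrow> poly p V = (\<Sum>k\<le>d. poly p (of_nat k) * poly (e k) V)"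
proof -
  define e :: "nat \<Rightarrow> complex poly" where
    "e k = (\<Prod>j\<in>{..d}-{k}. smult (1 / (of_nat k - of_nat j)) [:- of_nat j, 1:])" for k
  have deg: "degree (e k) \<le> d" if "k \<le> d" for k
  proof -
    have "degree (e k) \<le> (\<Sum>j\<in>{..d}-{k}. degree (smult (1 / (of_nat k - of_nat j :: complex)) [:- of_nat j, 1:]))"
      unfolding e_def by (rule order_trans[OF degree_prod_sum_le]) (auto simp: o_def)
    also have "\<dots> \<le> (\<Sum>j\<in>{..d}-{k}. 1)" by (intro sum_mono) auto
    also have "\<dots> = d" using that by (simp add: card_Diff_singleton)
    finally show ?thesis .
  qed
  have eval: "poly (e k) (of_nat i) = (if i = k then 1 else 0)" if "k \<le> d" "i \<le> d" for i k
  proof (cases "i = k")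
    case True
    have "poly (e k) (of_nat i) = (\<Prod>j\<in>{..d}-{k}. 1)"
      unfolding e_def poly_prod
      by (rule prod.cong) (auto simp: True diff_divide_distrib[symmetric])
    then show ?thesis using True by simp
  next
    case False
    then show ?thesis using that unfolding e_def poly_prod by (auto intro!: prod_zero bexI[of _ i])
  qed
  show thesis
  proof (rule that)
    fix p :: "complex poly" and V
    assume p: "degree p \<le> d"
    define r where "r = (\<Sum>k\<le>d. smult (poly p (of_nat k)) (e k))"
    have "p = r"
    proof (rule poly_eqI_degree)
      show "poly p x = poly r x" if x: "x \<in> of_nat ` {..d}" for x
      proof -
        obtain i where i: "i \<le> d" "x = of_nat i" using x by auto
        have "poly r x = (\<Sum>k\<le>d. if i = k then poly p (of_nat k) else 0)"
          unfolding r_def poly_sum by (rule sum.cong) (use i eval in auto)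
        also have "\<dots> = poly p x" using i by simp
        finally show ?thesis by simp
      qed
      have card: "card (of_nat ` {..d} :: complex set) = Suc d"
        by (subst card_image) (auto intro: inj_onI)
      then show "degree p < card (of_nat ` {..d} :: complex set)" using p by simp
      have "degree r \<le> d" unfolding r_def
        by (intro degree_sum_le) (auto intro: order_trans[OF degree_smult_le] deg)
      then show "degree r < card (of_nat ` {..d} :: complex set)" using card by simp
    qed
    then have "poly p V = poly r V" by simp
    then show "poly p V = (\<Sum>k\<le>d. poly p (of_nat k) * poly (e k) V)"
      by (simp add: r_def poly_sum)
  qed
qed

text \<open>
  Interpolation in \<open>V\<close> at \<open>d + 1\<close> fixed nodes writes \<open>F\<close> as a finite combination of functions
  that are polynomial in \<open>U\<close>, with coefficients polynomial in \<open>V\<close>. A uniform bound on the degree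
  is needed in one variable only.
\<close>
lemma separately_polynomial_imp_bipoly:
  fixes F :: "complex \<Rightarrow> complex \<Rightarrow> complex"
  assumes "\<And>V. \<exists>p. \<forall>U. F U V = poly p U"
    and "\<And>U. \<exists>p. degree p \<le> d \<and> (\<forall>V. F U V = poly p V)"
  shows "\<exists>G. \<forall>U V. F U V = bipoly G U V"
proof -
  obtain e :: "nat \<Rightarrow> complex poly"
    where e: "\<And>p V. degree p \<le> d \<Longrightarrow> poly p V = (\<Sum>k\<le>d. poly p (of_nat k) * poly (e k) V)"
    using lagrange_interpolation_complex[of d] by blast
  obtain P where P: "\<And>V U. F U V = poly (P V) U" using assms(1) by metis
  have F: "F U V = (\<Sum>k\<le>d. poly (P (of_nat k)) U * poly (e k) V)" for U V
  proof -
    obtain p where p: "degree p \<le> d" "\<And>V. F U V = poly p V" using assms(2)[of U] by blast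
    show ?thesis using e[OF p(1), of V] by (simp add: p(2)[symmetric] P[symmetric])
  qed
  \<comment> \<open>the outer variable is \<open>V\<close>, the coefficients are polynomials in \<open>U\<close>\<close>
  define G where "G = (\<Sum>k\<le>d. smult (P (of_nat k)) (map_poly (\<lambda>c. [:c:]) (e k)))"
  have lift: "poly (map_poly (\<lambda>c. [:c:]) f) [:V:] = [:poly f V:]" for f :: "complex poly" and V
    by (induction f) (auto simp: map_poly_pCons)
  have "bipoly G U V = F U V" for U V
    by (simp add: bipoly_def G_def poly_sum lift F mult.commute)
  then show ?thesis by metis
qed

text \<open>
  A substitute for the resultant of \<open>P - U Q\<close> and \<open>R - V S\<close> that avoids Sylvester matrices.
  The product on the right is visibly a polynomial in \<open>U\<close> for fixed \<open>V\<close>. For fixed \<open>U\<close>, exchanging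
  the two products turns it into a product over the roots of \<open>P - U Q\<close> of values of \<open>R - V S\<close>,
  hence into a polynomial in \<open>V\<close> of bounded degree. The degree condition makes \<open>R - V S\<close> monic of
  constant degree, so that no root escapes to infinity as \<open>V\<close> varies.
\<close>
lemma elimination:
  fixes P Q R S :: "complex poly"
  assumes R: "lead_coeff R = 1" and S: "degree S < degree R"
  obtains G where "\<And>U V. bipoly G U V = (\<Prod>t\<in>#proots (R - smult V S). poly P t - U * poly Q t)"
proof -
  define M where "M V = proots (R - smult V S)" for V
  define F where "F U V = (\<Prod>t\<in>#M V. poly P t - U * poly Q t)" for U V
  define n where "n = degree R"
  have degSV: "degree (smult V S) < degree R" for V
    using S degree_smult_le[of V S] by linarith
  have deg: "degree (R - smult V S) = n" for V
  proof -
    have "degree (- smult V S + R) = degree R" using degSV[of V] by (intro degree_add_eq_right) simp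
    then show ?thesis by (simp add: n_def)
  qed
  have lead: "lead_coeff (R - smult V S) = 1" for V
    using R S deg[of V] by (simp add: n_def coeff_eq_0)
  have split: "poly (R - smult V S) x = (\<Prod>t\<in>#M V. x - t)" for V x
  proof -
    have "R - smult V S = (\<Prod>t\<in>#M V. [:-t, 1:])"
      using complex_poly_decompose_multiset[of "R - smult V S"] lead[of V] by (simp add: M_def)
    then show ?thesis by (simp add: poly_prod_mset_image)
  qed
  have sizeM: "size (M V) = n" for V by (simp add: M_def size_proots_complex deg)
  have "\<exists>G. \<forall>U V. F U V = bipoly G U V"
  proof (rule separately_polynomial_imp_bipoly)
    fix V
    show "\<exists>p. \<forall>U. F U V = poly p U"
      by (intro exI[of _ "\<Prod>t\<in>#M V. [:poly P t, - poly Q t:]"])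
        (simp add: F_def poly_prod_mset_image)
  next
    fix U
    define f where "f = P - smult U Q"
    define c where "c = lead_coeff f"
    show "\<exists>p. degree p \<le> max (degree P) (degree Q) \<and> (\<forall>V. F U V = poly p V)"
    proof (cases "f = 0")
      case True
      have "F U V = 0" for V
      proof -
        have "size (M V) > 0" using sizeM[of V] S by (simp add: n_def)
        moreover have "poly P t - U * poly Q t = 0" for t
          using arg_cong[OF True, of "\<lambda>f. poly f t"] by (simp add: f_def)
        ultimately show ?thesis by (simp add: F_def)
      qed
      then show ?thesis by (intro exI[of _ 0]) auto
    next
      case False
      define N where "N = proots f"
      have f: "poly f t = c * (\<Prod>r\<in>#N. t - r)" for t
      proof -
        have "poly f t = poly (smult (lead_coeff f) (\<Prod>x\<in>#proots f. [:-x, 1:])) t"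
          by (simp only: complex_poly_decompose_multiset)
        then show ?thesis by (simp add: poly_prod_mset_image c_def N_def)
      qed
      define p where "p = smult (c ^ n) (\<Prod>r\<in>#N. [:(-1)^n * poly R r, - ((-1)^n * poly S r):])"
      have "F U V = poly p V" for V
      proof -
        have flip: "(\<Prod>t\<in>#A. t - r) = (-1) ^ size A * (\<Prod>t\<in>#A. r - t)" for A and r :: complex
          by (induction A) (auto simp: algebra_simps)
        have const: "(\<Prod>t\<in>#A. c * g t) = c ^ size A * (\<Prod>t\<in>#A. g t)" for A and g :: "complex \<Rightarrow> complex"
          by (induction A) (auto simp: algebra_simps)
        have "F U V = (\<Prod>t\<in>#M V. c * (\<Prod>r\<in>#N. t - r))"
          by (simp add: F_def f[symmetric] f_def)
        also have "\<dots> = c ^ n * (\<Prod>r\<in>#N. \<Prod>t\<in>#M V. t - r)"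
          by (subst prod_mset.swap) (simp add: const sizeM)
        also have "\<dots> = c ^ n * (\<Prod>r\<in>#N. (-1) ^ n * poly (R - smult V S) r)"
          by (simp only: flip split sizeM)
        also have "\<dots> = poly p V"
          by (simp add: p_def poly_prod_mset_image algebra_simps)
        finally show ?thesis .
      qed
      moreover have "degree p \<le> max (degree P) (degree Q)"
      proof -
        have "degree p \<le> size N" unfolding p_def
          by (rule order_trans[OF degree_smult_le]) (intro degree_prod_mset_linear, simp)
        also have "\<dots> = degree f" by (simp add: N_def size_proots_complex)
        also have "\<dots> \<le> max (degree P) (degree Q)" unfolding f_def
          using degree_diff_le_max[of P "smult U Q"] degree_smult_le[of U Q] by linarith
        finally show ?thesis .
      qed
      ultimately show ?thesis by blast
    qed
  qed
  then show thesis using that unfolding F_def M_def by metis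
qed

section \<open>Laurent polynomials on a torus\<close>
lemma torus_point_zero:
  assumes "torus_point G y" "0 \<in> G"
  shows "y 0 = 1"
proof -
  have "y (0 + 0) = y 0 * y 0" "y 0 \<noteq> 0" using assms unfolding torus_point_def by blast+
  then show ?thesis by simp
qed

text \<open>
  The lattice need not be everything: the points of the orbit of a ray are homomorphisms
  defined on the multiples of a single exponent.
\<close>
lemma torus_point_smult:
  assumes y: "torus_point G y" and G: "\<And>k. k *s l \<in> G"
  shows "y (k *s l) = y l powi k"
proof -
  have l: "l \<in> G" using G[of 1] by simp
  have zero: "0 \<in> G" using G[of 0] by simp
  have ne: "y (k *s l) \<noteq> 0" for k using y G unfolding torus_point_def by blast
  have add: "y ((j + k) *s l) = y (j *s l) * y (k *s l)" for j k
  proof -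
    have "(j + k) *s l = j *s l + k *s l" by (simp add: vec_eq_iff algebra_simps)
    then show ?thesis using y G unfolding torus_point_def by metis
  qed
  have nat: "y (int n *s l) = y l ^ n" for n
  proof (induction n)
    case 0 then show ?case using torus_point_zero[OF y zero] by simp
  next
    case (Suc n)
    have "y (int (Suc n) *s l) = y (int n *s l) * y (1 *s l)" using add[of "int n" 1] by (simp add: add.commute)
    then show ?case using Suc by simp
  qed
  show ?thesis
  proof (cases "k \<ge> 0")
    case True
    then show ?thesis using nat[of "nat k"] by (simp add: power_int_def)
  next
    case False
    have "y (k *s l) * y (int (nat (-k)) *s l) = y 0"
      using add[of k "-k"] False by simp
    then have "y (k *s l) * y l ^ nat (-k) = 1"
      using nat[of "nat (-k)"] torus_point_zero[OF y zero] by simp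
    then have "inverse (y l ^ nat (-k)) = y (k *s l)" by (intro inverse_unique) (simp add: mult.commute)
    then show ?thesis using False by (simp add: power_int_def power_inverse)
  qed
qed

lemma torus_point_UNIV_add: "torus_point UNIV y \<Longrightarrow> y (u + v) = y u * y v"
  by (simp add: torus_point_def)

lemma torus_point_UNIV_smult: "torus_point UNIV y \<Longrightarrow> y (k *s u) = y u powi k"
  by (rule torus_point_smult) auto

lemma torus_point_UNIV_nonzero: "torus_point UNIV y \<Longrightarrow> y u \<noteq> 0"
  by (simp add: torus_point_def)

lemma laurent_eval_superset:
  assumes "finite A" "Poly_Mapping.keys f \<subseteq> A"
  shows "laurent_eval f y = (\<Sum>m\<in>A. Poly_Mapping.lookup f m * y m)"
  unfolding laurent_eval_def
  by (rule sum.mono_neutral_left) (use assms in \<open>auto simp: in_keys_iff\<close>)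

lemma laurent_eval_zero [simp]: "laurent_eval 0 y = 0"
  by (simp add: laurent_eval_def)

lemma laurent_eval_add: "laurent_eval (f + g) y = laurent_eval f y + laurent_eval g y"
proof -
  let ?A = "Poly_Mapping.keys f \<union> Poly_Mapping.keys g"
  have "laurent_eval h y = (\<Sum>m\<in>?A. Poly_Mapping.lookup h m * y m)" if "h \<in> {f, g, f + g}" for h
    by (rule laurent_eval_superset) (use that keys_add[of f g] in auto)
  then show ?thesis by (simp add: lookup_add algebra_simps sum.distrib)
qed

lemma laurent_eval_sum: "laurent_eval (\<Sum>i\<in>A. f i) y = (\<Sum>i\<in>A. laurent_eval (f i) y)"
  by (induction A rule: infinite_finite_induct) (auto simp: laurent_eval_add)

lemma laurent_eval_single [simp]: "laurent_eval (Poly_Mapping.single m c) y = c * y m"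
  by (subst laurent_eval_superset[of "{m}"]) (auto simp: lookup_single)

lemma poly_mapping_eq_sum_single:
  "f = (\<Sum>m\<in>Poly_Mapping.keys f. Poly_Mapping.single m (Poly_Mapping.lookup f m))"
proof (rule poly_mapping_eqI)
  fix k
  have "(\<Sum>m\<in>Poly_Mapping.keys f. Poly_Mapping.lookup f m when m = k)
      = (\<Sum>m\<in>Poly_Mapping.keys f. if m = k then Poly_Mapping.lookup f k else 0)"
    by (rule sum.cong) (auto simp: when_def)
  then show "Poly_Mapping.lookup f k =
    Poly_Mapping.lookup (\<Sum>m\<in>Poly_Mapping.keys f. Poly_Mapping.single m (Poly_Mapping.lookup f m)) k"
    by (simp add: lookup_sum lookup_single in_keys_iff)
qed

lemma laurent_eval_mult:
  assumes y: "torus_point UNIV y"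
  shows "laurent_eval (f * g) y = laurent_eval f y * laurent_eval g y"
proof -
  have "f * g = (\<Sum>m\<in>Poly_Mapping.keys f. \<Sum>k\<in>Poly_Mapping.keys g.
      Poly_Mapping.single (m + k) (Poly_Mapping.lookup f m * Poly_Mapping.lookup g k))"
    by (subst poly_mapping_eq_sum_single[of f], subst poly_mapping_eq_sum_single[of g])
      (simp add: sum_product mult_single)
  then have "laurent_eval (f * g) y = (\<Sum>m\<in>Poly_Mapping.keys f. \<Sum>k\<in>Poly_Mapping.keys g.
      Poly_Mapping.lookup f m * Poly_Mapping.lookup g k * (y m * y k))"
    by (simp only: laurent_eval_sum laurent_eval_single torus_point_UNIV_add[OF y])
  also have "\<dots> = laurent_eval f y * laurent_eval g y"
    by (simp add: laurent_eval_def sum_product mult_ac)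
  finally show ?thesis .
qed

text \<open>
  Evaluation at a torus point is a ring homomorphism, so a unit vanishes nowhere.
\<close>
lemma not_unit_if_laurent_zero:
  assumes y: "torus_point UNIV y" and f: "laurent_eval f y = 0"
  shows "\<not> f dvd 1"
proof
  assume "f dvd 1"
  then obtain g where "1 = f * g" by (auto simp: dvd_def)
  then have "laurent_eval 1 y = 0" using laurent_eval_mult[OF y, of f g] f by simp
  moreover have "laurent_eval 1 y = 1"
    using laurent_eval_single[of 0 1 y] torus_point_zero[OF y] by (simp del: laurent_eval_single)
  ultimately show False by simp
qed

definition laurent_of_bipoly ::
    "int ^ 'r::finite \<Rightarrow> int ^ 'r \<Rightarrow> complex poly poly \<Rightarrow> (int ^ 'r) \<Rightarrow>\<^sub>0 complex" where
  "laurent_of_bipoly l m G = (\<Sum>j\<le>degree G. \<Sum>i\<le>degree (coeff G j).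
     Poly_Mapping.single (int i *s l + int j *s m) (coeff (coeff G j) i))"

lemma laurent_eval_of_bipoly:
  assumes y: "torus_point UNIV y"
  shows "laurent_eval (laurent_of_bipoly l m G) y = bipoly G (y l) (y m)"
  by (simp add: laurent_of_bipoly_def bipoly_expand laurent_eval_sum poly_altdef
      torus_point_UNIV_add[OF y] torus_point_UNIV_smult[OF y] sum_distrib_left mult_ac)

lemma keys_laurent_of_bipoly:
  assumes "k \<in> Poly_Mapping.keys (laurent_of_bipoly l m G)"
  obtains i j :: nat where "k = int i *s l + int j *s m"
proof -
  have "Poly_Mapping.lookup (laurent_of_bipoly l m G) k \<noteq> 0" using assms by (simp add: in_keys_iff)
  then have "\<exists>j\<in>{..degree G}. \<exists>i\<in>{..degree (coeff G j)}.
      (coeff (coeff G j) i when int i *s l + int j *s m = k) \<noteq> 0"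
    unfolding laurent_of_bipoly_def lookup_sum lookup_single
    by (meson sum.not_neutral_contains_not_neutral)
  then show thesis using that by (auto simp: when_def split: if_splits)
qed

text \<open>
  Restriction to the toric curve keeps the monomials with exponent in \<open>\<int> l\<close>; by independence of \<open>l\<close>
  and \<open>m\<close> these are the monomials of \<open>G\<close> without \<open>V\<close>.
\<close>
lemma lookup_laurent_of_bipoly:
  assumes indep: "\<And>a b. a *s l + b *s m = 0 \<Longrightarrow> a = 0 \<and> b = 0"
  shows "Poly_Mapping.lookup (laurent_of_bipoly l m G) (k *s l)
       = (if k \<ge> 0 then coeff (coeff G 0) (nat k) else 0)"
proof -
  have eq: "int i *s l + int j *s m = k *s l \<longleftrightarrow> int i = k \<and> j = 0" for i j
  proof
    assume "int i *s l + int j *s m = k *s l"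
    then have "(int i - k) *s l + int j *s m = 0" by (simp add: vec_eq_iff algebra_simps)
    from indep[OF this] show "int i = k \<and> j = 0" by simp
  qed auto
  have "Poly_Mapping.lookup (laurent_of_bipoly l m G) (k *s l)
      = (\<Sum>j\<le>degree G. \<Sum>i\<le>degree (coeff G j). if int i = k \<and> j = 0 then coeff (coeff G j) i else 0)"
    by (simp add: laurent_of_bipoly_def lookup_sum lookup_single when_def eq)
  also have "\<dots> = (\<Sum>j\<le>degree G. if j = 0 then (\<Sum>i\<le>degree (coeff G 0). if int i = k then coeff (coeff G 0) i else 0) else 0)"
    by (rule sum.cong) auto
  also have "\<dots> = (\<Sum>i\<le>degree (coeff G 0). if int i = k then coeff (coeff G 0) i else 0)" by simp
  also have "\<dots> = (if k \<ge> 0 then coeff (coeff G 0) (nat k) else 0)"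
  proof (cases "k \<ge> 0")
    case True
    have "(\<Sum>i\<le>degree (coeff G 0). if int i = k then coeff (coeff G 0) i else 0)
      = (\<Sum>i\<le>degree (coeff G 0). if i = nat k then coeff (coeff G 0) (nat k) else 0)"
      using True by (intro sum.cong) auto
    then show ?thesis using True by (auto simp: coeff_eq_0)
  qed auto
  finally show ?thesis .
qed

lemma laurent_of_bipoly_nonzero:
  assumes indep: "\<And>a b. a *s l + b *s m = 0 \<Longrightarrow> a = 0 \<and> b = 0" and "coeff G 0 \<noteq> 0"
  shows "laurent_of_bipoly l m G \<noteq> 0"
proof
  assume "laurent_of_bipoly l m G = 0"
  then have "coeff (coeff G 0) n = 0" for n
    using lookup_laurent_of_bipoly[OF indep, where l=l and m=m and G=G and k="int n"] by simp
  then show False using assms(2) by (simp add: poly_eq_iff)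
qed

section \<open>Orders of vanishing on the toric curve\<close>
lemma zorder_poly_mult:
  assumes "p \<noteq> 0" and h: "h analytic_on {s}" "h s \<noteq> 0"
    and g: "\<forall>\<^sub>F w in at s. g w = poly p w * h w"
  shows "zorder g s = int (order s p)"
proof -
  obtain r where r: "p = [:-s, 1:] ^ order s p * r" "\<not> [:-s, 1:] dvd r"
    using order_decomp[OF assms(1)] by blast
  obtain S where S: "open S" "s \<in> S" "h holomorphic_on S" using h(1) by (auto simp: analytic_at)
  have "zorder (\<lambda>w. poly p w * h w) s = int (order s p)"
  proof (rule zorder_eqI[where S=S and g="\<lambda>w. poly r w * h w"])
    show "(\<lambda>w. poly r w * h w) holomorphic_on S" by (intro holomorphic_intros S(3))
    show "poly r s * h s \<noteq> 0" using r(2) h(2) by (simp add: poly_eq_0_iff_dvd)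
    show "poly p w * h w = poly r w * h w * (w - s) powi int (order s p)" for w
      by (subst r(1)) simp
  qed (use S in auto)
  then show ?thesis using zorder_cong[OF g refl] by simp
qed

text \<open>
  A Laurent polynomial in one variable is a polynomial up to a power of the variable, and that
  power does not change orders away from \<open>0\<close>.
\<close>
lemma curve_restriction_as_poly:
  fixes l :: "int ^ 'r::finite"
  assumes l: "l \<noteq> 0" and f: "\<exists>k. k *s l \<in> Poly_Mapping.keys f"
  obtains p N where "p \<noteq> 0" "\<And>s. s \<noteq> 0 \<Longrightarrow> curve_restriction l f s = poly p s / s ^ N"
    "\<And>s. s \<noteq> 0 \<Longrightarrow> curve_order l f s = enat (order s p)"
proof -
  define K where "K = {k. k *s l \<in> Poly_Mapping.keys f}"
  have inj: "inj (\<lambda>k::int. k *s l)"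
    using l by (intro injI) (auto simp: vec_eq_iff)
  have fin: "finite K" unfolding K_def
    using finite_vimageI[OF finite_keys inj, of f] by (simp add: vimage_def)
  obtain N :: nat where N: "\<And>k. k \<in> K \<Longrightarrow> - int N \<le> k"
  proof
    fix k assume "k \<in> K"
    then have "nat \<bar>k\<bar> \<le> Max ((\<lambda>k. nat \<bar>k\<bar>) ` K)" using fin by (intro Max_ge) auto
    then show "- int (Max ((\<lambda>k. nat \<bar>k\<bar>) ` K)) \<le> k" by linarith
  qed
  define p where "p = (\<Sum>k\<in>K. monom (Poly_Mapping.lookup f (k *s l)) (nat (k + int N)))"
  have res: "curve_restriction l f s = poly p s / s ^ N" if s: "s \<noteq> 0" for s
  proof -
    have "s powi k = s ^ nat (k + int N) / s ^ N" if "k \<in> K" for k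
    proof -
      have "s ^ nat (k + int N) = s powi (k + int N)" using N[OF that] by (simp add: power_int_def)
      also have "\<dots> = s powi k * s ^ N" using s by (simp add: power_int_add)
      finally show ?thesis using s by simp
    qed
    then show ?thesis
      unfolding curve_restriction_def p_def K_def[symmetric] poly_sum poly_monom sum_divide_distrib
      by (intro sum.cong) auto
  qed
  have p0: "p \<noteq> 0"
  proof -
    obtain k where k: "k \<in> K" using f by (auto simp: K_def)
    have "coeff p (nat (k + int N)) = (\<Sum>j\<in>K. if j = k then Poly_Mapping.lookup f (j *s l) else 0)"
      unfolding p_def coeff_sum coeff_monom
    proof (rule sum.cong)
      fix j assume j: "j \<in> K"
      have "nat (j + int N) = nat (k + int N) \<longleftrightarrow> j = k" using N[OF j] N[OF k] by auto
      then show "(if nat (j + int N) = nat (k + int N) then Poly_Mapping.lookup f (j *s l) else 0)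
          = (if j = k then Poly_Mapping.lookup f (j *s l) else 0)" by simp
    qed simp
    then have "coeff p (nat (k + int N)) = Poly_Mapping.lookup f (k *s l)" using fin k by simp
    then show ?thesis using k by (auto simp: K_def in_keys_iff)
  qed
  have "curve_order l f s = enat (order s p)" if s: "s \<noteq> 0" for s
  proof -
    have "zorder (curve_restriction l f) s = int (order s p)"
    proof (rule zorder_poly_mult[OF p0])
      show "(\<lambda>w. inverse (w ^ N)) analytic_on {s}" using s by (intro analytic_intros) auto
      show "inverse (s ^ N) \<noteq> 0" using s by simp
      have "\<forall>\<^sub>F w in at s. w \<noteq> 0" using s by (intro tendsto_imp_eventually_ne[OF tendsto_ident_at])
      then show "\<forall>\<^sub>F w in at s. curve_restriction l f w = poly p w * inverse (w ^ N)"
        by eventually_elim (simp add: res divide_inverse)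
    qed
    then show ?thesis using f by (auto simp: curve_order_def)
  qed
  with p0 res show thesis using that by blast
qed

lemma curve_order_laurent_of_bipoly:
  fixes l m :: "int ^ 'r::finite"
  assumes indep: "\<And>a b. a *s l + b *s m = 0 \<Longrightarrow> a = 0 \<and> b = 0" and G: "coeff G 0 \<noteq> 0"
  shows "curve_order l (laurent_of_bipoly l m G) s = enat (order s (coeff G 0))"
proof -
  let ?f = "laurent_of_bipoly l m G" and ?g = "coeff G 0"
  have look: "Poly_Mapping.lookup ?f (k *s l) = (if k \<ge> 0 then coeff ?g (nat k) else 0)" for k
    by (rule lookup_laurent_of_bipoly[OF indep])
  have ex: "\<exists>k. k *s l \<in> Poly_Mapping.keys ?f"
  proof -
    obtain n where "coeff ?g n \<noteq> 0" using G by (metis leading_coeff_0_iff)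
    then show ?thesis by (intro exI[of _ "int n"]) (simp add: in_keys_iff look)
  qed
  have "curve_restriction l ?f s = poly ?g s" for s
  proof -
    have "curve_restriction l ?f s = (\<Sum>k\<in>int ` {n. coeff ?g n \<noteq> 0}. coeff ?g (nat k) * s powi k)"
      unfolding curve_restriction_def
    proof (rule sum.cong)
      show "{k. k *s l \<in> Poly_Mapping.keys ?f} = int ` {n. coeff ?g n \<noteq> 0}"
        by (auto simp: in_keys_iff look image_iff split: if_splits) (metis nat_0_le)
    qed (auto simp: look)
    also have "\<dots> = (\<Sum>n | coeff ?g n \<noteq> 0. coeff ?g n * s ^ n)"
      by (subst sum.reindex) auto
    also have "\<dots> = (\<Sum>n\<le>degree ?g. coeff ?g n * s ^ n)"
      by (rule sum.mono_neutral_left) (auto intro: le_degree)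
    finally show ?thesis by (simp add: poly_altdef)
  qed
  then have "zorder (curve_restriction l ?f) s = int (order s ?g)"
    by (intro zorder_poly_mult[OF G, where h="\<lambda>_. 1"]) auto
  then show ?thesis using ex by (auto simp: curve_order_def)
qed

text \<open>
  The mechanism behind the lower bound for the intersection multiplicity. If \<open>f\<close> vanishes along
  a path \<open>(u t, v t)\<close> on which \<open>v\<close> vanishes to order \<open>n\<close>, then the part of \<open>f\<close> without \<open>v\<close> is
  \<open>O (t ^ n)\<close> along the path; as \<open>u\<close> is a local parameter of the axis at \<open>\<rho>\<close>, that part vanishes to
  order at least \<open>n\<close> there.
\<close>
lemma curve_order_ge_of_path:
  fixes l :: "int ^ 'r::finite" and u v :: "complex \<Rightarrow> complex" and b :: "'k \<Rightarrow> nat"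
  assumes l: "l \<noteq> 0" and rho: "\<rho> \<noteq> 0"
    and u: "((\<lambda>t. (u t - \<rho>) / t) \<longlongrightarrow> w) (at 0)" "w \<noteq> 0"
    and v: "((\<lambda>t. v t / t ^ n) \<longlongrightarrow> v0) (at 0)"
    and fin: "finite B" and b: "\<And>m. m \<in> B \<Longrightarrow> b m > 0"
    and vanish: "\<forall>\<^sub>F t in at 0. curve_restriction l f (u t) + (\<Sum>m\<in>B. c m * u t powi a m * v t ^ b m) = 0"
  shows "enat n \<le> curve_order l f \<rho>"
proof (cases "\<exists>k. k *s l \<in> Poly_Mapping.keys f")
  case False
  then show ?thesis by (auto simp: curve_order_def)
next
  case True
  obtain p N where p: "p \<noteq> 0" "\<And>s. s \<noteq> 0 \<Longrightarrow> curve_restriction l f s = poly p s / s ^ N"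
    "\<And>s. s \<noteq> 0 \<Longrightarrow> curve_order l f s = enat (order s p)"
    using curve_restriction_as_poly[OF l True] by metis
  define o' where "o' = order \<rho> p"
  obtain r where r: "p = [:-\<rho>, 1:] ^ o' * r" "\<not> [:-\<rho>, 1:] dvd r"
    using order_decomp[OF p(1), of \<rho>] unfolding o'_def by blast
  have "\<not> o' < n"
  proof
    assume less: "o' < n"
    have t0: "((\<lambda>t. t) \<longlongrightarrow> (0::complex)) (at 0)" by (rule tendsto_ident_at)
    have nz: "\<forall>\<^sub>F t in at 0. t \<noteq> (0::complex)" by (simp add: eventually_at_filter)
    have ulim: "(u \<longlongrightarrow> \<rho>) (at 0)"
    proof -
      have "((\<lambda>t. \<rho> + (u t - \<rho>) / t * t) \<longlongrightarrow> \<rho> + w * 0) (at 0)"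
        by (intro tendsto_intros u t0)
      moreover have "\<forall>\<^sub>F t in at 0. \<rho> + (u t - \<rho>) / t * t = u t" using nz by eventually_elim simp
      ultimately show ?thesis using Lim_transform_eventually by fastforce
    qed
    have vlim: "(v \<longlongrightarrow> 0) (at 0)"
    proof -
      have "((\<lambda>t. v t / t ^ n * t ^ n) \<longlongrightarrow> v0 * 0 ^ n) (at 0)"
        by (intro tendsto_intros v t0)
      moreover have "\<forall>\<^sub>F t in at 0. v t / t ^ n * t ^ n = v t" using nz by eventually_elim simp
      ultimately have "(v \<longlongrightarrow> v0 * 0 ^ n) (at 0)" by (rule Lim_transform_eventually)
      moreover have "(0::complex) ^ n = 0" using less by (simp add: power_0_left)
      ultimately show ?thesis by simp
    qed
    have zero: "(0::complex) ^ (n - o') = 0" using less by (simp add: power_0_left)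
    have lim1: "((\<lambda>t. ((u t - \<rho>) / t) ^ o' * poly r (u t)) \<longlongrightarrow> w ^ o' * poly r \<rho>) (at 0)"
      by (intro tendsto_mult tendsto_power u isCont_tendsto_compose[OF poly_isCont ulim])
    have "((\<lambda>t. - (u t ^ N * (\<Sum>m\<in>B. c m * u t powi a m * (v t ^ (b m - 1) * (v t / t ^ n) * t ^ (n - o')))))
        \<longlongrightarrow> - (\<rho> ^ N * (\<Sum>m\<in>B. c m * \<rho> powi a m * (0 ^ (b m - 1) * v0 * 0 ^ (n - o'))))) (at 0)"
      using rho by (intro tendsto_intros ulim vlim v t0) auto
    then have lim2: "((\<lambda>t. - (u t ^ N * (\<Sum>m\<in>B. c m * u t powi a m * (v t ^ (b m - 1) * (v t / t ^ n) * t ^ (n - o')))))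
        \<longlongrightarrow> 0) (at 0)" by (simp only: zero mult_zero_right sum.neutral_const minus_zero)
    have eq: "\<forall>\<^sub>F t in at 0. ((u t - \<rho>) / t) ^ o' * poly r (u t)
        = - (u t ^ N * (\<Sum>m\<in>B. c m * u t powi a m * (v t ^ (b m - 1) * (v t / t ^ n) * t ^ (n - o'))))"
      using vanish nz tendsto_imp_eventually_ne[OF ulim rho]
    proof eventually_elim
      case (elim t)
      have pt: "poly p (u t) = (u t - \<rho>) ^ o' * poly r (u t)" by (subst r(1)) simp
      have v': "v t ^ b m / t ^ o' = v t ^ (b m - 1) * (v t / t ^ n) * t ^ (n - o')" if "m \<in> B" for m
      proof -
        have "v t ^ b m = v t ^ (b m - 1) * v t" using b[OF that] by (cases "b m") auto
        moreover have "t ^ n = t ^ (n - o') * t ^ o'" using less by (simp flip: power_add)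
        ultimately show ?thesis using elim(2) by simp
      qed
      have "poly p (u t) = - (u t ^ N * (\<Sum>m\<in>B. c m * u t powi a m * v t ^ b m))"
        using elim by (simp add: p(2) field_simps add_eq_0_iff)
      then have "(u t - \<rho>) ^ o' * poly r (u t) / t ^ o'
        = - (u t ^ N * (\<Sum>m\<in>B. c m * u t powi a m * (v t ^ b m / t ^ o')))"
        by (simp only: pt[symmetric] sum_divide_distrib[symmetric] times_divide_eq_right minus_divide_left)
      then show ?case by (simp only: v' power_divide times_divide_eq_left cong: sum.cong)
    qed
    have "w ^ o' * poly r \<rho> = 0"
      by (rule tendsto_unique[OF _ Lim_transform_eventually[OF lim1 eq] lim2]) simp
    then show False using u(2) r(2) by (auto simp: poly_eq_0_iff_dvd)
  qed
  then show ?thesis using p(3)[OF rho] by (simp add: o'_def)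
qed

section \<open>The Horn curve in the plane\<close>
definition weight_form :: "('n \<Rightarrow> int) \<Rightarrow> ('n \<Rightarrow> int) \<Rightarrow> 'n \<Rightarrow> complex \<Rightarrow> complex \<Rightarrow> complex" where
  "weight_form x y i s1 s2 = of_int (x i) * s1 + of_int (y i) * s2"

text \<open>
  The \<open>e\<close>-component of the Horn uniformisation: a product of linear forms raised to integer
  exponents. With \<open>e\<close> equal to \<open>x\<close> and to \<open>y\<close> it gives the two coordinates of a plane curve.
\<close>
definition horn :: "('n::finite \<Rightarrow> int) \<Rightarrow> ('n \<Rightarrow> int) \<Rightarrow> ('n \<Rightarrow> int) \<Rightarrow> complex \<Rightarrow> complex \<Rightarrow> complex" where
  "horn x y e s1 s2 = (\<Prod>i\<in>UNIV. weight_form x y i s1 s2 powi e i)"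

text \<open>
  This is where the Calabi-Yau condition first enters: the curve is parametrised by a projective
  line.
\<close>
lemma horn_scale:
  assumes "(\<Sum>i\<in>UNIV. e i) = 0" "c \<noteq> 0"
  shows "horn x y e (c * s1) (c * s2) = horn x y e s1 s2"
proof -
  have pow: "(\<Prod>i\<in>A. c powi e i) = c powi (\<Sum>i\<in>A. e i)" if "finite A" for A
    using that by induction (auto simp: power_int_add assms(2))
  have "horn x y e (c * s1) (c * s2) = (\<Prod>i\<in>UNIV. (c * weight_form x y i s1 s2) powi e i)"
    by (simp add: horn_def weight_form_def algebra_simps)
  also have "\<dots> = (\<Prod>i\<in>UNIV. c powi e i) * horn x y e s1 s2"
    by (simp add: horn_def power_int_mult_distrib prod.distrib)
  finally show ?thesis using pow[of UNIV] assms by simp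
qed

text \<open>
  Linear forms \<open>c i + t * d i\<close> in one parameter. Distinct forms may share their root, and then their
  exponents add up; a product of powers of the forms has to be regrouped by roots before its
  numerator and denominator are coprime.
\<close>
definition lin_root :: "('n \<Rightarrow> complex) \<Rightarrow> ('n \<Rightarrow> complex) \<Rightarrow> 'n \<Rightarrow> complex" where
  "lin_root c d i = - c i / d i"

definition lin_roots :: "('n \<Rightarrow> complex) \<Rightarrow> ('n \<Rightarrow> complex) \<Rightarrow> complex set" where
  "lin_roots c d = lin_root c d ` {i. d i \<noteq> 0}"

definition root_exponent :: "('n \<Rightarrow> complex) \<Rightarrow> ('n \<Rightarrow> complex) \<Rightarrow> ('n \<Rightarrow> int) \<Rightarrow> complex \<Rightarrow> int" where
  "root_exponent c d e a = (\<Sum>i | d i \<noteq> 0 \<and> lin_root c d i = a. e i)"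

definition root_prod :: "('n::finite \<Rightarrow> complex) \<Rightarrow> ('n \<Rightarrow> complex) \<Rightarrow> (complex \<Rightarrow> int) \<Rightarrow> complex poly" where
  "root_prod c d E = (\<Prod>a\<in>lin_roots c d. [:-a, 1:] ^ nat (E a))"

text \<open>
  The leading constant; a form with \<open>d i = 0\<close> does not move with \<open>t\<close>.
\<close>
definition root_const :: "('n::finite \<Rightarrow> complex) \<Rightarrow> ('n \<Rightarrow> complex) \<Rightarrow> ('n \<Rightarrow> int) \<Rightarrow> complex" where
  "root_const c d e = (\<Prod>i\<in>UNIV. (if d i = 0 then c i else d i) powi e i)"

lemma finite_lin_roots [simp]: "finite (lin_roots c d)" for c :: "'n::finite \<Rightarrow> complex"
  by (simp add: lin_roots_def)

lemma proots_root_prod: "proots (root_prod c d E) = (\<Sum>a\<in>lin_roots c d. replicate_mset (nat (E a)) a)"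
  unfolding root_prod_def by (subst proots_prod) (auto simp: proots_power)

lemma root_prod_monic: "lead_coeff (root_prod c d E) = 1"
  by (simp add: root_prod_def lead_coeff_prod lead_coeff_power)

lemma degree_root_prod: "degree (root_prod c d E) = (\<Sum>a\<in>lin_roots c d. nat (E a))"
  unfolding root_prod_def by (subst degree_prod_sum_eq) (auto simp: degree_power_eq)

lemma poly_root_prod_eq_0_iff:
  "poly (root_prod c d E) t = 0 \<longleftrightarrow> t \<in> lin_roots c d \<and> E t > 0"
  by (auto simp: root_prod_def poly_prod)

lemma sum_root_exponent:
  fixes c :: "'n::finite \<Rightarrow> complex"
  shows "(\<Sum>a\<in>lin_roots c d. root_exponent c d e a) = (\<Sum>i | d i \<noteq> 0. e i)"
proof -
  have "(\<Sum>a\<in>lin_roots c d. root_exponent c d e a)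
      = (\<Sum>a\<in>lin_root c d ` {i. d i \<noteq> 0}. \<Sum>i\<in>{i\<in>{i. d i \<noteq> 0}. lin_root c d i = a}. e i)"
    by (simp add: root_exponent_def lin_roots_def)
  also have "\<dots> = (\<Sum>i | d i \<noteq> 0. e i)" by (rule sum.group) auto
  finally show ?thesis .
qed

text \<open>
  The formula also holds at a root \<open>t\<close> at which every vanishing form has exponent \<open>0\<close>, thanks to
  \<open>0 powi 0 = 1\<close>. This is what evaluates the curve at the point where it meets the wall.
\<close>
lemma prod_linear_powers:
  fixes c d :: "'n::finite \<Rightarrow> complex"
  assumes t: "\<And>i. d i \<noteq> 0 \<Longrightarrow> lin_root c d i = t \<Longrightarrow> e i = 0"
  shows "(\<Prod>i\<in>UNIV. (c i + t * d i) powi e i)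
    = root_const c d e * poly (root_prod c d (root_exponent c d e)) t
      / poly (root_prod c d (\<lambda>a. - root_exponent c d e a)) t"
proof -
  define I where "I = {i. d i \<noteq> 0}"
  let ?r = "lin_root c d" and ?E = "root_exponent c d e"
  have "(\<Prod>i\<in>UNIV. (c i + t * d i) powi e i)
      = (\<Prod>i\<in>UNIV. (if d i = 0 then c i else d i) powi e i * (if d i = 0 then 1 else (t - ?r i) powi e i))"
  proof (rule prod.cong)
    fix i
    have "c i + t * d i = d i * (t - ?r i)" if "d i \<noteq> 0"
      using that by (simp add: lin_root_def field_simps)
    then show "(c i + t * d i) powi e i = (if d i = 0 then c i else d i) powi e i *
        (if d i = 0 then 1 else (t - ?r i) powi e i)"
      by (simp add: power_int_mult_distrib)
  qed simp
  also have "\<dots> = root_const c d e * (\<Prod>i\<in>UNIV. if d i = 0 then 1 else (t - ?r i) powi e i)"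
    by (simp add: prod.distrib root_const_def)
  also have "(\<Prod>i\<in>UNIV. if d i = 0 then 1 else (t - ?r i) powi e i) = (\<Prod>i\<in>I. (t - ?r i) powi e i)"
    by (intro prod.mono_neutral_cong_right) (auto simp: I_def)
  also have "\<dots> = (\<Prod>a\<in>?r ` I. \<Prod>i\<in>{i\<in>I. ?r i = a}. (t - ?r i) powi e i)"
    by (rule prod.group[symmetric]) auto
  also have "\<dots> = (\<Prod>a\<in>lin_roots c d. (t - a) ^ nat (?E a) / (t - a) ^ nat (- ?E a))"
  proof (rule prod.cong)
    show "?r ` I = lin_roots c d" by (simp add: I_def lin_roots_def)
    fix a assume a: "a \<in> lin_roots c d"
    have E: "?E a = (\<Sum>i\<in>{i\<in>I. ?r i = a}. e i)" by (simp add: root_exponent_def I_def)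
    show "(\<Prod>i\<in>{i\<in>I. ?r i = a}. (t - ?r i) powi e i) = (t - a) ^ nat (?E a) / (t - a) ^ nat (- ?E a)"
    proof (cases "t = a")
      case True
      then have e: "e i = 0" if "i \<in> {i\<in>I. ?r i = a}" for i using that t by (auto simp: I_def)
      have "?E a = 0" using e unfolding E by (intro sum.neutral) auto
      moreover have "(\<Prod>i\<in>{i\<in>I. ?r i = a}. (t - ?r i) powi e i) = 1"
        using e by (intro prod.neutral) auto
      ultimately show ?thesis by simp
    next
      case False
      have pow: "(\<Prod>i\<in>A. (t - a) powi e i) = (t - a) powi (\<Sum>i\<in>A. e i)" if "finite A" for A
        using that by induction (auto simp: power_int_add False)
      have "(\<Prod>i\<in>{i\<in>I. ?r i = a}. (t - ?r i) powi e i) = (\<Prod>i\<in>{i\<in>I. ?r i = a}. (t - a) powi e i)"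
        by (rule prod.cong) auto
      also have "\<dots> = (t - a) powi ?E a" using pow E by simp
      finally show ?thesis by (simp add: power_int_def divide_inverse power_inverse)
    qed
  qed
  finally show ?thesis by (simp add: root_prod_def poly_prod prod_dividef algebra_simps)
qed

text \<open>
  The parameter line through \<open>(x k, y k)\<close> with direction \<open>(- y k, x k)\<close>. The direction is orthogonal
  to weight \<open>k\<close>, so the point at infinity of the chart is the point where the form of weight \<open>k\<close>
  vanishes. Two other weights have the same root iff they are parallel.
\<close>
lemma uniformisation_coordinates:
  fixes x y :: "'n::finite \<Rightarrow> int" and k :: 'n and c d :: "'n \<Rightarrow> complex"
  assumes c_def: "\<And>i. c i = of_int (x i * x k + y i * y k)"
    and d_def: "\<And>i. d i = of_int (x k * y i - y k * x i)"
    and nz: "\<And>i. x i \<noteq> 0 \<or> y i \<noteq> 0"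
  shows "\<And>i t. weight_form x y i (of_int (x k) - t * of_int (y k)) (of_int (y k) + t * of_int (x k)) = c i + t * d i"
    and "\<And>i. d i = 0 \<longleftrightarrow> x i * y k = x k * y i"
    and "\<And>i j. d i \<noteq> 0 \<Longrightarrow> d j \<noteq> 0 \<Longrightarrow> lin_root c d i = lin_root c d j \<longleftrightarrow> x i * y j = x j * y i"
    and "c k \<noteq> 0"
    and "\<And>i. d i = 0 \<Longrightarrow> c i \<noteq> 0"
proof -
  have N: "x i * x i + y i * y i > 0" for i
    using nz[of i] by (metis sum_squares_gt_zero_iff)
  show "weight_form x y i (of_int (x k) - t * of_int (y k)) (of_int (y k) + t * of_int (x k)) = c i + t * d i" for i t
    by (simp add: weight_form_def c_def d_def algebra_simps)
  show d0: "d i = 0 \<longleftrightarrow> x i * y k = x k * y i" for i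
  proof -
    have "d i = 0 \<longleftrightarrow> x k * y i - y k * x i = 0" unfolding d_def by (simp only: of_int_eq_0_iff)
    then show ?thesis by (auto simp: algebra_simps)
  qed
  show "lin_root c d i = lin_root c d j \<longleftrightarrow> x i * y j = x j * y i" if "d i \<noteq> 0" "d j \<noteq> 0" for i j
  proof -
    have "lin_root c d i = lin_root c d j \<longleftrightarrow> c i * d j - c j * d i = 0"
      using that by (auto simp: lin_root_def field_simps)
    also have "c i * d j - c j * d i = of_int ((x i * y j - x j * y i) * (x k * x k + y k * y k))"
      by (simp add: c_def d_def algebra_simps)
    also have "\<dots> = 0 \<longleftrightarrow> x i * y j - x j * y i = 0" using N[of k] by (simp only: of_int_eq_0_iff; auto)
    finally show ?thesis by auto
  qed
  have "of_int (x k * x k + y k * y k) \<noteq> (0::complex)" using N[of k] by (simp only: of_int_eq_0_iff; simp)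
  then show "c k \<noteq> 0" by (simp add: c_def)
  show "c i \<noteq> 0" if "d i = 0" for i
  proof
    assume "c i = 0"
    then have "x i * x k + y i * y k = 0" unfolding c_def by (simp only: of_int_eq_0_iff)
    moreover have "x k * y i - y k * x i = 0" using that unfolding d_def by (simp only: of_int_eq_0_iff)
    moreover have "(x i * x k + y i * y k)^2 + (x k * y i - y k * x i)^2
        = (x i * x i + y i * y i) * (x k * x k + y k * y k)"
      by (simp add: power2_eq_square algebra_simps)
    ultimately have "(x i * x i + y i * y i) * (x k * x k + y k * y k) = 0" by simp
    then show False using N[of i] N[of k] by (metis mult_eq_0_iff less_irrefl)
  qed
qed

lemma prod_mset_image_eq_0: "t \<in># M \<Longrightarrow> f t = 0 \<Longrightarrow> (\<Prod>t\<in>#M. f t) = 0"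
  for f :: "'b \<Rightarrow> 'a::comm_semiring_1"
  by (induction M) auto

text \<open>
  A chart of the projective line of parameters, obtained by removing the point at which weight \<open>k\<close>
  vanishes. In the chart weight \<open>i\<close> becomes the form \<open>c i + t * d i\<close>; the roots \<open>A\<close> of these forms
  correspond to the lines spanned by the weights other than the line of \<open>k\<close>, and \<open>Ex\<close>, \<open>Ey\<close> are the
  orders of the two coordinates of the curve at a root. The reduced fractions are \<open>P / Q\<close> and
  \<open>R / S\<close>.
\<close>
locale line_chart =
  fixes x y :: "'n::finite \<Rightarrow> int" and k :: 'n
  assumes nz: "\<And>i. x i \<noteq> 0 \<or> y i \<noteq> 0"
    and sumx: "(\<Sum>i\<in>UNIV. x i) = 0" and sumy: "(\<Sum>i\<in>UNIV. y i) = 0"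
begin

definition par :: "'n \<Rightarrow> 'n set" where
  "par j = {i. x i * y j = x j * y i}"

definition c :: "'n \<Rightarrow> complex" where
  "c i = of_int (x i * x k + y i * y k)"

definition d :: "'n \<Rightarrow> complex" where
  "d i = of_int (x k * y i - y k * x i)"

definition S1 :: "complex \<Rightarrow> complex" where
  "S1 t = of_int (x k) - t * of_int (y k)"

definition S2 :: "complex \<Rightarrow> complex" where
  "S2 t = of_int (y k) + t * of_int (x k)"

definition A :: "complex set" where
  "A = lin_roots c d"

abbreviation fibre :: "complex \<Rightarrow> 'n set" where
  "fibre a \<equiv> {i. d i \<noteq> 0 \<and> lin_root c d i = a}"

definition Ex :: "complex \<Rightarrow> int" where
  "Ex = root_exponent c d x"

definition Ey :: "complex \<Rightarrow> int" where
  "Ey = root_exponent c d y"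

definition P :: "complex poly" where
  "P = smult (root_const c d x) (root_prod c d Ex)"

definition Q :: "complex poly" where
  "Q = root_prod c d (\<lambda>a. - Ex a)"

definition R :: "complex poly" where
  "R = root_prod c d Ey"

definition S :: "complex poly" where
  "S = smult (1 / root_const c d y) (root_prod c d (\<lambda>a. - Ey a))"

definition \<rho> :: complex where
  "\<rho> = (\<Prod>i\<in>UNIV. of_int (x i) powi x i)"

definition \<kappa> :: int where
  "\<kappa> = (\<Sum>i | x i = 0. y i)"

lemma norm_pos: "x i * x i + y i * y i > 0" for i
  using nz[of i] by (metis sum_squares_gt_zero_iff)

lemmas coords = uniformisation_coordinates[where x=x and y=y and k=k and c=c and d=d, OF c_def d_def nz]

lemma chart_form: "weight_form x y i (S1 t) (S2 t) = c i + t * d i" for i t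
  using coords(1) by (simp add: S1_def S2_def)

text \<open>
  The roots separate the lines spanned by the weights.
\<close>
lemma fibre_eq_par: "fibre a = par i" if "i \<in> fibre a" for a i
proof -
  have "d j \<noteq> 0" if "j \<in> par i" for j
  proof
    assume "d j = 0"
    then have j: "x j * y k = x k * y j" by (simp add: coords(2))
    have ij: "x j * y i = x i * y j" using that by (simp add: par_def)
    have "x i * y k = x k * y i"
    proof (cases "x j = 0")
      case True
      then have "y j \<noteq> 0" using nz[of j] by simp
      then show ?thesis using True j ij by simp
    next
      case False
      have "x j * (x i * y k) = x j * (x k * y i)" using j ij by (metis mult.left_commute)
      then show ?thesis using False by simp
    qed
    then show False using \<open>i \<in> fibre a\<close> by (simp add: coords(2))
  qed
  moreover have "d j \<noteq> 0 \<Longrightarrow> lin_root c d j = a \<longleftrightarrow> j \<in> par i" for j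
    using coords(3)[of j i] \<open>i \<in> fibre a\<close> by (auto simp: par_def)
  ultimately show ?thesis by blast
qed

lemma exponent_sums: "Ex a = (\<Sum>i\<in>fibre a. x i)" "Ey a = (\<Sum>i\<in>fibre a. y i)" for a
  by (simp_all add: Ex_def Ey_def root_exponent_def)

lemma A_iff: "a \<in> A \<longleftrightarrow> fibre a \<noteq> {}" for a by (auto simp: A_def lin_roots_def)

text \<open>
  The pair of orders at a root is the sum of the weights on the corresponding line, so it lies on
  that line itself.
\<close>
lemma exponents_parallel: "x i * Ey a = y i * Ex a" if "i \<in> fibre a" for a i
proof -
  have "x i * Ey a - y i * Ex a = (\<Sum>j\<in>fibre a. x i * y j - y i * x j)"
    by (simp add: exponent_sums sum_distrib_left sum_subtractf)
  also have "\<dots> = 0"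
  proof (rule sum.neutral, rule ballI)
    fix j assume "j \<in> fibre a"
    then have "j \<in> par i" using fibre_eq_par[OF that] by simp
    then show "x i * y j - y i * x j = 0" by (simp add: par_def algebra_simps)
  qed
  finally show ?thesis by simp
qed

lemma moving_weights: "{i. d i \<noteq> 0} = - par k" by (auto simp: coords(2) par_def)

lemma sum_moving: "(\<Sum>i | d i \<noteq> 0. y i) = - (\<Sum>i\<in>par k. y i)"
  unfolding moving_weights using sumy sum.subset_diff[of "par k" UNIV y] by (simp add: Compl_eq_Diff_UNIV)

text \<open>
  No admissible parameter is lost by removing the point at infinity, because weight \<open>k\<close> vanishes
  there.
\<close>
lemma chart_covers: "\<exists>t. (\<forall>i. d i \<noteq> 0 \<longrightarrow> lin_root c d i \<noteq> t) \<and>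
    horn x y x s1 s2 = horn x y x (S1 t) (S2 t) \<and> horn x y y s1 s2 = horn x y y (S1 t) (S2 t)"
  if s: "\<And>i. weight_form x y i s1 s2 \<noteq> 0" for s1 s2
proof -
  define n :: complex where "n = of_int (x k * x k + y k * y k)"
  have n: "n \<noteq> 0" unfolding n_def using norm_pos[of k] by (simp only: of_int_eq_0_iff; simp)
  define a where "a = weight_form x y k s1 s2 / n"
  have a: "a \<noteq> 0" using s n by (simp add: a_def)
  define t where "t = (of_int (x k) * s2 - of_int (y k) * s1) / n / a"
  have s12: "s1 = a * S1 t" "s2 = a * S2 t"
  proof -
    have at: "a * t = (of_int (x k) * s2 - of_int (y k) * s1) / n" using a by (simp add: t_def)
    let ?X = "of_int (x k) :: complex" and ?Y = "of_int (y k) :: complex"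
    have "a * S1 t = a * ?X - (a * t) * ?Y" by (simp add: S1_def algebra_simps)
    also have "\<dots> = ((?X * s1 + ?Y * s2) * ?X - (?X * s2 - ?Y * s1) * ?Y) / n"
      by (subst at) (simp add: a_def weight_form_def diff_divide_distrib add_divide_distrib algebra_simps)
    also have "(?X * s1 + ?Y * s2) * ?X - (?X * s2 - ?Y * s1) * ?Y = n * s1"
      by (simp add: n_def algebra_simps)
    finally show "s1 = a * S1 t" using n by simp
    have "a * S2 t = a * ?Y + (a * t) * ?X" by (simp add: S2_def algebra_simps)
    also have "\<dots> = ((?X * s1 + ?Y * s2) * ?Y + (?X * s2 - ?Y * s1) * ?X) / n"
      by (subst at) (simp add: a_def weight_form_def diff_divide_distrib add_divide_distrib algebra_simps)
    also have "(?X * s1 + ?Y * s2) * ?Y + (?X * s2 - ?Y * s1) * ?X = n * s2"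
      by (simp add: n_def algebra_simps)
    finally show "s2 = a * S2 t" using n by simp
  qed
  have "lin_root c d i \<noteq> t" if "d i \<noteq> 0" for i
  proof
    assume "lin_root c d i = t"
    then have "c i + t * d i = 0" using that by (auto simp: lin_root_def)
    then have "weight_form x y i (S1 t) (S2 t) = 0" by (simp add: chart_form)
    then have "weight_form x y i s1 s2 = 0" unfolding s12(1)[symmetric] s12(2)[symmetric]
      by (subst s12, subst s12) (simp add: weight_form_def algebra_simps flip: distrib_left)
    then show False using s by simp
  qed
  moreover have "horn x y x s1 s2 = horn x y x (S1 t) (S2 t)" "horn x y y s1 s2 = horn x y y (S1 t) (S2 t)"
    using horn_scale[OF sumx a, of x y "S1 t" "S2 t"] horn_scale[OF sumy a, of x y "S1 t" "S2 t"] s12 by simp_all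
  ultimately show ?thesis by blast
qed

lemma root_const_nonzero: "root_const c d e \<noteq> 0" for e
  using coords(5) by (auto simp: root_const_def)

lemma P_zero: "poly P t = 0 \<longleftrightarrow> t \<in> A \<and> Ex t > 0" and Q_zero: "poly Q t = 0 \<longleftrightarrow> t \<in> A \<and> Ex t < 0"
  and R_zero: "poly R t = 0 \<longleftrightarrow> t \<in> A \<and> Ey t > 0" and S_zero: "poly S t = 0 \<longleftrightarrow> t \<in> A \<and> Ey t < 0" for t
  using root_const_nonzero by (auto simp: P_def Q_def R_def S_def poly_root_prod_eq_0_iff A_def)

lemma horn_first: "horn x y x (S1 t) (S2 t) = poly P t / poly Q t"
  if "\<And>i. d i \<noteq> 0 \<Longrightarrow> lin_root c d i = t \<Longrightarrow> x i = 0" for t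
  using prod_linear_powers[of d c t x] that by (simp add: horn_def chart_form P_def Q_def Ex_def)

lemma horn_second: "horn x y y (S1 t) (S2 t) = poly R t / poly S t"
  if "\<And>i. d i \<noteq> 0 \<Longrightarrow> lin_root c d i = t \<Longrightarrow> y i = 0" for t
  using prod_linear_powers[of d c t y] that root_const_nonzero[of y]
  by (simp add: horn_def chart_form R_def S_def Ey_def)

text \<open>
  The second coordinate has no poles, so it is constant on the projective line; there is then no
  chart with a pole at infinity, and the equation is \<open>V = const\<close>.
\<close>
lemma constant_second_coordinate:
  assumes nonneg: "\<And>j. (\<Sum>i\<in>par j. y i) \<ge> 0"
  shows "\<kappa> = 0"
    and "\<And>s1 s2. (\<And>i. weight_form x y i s1 s2 \<noteq> 0) \<Longrightarrow> horn x y y s1 s2 = root_const c d y"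
proof -
  have Ey_ge: "Ey a \<ge> 0" if "a \<in> A" for a
    using that nonneg fibre_eq_par[of _ a] by (auto simp: A_iff exponent_sums)
  have "(\<Sum>a\<in>A. Ey a) \<le> 0" unfolding Ey_def A_def sum_root_exponent sum_moving using nonneg[of k] by simp
  then have Ey0: "Ey a = 0" if "a \<in> A" for a
    using that Ey_ge sum_nonneg_eq_0_iff[of A Ey] sum_nonneg[of A Ey] by (auto simp: A_def)
  have par0: "(\<Sum>i\<in>par j. y i) = 0" for j
  proof (cases "d j = 0")
    case True
    have pos: "(\<Sum>i\<in>par k. y i) = 0"
      using sum_moving sum_root_exponent[of c d y] Ey0 by (simp add: Ey_def A_def)
    have "par j = par k"
    proof -
      have jk: "x j * y k = x k * y j" using True by (simp add: coords(2))
      have "x i * y j = x j * y i \<longleftrightarrow> x i * y k = x k * y i" for i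
      proof -
        have 1: "x j * (x i * y k - x k * y i) = x k * (x i * y j - x j * y i)" 
          using jk by (simp add: algebra_simps; metis mult.left_commute)
        have 2: "y j * (x i * y k - x k * y i) = y k * (x i * y j - x j * y i)"
          using jk by (simp add: algebra_simps; metis mult.left_commute)
        show ?thesis using 1 2 nz[of j] nz[of k] by (metis eq_iff_diff_eq_0 mult_eq_0_iff)
      qed
      then show ?thesis by (auto simp: par_def)
    qed
    then show ?thesis using pos by simp
  next
    case False
    then have "j \<in> fibre (lin_root c d j)" by simp
    then show ?thesis using fibre_eq_par Ey0[of "lin_root c d j"] by (auto simp: A_iff exponent_sums)
  qed
  define v0 where "v0 = 1 / (poly S 0)"
  have S: "poly S t = 1 / root_const c d y" and R: "poly R t = 1" for t
    using Ey0 by (auto simp: R_def S_def root_prod_def A_def poly_prod)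
  show "\<kappa> = 0"
  proof (cases "\<exists>j. x j = 0")
    case True
    then obtain j where j: "x j = 0" by blast
    have "{i. x i = 0} = par j" using j nz[of j] by (auto simp: par_def)
    then show ?thesis using par0[of j] by (simp add: \<kappa>_def)
  next
    case False
    then show ?thesis by (simp add: \<kappa>_def)
  qed
  show "horn x y y s1 s2 = root_const c d y" if s: "\<And>i. weight_form x y i s1 s2 \<noteq> 0" for s1 s2
  proof -
    obtain t where t: "\<forall>i. d i \<noteq> 0 \<longrightarrow> lin_root c d i \<noteq> t" "horn x y y s1 s2 = horn x y y (S1 t) (S2 t)"
      using chart_covers[OF s] by blast
    show ?thesis using horn_second[of t] t by (auto simp: S R)
  qed
qed

text \<open>
  Choosing \<open>k\<close> such that the second coordinate has a pole at infinity makes its numerator the one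
  of larger degree, as elimination requires.
\<close>
lemma degree_S_less:
  assumes pole: "(\<Sum>i\<in>par k. y i) < 0"
  shows "degree S < degree R"
proof -
  have "degree S = (\<Sum>a\<in>A. nat (- Ey a))" "degree R = (\<Sum>a\<in>A. nat (Ey a))"
    using root_const_nonzero by (simp_all add: S_def R_def degree_root_prod A_def)
  then have "int (degree R) - int (degree S) = (\<Sum>a\<in>A. Ey a)"
    by (auto simp: sum_subtractf[symmetric] intro!: sum.cong)
  also have "\<dots> > 0" unfolding Ey_def A_def sum_root_exponent sum_moving using pole by simp
  finally show ?thesis by simp
qed

context
  fixes G
  assumes pole: "(\<Sum>i\<in>par k. y i) < 0"
    and G: "\<And>U V. bipoly G U V = (\<Prod>t\<in>#proots (R - smult V S). poly P t - U * poly Q t)"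
begin

lemma pencil_nonzero: "R - smult V S \<noteq> 0" for V
proof
  assume "R - smult V S = 0"
  then have "degree R = degree (smult V S)" by simp
  then show False using degree_S_less[OF pole] degree_smult_le[of V S] by simp
qed

text \<open>
  At \<open>V = 0\<close> the product runs over the zeros of the second coordinate.
\<close>
lemma coeff_as_product: "coeff G 0 = (\<Prod>a\<in>A. [:poly P a, - poly Q a:] ^ nat (Ey a))"
proof (rule poly_eq_poly_eq_iff[THEN iffD1])
  show "poly (coeff G 0) = poly (\<Prod>a\<in>A. [:poly P a, - poly Q a:] ^ nat (Ey a))"
  proof
    fix U
    have "poly (coeff G 0) U = (\<Prod>t\<in>#proots R. poly P t - U * poly Q t)"
      using G[of U 0] by (simp add: bipoly_zero_right)
    also have "\<dots> = (\<Prod>a\<in>A. (poly P a - U * poly Q a) ^ nat (Ey a))"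
    proof -
      have "(\<Prod>t\<in>#(\<Sum>a\<in>B. replicate_mset (n a) a). g t) = (\<Prod>a\<in>B. g a ^ n a)" if "finite B"
        for B n and g :: "complex \<Rightarrow> complex"
        using that by induction auto
      then show ?thesis by (simp add: R_def proots_root_prod A_def)
    qed
    also have "\<dots> = poly (\<Prod>a\<in>A. [:poly P a, - poly Q a:] ^ nat (Ey a)) U"
      by (simp add: poly_prod)
    finally show "poly (coeff G 0) U = poly (\<Prod>a\<in>A. [:poly P a, - poly Q a:] ^ nat (Ey a)) U" .
  qed
qed

lemma factor_nonzero: "[:poly P a, - poly Q a:] \<noteq> 0" for a using P_zero[of a] Q_zero[of a] by auto

lemma coeff_nonzero: "coeff G 0 \<noteq> 0" unfolding coeff_as_product using factor_nonzero by (simp add: A_def) blast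

lemma order_as_sum: "order s (coeff G 0) = (\<Sum>a\<in>A. nat (Ey a) * (if poly Q a \<noteq> 0 \<and> poly P a = s * poly Q a then 1 else 0))" for s
proof -
  have one: "proots [:poly P a, - poly Q a:] = (if poly Q a = 0 then {#} else {#poly P a / poly Q a#})" for a
  proof (cases "poly Q a = 0")
    case False
    have "[:poly P a, - poly Q a:] = smult (- poly Q a) [:- (poly P a / poly Q a), 1:]" using False by simp
    then have "proots [:poly P a, - poly Q a:] = proots [:- (poly P a / poly Q a), 1:]"
      using False by (simp only: proots_smult neg_equal_0_iff_equal not_False_eq_True)
    then show ?thesis using False by simp
  qed simp
  have "order s (coeff G 0) = count (proots (coeff G 0)) s" using coeff_nonzero by simp
  also have "\<dots> = (\<Sum>a\<in>A. nat (Ey a) * count (proots [:poly P a, - poly Q a:]) s)"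
  proof -
    have "proots (coeff G 0) = (\<Sum>a\<in>A. proots ([:poly P a, - poly Q a:] ^ nat (Ey a)))"
      unfolding coeff_as_product by (rule proots_prod) (rule power_not_zero[OF factor_nonzero])
    then show ?thesis by (simp only: proots_power count_sum count_repeat_mset)
  qed
  also have "\<dots> = (\<Sum>a\<in>A. nat (Ey a) * (if poly Q a \<noteq> 0 \<and> poly P a = s * poly Q a then 1 else 0))"
  proof (rule sum.cong)
    fix a
    show "nat (Ey a) * count (proots [:poly P a, - poly Q a:]) s
        = nat (Ey a) * (if poly Q a \<noteq> 0 \<and> poly P a = s * poly Q a then 1 else 0)"
    proof (cases "poly Q a = 0")
      case False
      then have "poly P a / poly Q a = s \<longleftrightarrow> poly P a = s * poly Q a" by (simp add: divide_eq_eq)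
      then show ?thesis using False by (simp add: one)
    qed (simp add: one)
  qed simp
  finally show ?thesis .
qed

text \<open>
  A zero of the second coordinate at which the first one has neither a zero nor a pole belongs to
  the line \<open>x = 0\<close>: by parallelism the order \<open>0\<close> of the first coordinate forces \<open>x i = 0\<close>.
\<close>
lemma fibre_over_wall: "fibre a = {i. x i = 0}" if a: "a \<in> A" "Ey a > 0" "Ex a = 0" for a
proof -
  obtain i where i: "i \<in> fibre a" using a(1) A_iff[of a] by blast
  have "x i = 0" using exponents_parallel[OF i] a by simp
  then have "par i = {i. x i = 0}" using nz[of i] by (auto simp: par_def)
  then show ?thesis using fibre_eq_par[OF i] by simp
qed

lemma value_over_wall: "poly P a = \<rho> * poly Q a" "Ey a = \<kappa>" if a: "a \<in> A" "Ey a > 0" "Ex a = 0" for a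
proof -
  note Ja = fibre_over_wall[OF a]
  obtain i where i: "i \<in> fibre a" using a(1) A_iff[of a] by blast
  have xi: "x i = 0" using Ja i by blast
  have "weight_form x y i (S1 a) (S2 a) = 0"
    using i by (auto simp: chart_form lin_root_def)
  then have S2: "S2 a = 0" using xi nz[of i] by (simp add: weight_form_def)
  have "S1 a \<noteq> 0"
  proof
    assume "S1 a = 0"
    then have "weight_form x y k (S1 a) (S2 a) = 0" using S2 by (simp add: weight_form_def)
    then show False using coords(4) by (simp add: chart_form d_def)
  qed
  then have "horn x y x (S1 a) (S2 a) = horn x y x 1 0"
    using horn_scale[OF sumx, of "S1 a" x y 1 0] S2 by simp
  also have "\<dots> = \<rho>" by (simp add: horn_def weight_form_def \<rho>_def)
  finally have h: "horn x y x (S1 a) (S2 a) = \<rho>" .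
  have "x i = 0" if "d i \<noteq> 0" "lin_root c d i = a" for i using Ja that by blast
  from horn_first[OF this] h have "poly P a / poly Q a = \<rho>" by simp
  moreover have "poly Q a \<noteq> 0" using a Q_zero by auto
  ultimately show "poly P a = \<rho> * poly Q a" by (auto simp: field_simps)
  show "Ey a = \<kappa>" unfolding \<kappa>_def exponent_sums Ja ..
qed

lemma vanishes_on_curve: "bipoly G (horn x y x s1 s2) (horn x y y s1 s2) = 0" if s: "\<And>i. weight_form x y i s1 s2 \<noteq> 0" for s1 s2
proof -
  obtain t where t: "\<forall>i. d i \<noteq> 0 \<longrightarrow> lin_root c d i \<noteq> t"
      "horn x y x s1 s2 = horn x y x (S1 t) (S2 t)" "horn x y y s1 s2 = horn x y y (S1 t) (S2 t)"
    using chart_covers[OF s] by blast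
  have tA: "t \<notin> A" using t(1) by (auto simp: A_def lin_roots_def)
  have h: "horn x y x (S1 t) (S2 t) = poly P t / poly Q t" "horn x y y (S1 t) (S2 t) = poly R t / poly S t"
    by (rule horn_first horn_second; use t(1) in blast)+
  have "poly Q t \<noteq> 0" "poly S t \<noteq> 0" using Q_zero[of t] S_zero[of t] tA by blast+
  then have "horn x y x s1 s2 * poly Q t = poly P t" "horn x y y s1 s2 * poly S t = poly R t"
    by (simp_all add: t(2,3) h)
  then have "t \<in># proots (R - smult (horn x y y s1 s2) S)" "poly P t - horn x y x s1 s2 * poly Q t = 0"
    using pencil_nonzero by auto
  then show ?thesis unfolding G by (rule prod_mset_image_eq_0)
qed

text \<open>
  Among the zeros of the second coordinate, those where the first coordinate is zero or infinite
  contribute a power of \<open>U\<close> or a constant. The only other one is the point of the line \<open>x = 0\<close>, of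
  order \<open>\<kappa>\<close>, and there the first coordinate has the value \<open>\<rho>\<close>.
\<close>
lemma order_on_axis: "order s (coeff G 0) = (if s = \<rho> then nat \<kappa> else 0)" if s: "s \<noteq> 0" for s
proof -
  have iff: "Ey a > 0 \<and> poly Q a \<noteq> 0 \<and> poly P a = s * poly Q a \<longleftrightarrow> Ey a > 0 \<and> Ex a = 0 \<and> s = \<rho>"
    if "a \<in> A" for a
  proof
    assume l: "Ey a > 0 \<and> poly Q a \<noteq> 0 \<and> poly P a = s * poly Q a"
    then have "poly P a \<noteq> 0" using s by simp
    then have E0: "Ex a = 0" using l P_zero[of a] Q_zero[of a] that by linarith
    then have "poly P a = \<rho> * poly Q a" using l value_over_wall(1)[of a] that by blast
    then show "Ey a > 0 \<and> Ex a = 0 \<and> s = \<rho>" using l E0 by simp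
  next
    assume "Ey a > 0 \<and> Ex a = 0 \<and> s = \<rho>"
    then show "Ey a > 0 \<and> poly Q a \<noteq> 0 \<and> poly P a = s * poly Q a" using value_over_wall(1)[of a] that Q_zero[of a] by simp
  qed
  have "order s (coeff G 0) = (\<Sum>a\<in>A. if Ey a > 0 \<and> Ex a = 0 \<and> s = \<rho> then nat \<kappa> else 0)"
    unfolding order_as_sum
  proof (rule sum.cong)
    fix a assume a: "a \<in> A"
    show "nat (Ey a) * (if poly Q a \<noteq> 0 \<and> poly P a = s * poly Q a then 1 else 0)
        = (if Ey a > 0 \<and> Ex a = 0 \<and> s = \<rho> then nat \<kappa> else 0)"
      using iff[OF a] value_over_wall(2)[OF a] by (cases "Ey a > 0") auto
  qed simp
  also have "\<dots> = (if s = \<rho> then nat \<kappa> else 0)"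
  proof (cases "\<kappa> > 0")
    case False
    have "\<not> (Ey a > 0 \<and> Ex a = 0)" if "a \<in> A" for a using value_over_wall(2)[OF that] False by auto
    then show ?thesis using False by (simp add: sum.neutral)
  next
    case True
    then have "{i. x i = 0} \<noteq> {}" unfolding \<kappa>_def by force
    then obtain j where j: "x j = 0" by blast
    have parj: "par j = {i. x i = 0}" using j nz[of j] by (auto simp: par_def)
    have dj: "d j \<noteq> 0"
    proof
      assume "d j = 0"
      then have "x k = 0" using j nz[of j] by (auto simp: coords(2))
      then have "par k = {i. x i = 0}" using nz[of k] by (auto simp: par_def)
      then show False using True pole by (simp add: \<kappa>_def)
    qed
    define a0 where "a0 = lin_root c d j"
    have a0cl: "j \<in> fibre a0" using dj by (simp add: a0_def)
    have "fibre a0 = {i. x i = 0}" using fibre_eq_par[OF a0cl] parj by simp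
    then have a0: "a0 \<in> A" "Ey a0 > 0" "Ex a0 = 0"
      using a0cl A_iff True by (auto simp: exponent_sums \<kappa>_def)
    have uniq: "a = a0" if "a \<in> A" "Ey a > 0 \<and> Ex a = 0" for a
    proof -
      have "fibre a = {i. x i = 0}" using fibre_over_wall[of a] that by blast
      then have "j \<in> fibre a" using j by simp
      then show ?thesis by (simp add: a0_def)
    qed
    have "(\<Sum>a\<in>A. if Ey a > 0 \<and> Ex a = 0 \<and> s = \<rho> then nat \<kappa> else 0)
        = (\<Sum>a\<in>A. if a = a0 then (if s = \<rho> then nat \<kappa> else 0) else 0)"
    proof (rule sum.cong)
      fix a assume a: "a \<in> A"
      show "(if Ey a > 0 \<and> Ex a = 0 \<and> s = \<rho> then nat \<kappa> else 0)
          = (if a = a0 then (if s = \<rho> then nat \<kappa> else 0) else 0)"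
      proof (cases "a = a0")
        case True
        then show ?thesis using a0 by simp
      next
        case False
        then have "\<not> (Ey a > 0 \<and> Ex a = 0)" using uniq[OF a] by blast
        then show ?thesis using False by auto
      qed
    qed simp
    then show ?thesis using a0 by (simp add: A_def)
  qed
  finally show ?thesis .
qed

text \<open>
  A common zero of both coordinates would be a line on which the sum of the weights, and hence some
  weight, has two positive coordinates.
\<close>
lemma avoids_corner: "poly (coeff G 0) 0 \<noteq> 0" if no: "\<And>i. \<not> (x i > 0 \<and> y i > 0)"
proof -
  have "\<not> (Ey a > 0 \<and> Ex a > 0)" if "a \<in> A" for a
  proof
    assume E: "Ey a > 0 \<and> Ex a > 0"
    have "\<exists>i\<in>fibre a. x i > 0"
    proof (rule ccontr)
      assume "\<not> ?thesis"
      then have "Ex a \<le> 0" unfolding exponent_sums by (intro sum_nonpos) (meson linorder_not_le)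
      then show False using E by simp
    qed
    then obtain i where i: "i \<in> fibre a" "x i > 0" by blast
    have "y i * Ex a > 0" using exponents_parallel[OF i(1)] E i(2) by (metis mult_pos_pos)
    then have "y i > 0" using E by (simp add: zero_less_mult_iff)
    then show False using no i(2) by blast
  qed
  then have "[:poly P a, - poly Q a:] ^ nat (Ey a) = 1 \<or> poly P a \<noteq> 0" if "a \<in> A" for a
    using P_zero[of a] that by (cases "Ey a > 0") auto
  then have "poly ([:poly P a, - poly Q a:] ^ nat (Ey a)) 0 \<noteq> 0" if "a \<in> A" for a
    using that by fastforce
  then show ?thesis unfolding coeff_as_product by (auto simp: poly_prod A_def)
qed

text \<open>
  A zero of the eliminant off the axes comes from a parameter \<open>t0\<close> that is neither a zero nor a pole
  of either coordinate. It may still be the root of some forms, namely when the weights on their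
  line add up to zero; therefore the point is described as a limit of points of the curve.
\<close>
lemma zero_is_limit: "\<exists>s1 s2 (t0::complex). (\<forall>\<^sub>F t in at t0. \<forall>i. weight_form x y i (s1 t) (s2 t) \<noteq> 0) \<and>
   ((\<lambda>t. horn x y x (s1 t) (s2 t)) \<longlongrightarrow> U) (at t0) \<and> ((\<lambda>t. horn x y y (s1 t) (s2 t)) \<longlongrightarrow> V) (at t0)"
  if U: "U \<noteq> 0" and V: "V \<noteq> 0" and UV: "bipoly G U V = 0" for U V
proof -
  obtain t0 where t0: "t0 \<in># proots (R - smult V S)" "poly P t0 - U * poly Q t0 = 0"
    using UV unfolding G prod_mset_zero_iff by auto
  have "poly R t0 = V * poly S t0" using t0(1) pencil_nonzero by simp
  then have nzS: "poly S t0 \<noteq> 0" and Vt: "poly R t0 / poly S t0 = V"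
    using R_zero[of t0] S_zero[of t0] V by (auto simp: field_simps)
  have nzQ: "poly Q t0 \<noteq> 0" and Ut: "poly P t0 / poly Q t0 = U"
    using P_zero[of t0] Q_zero[of t0] U t0(2) by (auto simp: field_simps)
  have "\<forall>\<^sub>F t in at t0. t \<notin> A"
    using islimpt_finite[of A t0] by (simp add: A_def islimpt_iff_eventually)
  then have ev: "\<forall>\<^sub>F t in at t0. \<forall>i. d i \<noteq> 0 \<longrightarrow> lin_root c d i \<noteq> t"
    by eventually_elim (auto simp: A_def lin_roots_def)
  have 1: "\<forall>\<^sub>F t in at t0. \<forall>i. weight_form x y i (S1 t) (S2 t) \<noteq> 0"
    using ev
  proof eventually_elim
    case (elim t)
    show ?case
    proof
      fix i
      show "weight_form x y i (S1 t) (S2 t) \<noteq> 0"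
      proof (cases "d i = 0")
        case True
        then show ?thesis using coords(5) by (simp add: chart_form)
      next
        case False
        then have "lin_root c d i \<noteq> t" using elim by blast
        then show ?thesis using False by (auto simp: chart_form lin_root_def field_simps add_eq_0_iff)
      qed
    qed
  qed
  have lim: "((\<lambda>t. poly P t / poly Q t) \<longlongrightarrow> U) (at t0)" "((\<lambda>t. poly R t / poly S t) \<longlongrightarrow> V) (at t0)"
    unfolding Ut[symmetric] Vt[symmetric] using nzS nzQ
    by (intro tendsto_divide isContD[OF poly_isCont]; simp)+
  have eqx: "\<forall>\<^sub>F t in at t0. poly P t / poly Q t = horn x y x (S1 t) (S2 t)"
    using ev by eventually_elim (rule horn_first[symmetric], blast)
  have eqy: "\<forall>\<^sub>F t in at t0. poly R t / poly S t = horn x y y (S1 t) (S2 t)"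
    using ev by eventually_elim (rule horn_second[symmetric], blast)
  note Lim_transform_eventually[OF lim(1) eqx] Lim_transform_eventually[OF lim(2) eqy]
  with 1 show ?thesis by (intro exI[of _ S1] exI[of _ S2] exI[of _ t0] conjI)
qed

end

end

text \<open>
  The equation of the Horn curve and its contact with the axis \<open>V = 0\<close>. Either some weight line is a
  pole of the second coordinate, and moving it to infinity makes elimination applicable, or the
  second coordinate is constant and \<open>\<kappa>\<close>, the order of its zero on the line \<open>x = 0\<close>, vanishes.
\<close>
lemma horn_elimination:
  fixes x y :: "'n::finite \<Rightarrow> int"
  defines "\<rho> \<equiv> (\<Prod>i\<in>UNIV. of_int (x i) powi x i :: complex)"
    and "\<kappa> \<equiv> (\<Sum>i | x i = 0. y i)"
  assumes nz: "\<And>i. x i \<noteq> 0 \<or> y i \<noteq> 0"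
    and sumx: "(\<Sum>i\<in>UNIV. x i) = 0" and sumy: "(\<Sum>i\<in>UNIV. y i) = 0"
  obtains G where
    "coeff G 0 \<noteq> 0"
    "\<And>s1 s2. (\<And>i. weight_form x y i s1 s2 \<noteq> 0) \<Longrightarrow> bipoly G (horn x y x s1 s2) (horn x y y s1 s2) = 0"
    "\<And>s. s \<noteq> 0 \<Longrightarrow> order s (coeff G 0) = (if s = \<rho> then nat \<kappa> else 0)"
    "(\<And>i. \<not> (x i > 0 \<and> y i > 0)) \<Longrightarrow> poly (coeff G 0) 0 \<noteq> 0"
    "\<And>U V. \<kappa> > 0 \<Longrightarrow> U \<noteq> 0 \<Longrightarrow> V \<noteq> 0 \<Longrightarrow> bipoly G U V = 0 \<Longrightarrow>
       \<exists>s1 s2 (t0::complex). (\<forall>\<^sub>F t in at t0. \<forall>i. weight_form x y i (s1 t) (s2 t) \<noteq> 0) \<and>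
         ((\<lambda>t. horn x y x (s1 t) (s2 t)) \<longlongrightarrow> U) (at t0) \<and> ((\<lambda>t. horn x y y (s1 t) (s2 t)) \<longlongrightarrow> V) (at t0)"
proof -
  obtain k where k: "(\<Sum>i | x i * y k = x k * y i. y i) < 0 \<or> (\<forall>k. (\<Sum>i | x i * y k = x k * y i. y i) \<ge> 0)"
    by (metis linorder_not_le)
  interpret L: line_chart x y k by unfold_locales (use nz sumx sumy in auto)
  have rk: "L.\<rho> = \<rho>" "L.\<kappa> = \<kappa>" unfolding L.\<rho>_def L.\<kappa>_def \<rho>_def \<kappa>_def by (rule refl)+
  show thesis
  proof (cases "(\<Sum>i\<in>L.par k. y i) < 0")
    case True
    have "lead_coeff L.R = 1" by (simp add: L.R_def root_prod_monic)
    from elimination[OF this L.degree_S_less[OF True], of L.P L.Q]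
    obtain G where G: "\<And>U V. bipoly G U V = (\<Prod>t\<in>#proots (L.R - smult V L.S). poly L.P t - U * poly L.Q t)"
      by metis
    show thesis
      by (rule that[OF L.coeff_nonzero[OF True G] L.vanishes_on_curve[OF True G]
            L.order_on_axis[OF True G, unfolded rk] L.avoids_corner[OF True G] L.zero_is_limit[OF True G]])
  next
    case False
    have nonneg: "(\<Sum>i\<in>L.par j. y i) \<ge> 0" for j using k False by (auto simp: L.par_def)
    note L0 = L.constant_second_coordinate[OF nonneg, unfolded rk]
    define r where "r = root_const L.c L.d y"
    have r: "r \<noteq> 0" unfolding r_def by (rule L.root_const_nonzero)
    show thesis
    proof (rule that[of "[:[:- r:], 1:]"])
      show "bipoly [:[:- r:], 1:] (horn x y x s1 s2) (horn x y y s1 s2) = 0"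
        if "\<And>i. weight_form x y i s1 s2 \<noteq> 0" for s1 s2
        using L0(2)[OF that] by (simp add: bipoly_def r_def)
    qed (use r L0(1) in \<open>auto simp: order_0I\<close>)
  qed
qed

lemma weight_forms_eventually_nonzero:
  fixes x y :: "'n::finite \<Rightarrow> int"
  assumes nz: "\<And>i. x i \<noteq> 0 \<or> y i \<noteq> 0"
  shows "\<forall>\<^sub>F t in at 0. \<forall>i. weight_form x y i 1 t \<noteq> 0"
proof -
  have "\<not> 0 islimpt ((\<lambda>i. - of_int (x i) / of_int (y i)) ` UNIV :: complex set)"
    by (intro islimpt_finite) simp
  then have "\<forall>\<^sub>F t in at (0::complex). t \<notin> (\<lambda>i. - of_int (x i) / of_int (y i)) ` UNIV"
    by (simp only: islimpt_iff_eventually not_not)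
  then show ?thesis
  proof eventually_elim
    case (elim t)
    show ?case
    proof (intro allI notI)
      fix i assume "weight_form x y i 1 t = 0"
      then have w: "of_int (x i) + of_int (y i) * t = 0" by (simp add: weight_form_def)
      then have yi: "y i \<noteq> 0" using nz[of i] by auto
      have "of_int (y i) * t = - of_int (x i)" using w by (simp only: add_eq_0_iff)
      then have "t = - of_int (x i) / of_int (y i)"
        using yi by (metis nonzero_mult_div_cancel_left of_int_eq_0_iff)
      then show False using elim by blast
    qed
  qed
qed

text \<open>
  The curve near the point \<open>t = 0\<close>, where the weights with \<open>x i = 0\<close> vanish. The logarithmic
  derivative of the first coordinate at \<open>t = 0\<close> is the sum of \<open>y\<close> over the remaining weights, which is \<open>- \<kappa>\<close>
  because all weights add up to zero. So the first coordinate is a local parameter as soon as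
  \<open>\<kappa>\<close> is non-zero.
\<close>
lemma horn_path:
  fixes x y :: "'n::finite \<Rightarrow> int"
  defines "\<rho> \<equiv> (\<Prod>i\<in>UNIV. of_int (x i) powi x i :: complex)"
    and "\<kappa> \<equiv> (\<Sum>i | x i = 0. y i)"
  assumes nz: "\<And>i. x i \<noteq> 0 \<or> y i \<noteq> 0" and sumy: "(\<Sum>i\<in>UNIV. y i) = 0" and pos: "\<kappa> \<ge> 0"
  shows "((\<lambda>t. (horn x y x 1 t - \<rho>) / t) \<longlongrightarrow> - \<rho> * of_int \<kappa>) (at 0)"
    and "\<exists>v0. ((\<lambda>t. horn x y y 1 t / t ^ nat \<kappa>) \<longlongrightarrow> v0) (at 0)"
    and "\<forall>\<^sub>F t in at 0. \<forall>i. weight_form x y i 1 t \<noteq> 0"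
proof -
  define B where "B = {i. x i \<noteq> 0}"
  let ?f = "\<lambda>i t. of_int (x i) + of_int (y i) * (t::complex)"
  have split: "(\<Prod>i\<in>UNIV. g i) = (\<Prod>i | x i = 0. g i) * (\<Prod>i\<in>B. g i)" for g :: "'n \<Rightarrow> complex"
  proof -
    have "UNIV = {i. x i = 0} \<union> B" by (auto simp: B_def)
    then show ?thesis by (metis (no_types, lifting) B_def disjoint_iff finite mem_Collect_eq prod.union_disjoint)
  qed
  have sumB: "(\<Sum>i\<in>B. y i) = - \<kappa>"
  proof -
    have "(\<Sum>i\<in>UNIV. y i) = (\<Sum>i | x i = 0. y i) + (\<Sum>i\<in>B. y i)"
    proof -
      have "UNIV = {i. x i = 0} \<union> B" by (auto simp: B_def)
      then show ?thesis by (metis (no_types, lifting) B_def disjoint_iff finite mem_Collect_eq sum.union_disjoint)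
    qed
    then show ?thesis using sumy by (simp add: \<kappa>_def)
  qed
  have deriv: "((\<lambda>t. \<Prod>i\<in>C. ?f i t powi x i) has_field_derivative
      (\<Prod>i\<in>C. of_int (x i) powi x i) * of_int (\<Sum>i\<in>C. y i)) (at 0)" if "finite C" "C \<subseteq> B" for C
    using that
  proof induction
    case (insert i C)
    then have xi: "x i \<noteq> 0" by (auto simp: B_def)
    have 1: "((\<lambda>t. ?f i t powi x i) has_field_derivative of_int (x i) powi x i * of_int (y i)) (at 0)"
    proof -
      have "((\<lambda>t. ?f i t powi x i) has_field_derivative of_int (x i) * ?f i 0 powi (x i - 1) * of_int (y i)) (at 0)"
        using xi by (auto intro!: derivative_eq_intros)
      moreover have "of_int (x i) * ?f i 0 powi (x i - 1) = (of_int (x i) powi x i :: complex)"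
        using xi by (simp add: power_int_diff)
      ultimately show ?thesis by simp
    qed
    show ?case
      using DERIV_mult[OF 1 insert.IH] insert by (simp add: algebra_simps)
  qed simp
  have rho: "\<rho> = (\<Prod>i\<in>B. of_int (x i) powi x i)" unfolding \<rho>_def by (subst split) simp
  have hx: "horn x y x 1 t = (\<Prod>i\<in>B. ?f i t powi x i)" for t
    unfolding horn_def weight_form_def by (subst split) simp
  show "((\<lambda>t. (horn x y x 1 t - \<rho>) / t) \<longlongrightarrow> - \<rho> * of_int \<kappa>) (at 0)"
    using deriv[of B] unfolding has_field_derivative_iff hx rho sumB by simp
  have hy: "horn x y y 1 t / t ^ nat \<kappa> = (\<Prod>i | x i = 0. of_int (y i) powi y i) * (\<Prod>i\<in>B. ?f i t powi y i)"
    if "t \<noteq> 0" for t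
  proof -
    have pow: "(\<Prod>i\<in>C. t powi y i) = t powi (\<Sum>i\<in>C. y i)" if "finite C" for C
      using that by induction (auto simp: power_int_add \<open>t \<noteq> 0\<close>)
    have "horn x y y 1 t = (\<Prod>i | x i = 0. (of_int (y i) * t) powi y i) * (\<Prod>i\<in>B. ?f i t powi y i)"
      unfolding horn_def weight_form_def by (subst split) simp
    also have "(\<Prod>i | x i = 0. (of_int (y i) * t) powi y i) = (\<Prod>i | x i = 0. of_int (y i) powi y i) * t powi \<kappa>"
      by (simp add: power_int_mult_distrib prod.distrib pow \<kappa>_def)
    also have "t powi \<kappa> = t ^ nat \<kappa>" using pos by (simp add: power_int_def)
    finally show ?thesis using that by simp
  qed
  have "((\<lambda>t. (\<Prod>i | x i = 0. of_int (y i) powi y i) * (\<Prod>i\<in>B. ?f i t powi y i)) \<longlongrightarrow>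
      (\<Prod>i | x i = 0. of_int (y i) powi y i) * (\<Prod>i\<in>B. ?f i 0 powi y i)) (at 0)"
    by (intro tendsto_intros) (auto simp: B_def)
  moreover have "\<forall>\<^sub>F t in at 0. (\<Prod>i | x i = 0. of_int (y i) powi y i) * (\<Prod>i\<in>B. ?f i t powi y i) = horn x y y 1 t / t ^ nat \<kappa>"
    by (simp add: eventually_at_filter hy)
  ultimately show "\<exists>v0. ((\<lambda>t. horn x y y 1 t / t ^ nat \<kappa>) \<longlongrightarrow> v0) (at 0)"
    by (intro exI) (rule Lim_transform_eventually)
  show "\<forall>\<^sub>F t in at 0. \<forall>i. weight_form x y i 1 t \<noteq> 0"
    by (rule weight_forms_eventually_nonzero[OF nz])
qed

section \<open>Lattice coordinates adapted to a ray\<close>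
lemma pairing_add_left: "pairing (u + v) w = pairing u w + pairing v w"
  by (simp add: pairing_def algebra_simps sum.distrib)

lemma pairing_add_right: "pairing u (v + w) = pairing u v + pairing u w"
  by (simp add: pairing_def algebra_simps sum.distrib)

lemma pairing_smult_left: "pairing (k *s u) v = k * pairing u v"
  by (simp add: pairing_def sum_distrib_left algebra_simps)

lemma pairing_smult_right: "pairing u (k *s v) = k * pairing u v"
  by (simp add: pairing_def sum_distrib_left algebra_simps)

lemma pairing_zero [simp]: "pairing 0 v = 0" "pairing v 0 = 0"
  by (simp_all add: pairing_def)

lemma pairing_minus [simp]: "pairing (- u) v = - pairing u v" "pairing u (- v) = - pairing u v"
  by (simp_all add: pairing_def sum_negf)

lemma pairing_sum_left: "pairing (\<Sum>i\<in>A. f i) v = (\<Sum>i\<in>A. pairing (f i) v)"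
  by (induction A rule: infinite_finite_induct) (auto simp: pairing_add_left)

lemma pairing_commute: "pairing u v = pairing v u"
  by (simp add: pairing_def mult.commute)

lemma rvec_inner: "rvec u \<bullet> rvec v = of_int (pairing u v)"
  by (simp add: rvec_def pairing_def inner_vec_def)

lemma rvec_add: "rvec (u + v) = rvec u + rvec v"
  by (simp add: rvec_def vec_eq_iff)

lemma rvec_zero [simp]: "rvec 0 = 0"
  by (simp add: rvec_def vec_eq_iff)

lemma rvec_smult: "rvec (k *s v) = of_int k *\<^sub>R rvec v"
  by (simp add: rvec_def vec_eq_iff)

lemma rvec_minus: "rvec (- v) = - rvec v"
  by (simp add: rvec_def vec_eq_iff)

lemma rvec_eq_iff [simp]: "rvec u = rvec v \<longleftrightarrow> u = v"
  by (simp add: rvec_def vec_eq_iff)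

lemma rvec_eq_0_iff [simp]: "rvec u = 0 \<longleftrightarrow> u = 0"
  using rvec_eq_iff[of u 0] by simp

lemma rvec_sum: "rvec (\<Sum>i\<in>A. f i) = (\<Sum>i\<in>A. rvec (f i))"
  by (induction A rule: infinite_finite_induct) (auto simp: rvec_add)

definition ray :: "int ^ 'r::finite \<Rightarrow> (real ^ 'r) set" where "ray p = {c *\<^sub>R rvec p | c. c \<ge> 0}"

lemma zero_in_ray: "0 \<in> ray p"
  unfolding ray_def by (intro CollectI exI[of _ 0]) simp

lemma generator_in_ray: "rvec p \<in> ray p"
  unfolding ray_def by (intro CollectI exI[of _ 1]) simp

lemma span_ray: "span (ray p) = span {rvec p}"
proof (intro equalityI span_minimal subspace_span)
  show "ray p \<subseteq> span {rvec p}" by (auto simp: ray_def span_base span_scale)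
  show "{rvec p} \<subseteq> span (ray p)" by (simp add: span_base generator_in_ray)
qed

text \<open>
  The pairing extended to complex one-parameter subgroups.
\<close>
definition cpair :: "int ^ 'r::finite \<Rightarrow> complex ^ 'r \<Rightarrow> complex" where
  "cpair v s = (\<Sum>j\<in>UNIV. of_int (v $ j) * s $ j)"

text \<open>
  The image of the Horn-Kapranov uniformisation, with \<open>s\<close> in the complexification of the lattice \<open>L\<close>.
\<close>
definition horn_locus :: "('n::finite \<Rightarrow> int ^ 'r::finite) \<Rightarrow> (int ^ 'r \<Rightarrow> complex) set" where
  "horn_locus q = {y. torus_point UNIV y \<and>
     (\<exists>s. (\<forall>i. cpair (q i) s \<noteq> 0) \<and> (\<forall>l. y l = (\<Prod>i\<in>UNIV. cpair (q i) s powi pairing (q i) l)))}"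

text \<open>
  Coordinates adapted to a primitive weight direction \<open>p\<close> in rank two: \<open>lam\<close> generates the
  annihilator of \<open>p\<close>, and \<open>mu\<close> completes it to a basis of \<open>L\<close> with \<open>\<langle>p, mu\<rangle> = 1\<close>.
\<close>
locale plane_coordinates =
  fixes p lam mu :: "int ^ 'r::finite"
  assumes p_lam: "pairing p lam = 0" and p_mu: "pairing p mu = 1" and lam_nonzero: "lam \<noteq> 0"
    and coordinates: "\<And>l. \<exists>k. l = k *s lam + pairing p l *s mu"
    and dual_coordinates: "\<And>u. pairing u lam = 0 \<Longrightarrow> u = pairing u mu *s p"
begin

lemma p_nonzero: "p \<noteq> 0"
  using p_mu by auto

lemma independent:
  assumes m: "pairing p m \<noteq> 0" and eq: "a *s lam + b *s m = 0"
  shows "a = 0 \<and> b = 0"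
proof -
  have "pairing p (a *s lam + b *s m) = 0" using eq by simp
  then have b: "b = 0" using m by (simp add: pairing_add_right pairing_smult_right p_lam)
  then have "a *s lam = 0" using eq by simp
  then show ?thesis using b lam_nonzero by (auto simp: vec_eq_iff)
qed

definition lam_coord :: "int ^ 'r \<Rightarrow> int" where
  "lam_coord l = (SOME k. l = k *s lam + pairing p l *s mu)"

lemma lam_coord: "l = lam_coord l *s lam + pairing p l *s mu"
  unfolding lam_coord_def by (rule someI_ex) (rule coordinates)

lemma torus_point_coordinates:
  assumes y: "torus_point UNIV y"
  shows "y l = y lam powi lam_coord l * y mu powi pairing p l"
proof -
  have "y l = y (lam_coord l *s lam + pairing p l *s mu)" using lam_coord by (rule arg_cong)
  then show ?thesis by (simp add: torus_point_UNIV_add[OF y] torus_point_UNIV_smult[OF y])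
qed

lemma pairing_coordinates: "pairing v l = lam_coord l * pairing v lam + pairing p l * pairing v mu"
proof -
  have "pairing v l = pairing v (lam_coord l *s lam + pairing p l *s mu)"
    using lam_coord by (rule arg_cong)
  then show ?thesis by (simp add: pairing_add_right pairing_smult_right)
qed

lemma dual_monoid_ray: "dual_monoid (ray p) = {m. pairing p m \<ge> 0}"
proof -
  have "(\<forall>u\<in>ray p. rvec m \<bullet> u \<ge> 0) \<longleftrightarrow> pairing p m \<ge> 0" for m
  proof
    assume "\<forall>u\<in>ray p. rvec m \<bullet> u \<ge> 0"
    then have "rvec m \<bullet> rvec p \<ge> 0" using generator_in_ray by blast
    then show "pairing p m \<ge> 0" by (simp add: rvec_inner pairing_commute)
  next
    assume "pairing p m \<ge> 0"
    then show "\<forall>u\<in>ray p. rvec m \<bullet> u \<ge> 0" by (auto simp: ray_def rvec_inner pairing_commute)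
  qed
  then show ?thesis by (simp add: dual_monoid_def)
qed

lemma perp_lattice_ray: "perp_lattice (ray p) = range (\<lambda>k. k *s lam)"
proof -
  have "(\<forall>u\<in>ray p. rvec m \<bullet> u = 0) \<longleftrightarrow> pairing p m = 0" for m
  proof
    assume "\<forall>u\<in>ray p. rvec m \<bullet> u = 0"
    then have "rvec m \<bullet> rvec p = 0" using generator_in_ray by blast
    then show "pairing p m = 0" by (simp add: rvec_inner pairing_commute)
  next
    assume "pairing p m = 0"
    then show "\<forall>u\<in>ray p. rvec m \<bullet> u = 0" by (auto simp: ray_def rvec_inner pairing_commute)
  qed
  moreover have "pairing p m = 0 \<longleftrightarrow> m \<in> range (\<lambda>k. k *s lam)" for m
  proof
    assume "pairing p m = 0"
    then have "m = lam_coord m *s lam" using lam_coord[of m] by simp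
    then show "m \<in> range (\<lambda>k. k *s lam)" by blast
  qed (auto simp: pairing_smult_right p_lam)
  ultimately show ?thesis by (auto simp: perp_lattice_def)
qed

lemma generator_unique:
  assumes "perp_lattice (ray p) = range (\<lambda>k. k *s l)"
  shows "l = lam \<or> l = - lam"
proof -
  have eq: "range (\<lambda>k. k *s l) = range (\<lambda>k. k *s lam)" using assms perp_lattice_ray by simp
  have "l \<in> range (\<lambda>k. k *s l)" by (rule range_eqI[of _ _ 1]) simp
  then obtain k where k: "l = k *s lam" unfolding eq by blast
  have "lam \<in> range (\<lambda>k. k *s lam)" by (rule range_eqI[of _ _ 1]) simp
  then obtain j where j: "lam = j *s l" unfolding eq[symmetric] by blast
  have "(j * k - 1) *s lam = 0" using j k by (simp add: vec_eq_iff algebra_simps)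
  then have "j * k = 1" using lam_nonzero by (auto simp: vec_eq_iff)
  then have "k = 1 \<or> k = -1" by (metis mult.commute zmult_eq_1_iff)
  then show ?thesis using k by (auto simp: vec_eq_iff)
qed

lemma reverse_generator: "plane_coordinates p (- lam) mu"
proof
  fix l
  have "l = (- lam_coord l) *s (- lam) + pairing p l *s mu"
    using lam_coord[of l] by (simp add: vec_eq_iff)
  then show "\<exists>k. l = k *s (- lam) + pairing p l *s mu" by blast
qed (use p_lam p_mu lam_nonzero dual_coordinates in auto)

text \<open>
  The coordinate on the toric curve is chosen up to sign only.
\<close>
lemma curve_coordinate_ray:
  assumes "\<epsilon> \<in> {lam, - lam}" "\<epsilon> \<in> dual_monoid \<tau>"
  shows "perp_lattice (ray p) = range (\<lambda>k. k *s curve_coordinate (ray p) \<tau>)"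
    and "curve_coordinate (ray p) \<tau> \<in> dual_monoid \<tau>"
proof -
  have "range (\<lambda>k. k *s (- lam)) = range (\<lambda>k. k *s lam)"
  proof -
    interpret F: plane_coordinates p "- lam" mu by (rule reverse_generator)
    show ?thesis using perp_lattice_ray F.perp_lattice_ray by simp
  qed
  then have "perp_lattice (ray p) = range (\<lambda>k. k *s \<epsilon>) \<and> \<epsilon> \<in> dual_monoid \<tau>"
    using assms perp_lattice_ray by auto
  from someI[of "\<lambda>l. perp_lattice (ray p) = range (\<lambda>k. k *s l) \<and> l \<in> dual_monoid \<tau>", OF this]
  show "perp_lattice (ray p) = range (\<lambda>k. k *s curve_coordinate (ray p) \<tau>)"
    "curve_coordinate (ray p) \<tau> \<in> dual_monoid \<tau>"
    unfolding curve_coordinate_def by blast+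
qed

text \<open>
  On a chart with a torus-fixed point the sign is determined, since the opposite exponent is not
  regular there.
\<close>
lemma curve_coordinate_chamber:
  assumes \<epsilon>: "\<epsilon> \<in> {lam, - lam}" "\<epsilon> \<in> dual_monoid \<tau>" and perp: "perp_lattice \<tau> = {0}"
  shows "curve_coordinate (ray p) \<tau> = \<epsilon>"
proof (rule ccontr)
  let ?l = "curve_coordinate (ray p) \<tau>"
  assume "?l \<noteq> \<epsilon>"
  moreover have "?l = lam \<or> ?l = - lam" using generator_unique curve_coordinate_ray(1)[OF \<epsilon>] by blast
  ultimately have l: "?l = - \<epsilon>" using \<epsilon> by auto
  then have "- \<epsilon> \<in> dual_monoid \<tau>" using curve_coordinate_ray(2)[OF \<epsilon>] by simp
  then have "\<epsilon> \<in> perp_lattice \<tau>" using \<epsilon>(2)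
    by (force simp: dual_monoid_def perp_lattice_def rvec_minus)
  then have "\<epsilon> = 0" using perp by simp
  then show False using \<epsilon>(1) lam_nonzero by auto
qed

lemma laurent_eval_split:
  assumes y: "torus_point UNIV y" and f: "Poly_Mapping.keys f \<subseteq> dual_monoid (ray p)"
  shows "laurent_eval f y = curve_restriction lam f (y lam) +
    (\<Sum>m\<in>{m\<in>Poly_Mapping.keys f. pairing p m > 0}.
       Poly_Mapping.lookup f m * y lam powi lam_coord m * y mu ^ nat (pairing p m))"
proof -
  let ?K = "Poly_Mapping.keys f"
  have K: "?K = {m\<in>?K. pairing p m = 0} \<union> {m\<in>?K. pairing p m > 0}"
    using f by (auto simp: dual_monoid_ray)
  have "laurent_eval f y = (\<Sum>m\<in>{m\<in>?K. pairing p m = 0}. Poly_Mapping.lookup f m * y m)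
      + (\<Sum>m\<in>{m\<in>?K. pairing p m > 0}. Poly_Mapping.lookup f m * y m)"
  proof -
    have "sum g ({m\<in>?K. pairing p m = 0} \<union> {m\<in>?K. pairing p m > 0})
        = sum g {m\<in>?K. pairing p m = 0} + sum g {m\<in>?K. pairing p m > 0}" for g :: "int ^ 'r \<Rightarrow> complex"
      by (rule sum.union_disjoint) auto
    then show ?thesis unfolding laurent_eval_def K[symmetric] .
  qed
  also have "(\<Sum>m\<in>{m\<in>?K. pairing p m > 0}. Poly_Mapping.lookup f m * y m)
    = (\<Sum>m\<in>{m\<in>?K. pairing p m > 0}. Poly_Mapping.lookup f m * y lam powi lam_coord m * y mu ^ nat (pairing p m))"
  proof (rule sum.cong)
    fix m assume "m \<in> {m\<in>?K. pairing p m > 0}"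
    then show "Poly_Mapping.lookup f m * y m
        = Poly_Mapping.lookup f m * y lam powi lam_coord m * y mu ^ nat (pairing p m)"
      by (subst torus_point_coordinates[OF y, of m]) (simp add: power_int_def)
  qed simp
  also have "(\<Sum>m\<in>{m\<in>?K. pairing p m = 0}. Poly_Mapping.lookup f m * y m) = curve_restriction lam f (y lam)"
  proof -
    have inj: "inj_on (\<lambda>k::int. k *s lam) A" for A
      using lam_nonzero by (intro inj_onI) (auto simp: vec_eq_iff)
    have img: "{m\<in>?K. pairing p m = 0} = (\<lambda>k. k *s lam) ` {k. k *s lam \<in> ?K}"
    proof -
      have "m \<in> (\<lambda>k. k *s lam) ` {k. k *s lam \<in> ?K}" if "m \<in> ?K" "pairing p m = 0" for m
        using lam_coord[of m] that by (intro image_eqI[of _ _ "lam_coord m"]) auto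
      then show ?thesis by (auto simp: pairing_smult_right p_lam)
    qed
    show ?thesis unfolding img curve_restriction_def
      by (subst sum.reindex[OF inj]) (simp add: torus_point_UNIV_smult[OF y])
  qed
  finally show ?thesis .
qed

text \<open>
  All intersections happen at the single point of the open orbit of \<open>C_W\<close> with coordinate \<open>\<rho>\<close>.
  One function \<open>f0\<close> bounds the local multiplicities on the open orbit from above, and a function
  not vanishing at the torus-fixed point does so on each remaining chart.
\<close>
lemma intersection_number_eqI:
  assumes lam: "lam = curve_coordinate (ray p) (ray p)"
    and fan: "ray p \<in> secondary_fan q UNIV"
    and rho: "\<rho> \<noteq> 0"
    and lower: "\<And>f. f \<in> closure_ideal Y (ray p) \<Longrightarrow> enat n \<le> curve_order lam f \<rho>"
    and f0: "f0 \<in> closure_ideal Y (ray p)"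
    and upper: "\<And>s. s \<noteq> 0 \<Longrightarrow> curve_order lam f0 s = (if s = \<rho> then enat n else 0)"
    and fixed: "\<And>\<tau>. \<tau> \<in> secondary_fan q UNIV \<Longrightarrow> ray p \<subseteq> \<tau> \<Longrightarrow> \<tau> \<noteq> ray p \<Longrightarrow>
      curve_coordinate (ray p) \<tau> \<notin> perp_lattice \<tau> \<and>
      (\<exists>f\<in>closure_ideal Y \<tau>. curve_order (curve_coordinate (ray p) \<tau>) f 0 = 0)"
  shows "intersection_number q Y (ray p) = enat n"
proof -
  define x0 where "x0 m = (if pairing p m = 0 then \<rho> powi lam_coord m else 0)" for m
  define P0 where "P0 = (ray p, x0)"
  have coord: "lam_coord (k *s lam) = k" for k
  proof -
    have "k *s lam = lam_coord (k *s lam) *s lam"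
      using lam_coord[of "k *s lam"] by (simp add: pairing_smult_right p_lam)
    then show ?thesis using lam_nonzero by (auto simp: vec_eq_iff)
  qed
  have x0l: "x0 (k *s lam) = \<rho> powi k" for k
    by (simp add: x0_def pairing_smult_right p_lam coord)
  have x0orb: "x0 \<in> torus_orbit (ray p)"
  proof -
    have "x0 m = 0" if "m \<notin> perp_lattice (ray p)" for m
    proof -
      have "pairing p m \<noteq> 0"
      proof
        assume "pairing p m = 0"
        then have "m = lam_coord m *s lam" using lam_coord[of m] by simp
        then show False using that perp_lattice_ray by blast
      qed
      then show ?thesis by (simp add: x0_def)
    qed
    moreover have "x0 (j *s lam + k *s lam) = x0 (j *s lam) * x0 (k *s lam)" for j k
    proof -
      have "j *s lam + k *s lam = (j + k) *s lam" by (simp add: vec_eq_iff algebra_simps)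
      then have "x0 (j *s lam + k *s lam) = x0 ((j + k) *s lam)" by (rule arg_cong)
      also have "\<dots> = \<rho> powi (j + k)" by (rule x0l)
      finally show ?thesis by (simp add: x0l power_int_add rho)
    qed
    ultimately show ?thesis
      by (auto simp: torus_orbit_def torus_point_def perp_lattice_ray x0l rho)
  qed
  have P0: "P0 \<in> toric_curve q (ray p)"
    using x0orb fan by (simp add: P0_def toric_curve_def)
  have loc: "local_multiplicity Y (ray p) P = (if P = P0 then enat n else 0)"
    if P: "P \<in> toric_curve q (ray p)" for P
  proof -
    obtain \<tau> x where P_eq: "P = (\<tau>, x)" by (cases P)
    have \<tau>: "\<tau> \<in> secondary_fan q UNIV" "ray p \<subseteq> \<tau>" and x: "x \<in> torus_orbit \<tau>"
      using P by (auto simp: P_eq toric_curve_def)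
    have le: "local_multiplicity Y (ray p) P \<le> curve_order (curve_coordinate (ray p) \<tau>) f (x (curve_coordinate (ray p) \<tau>))"
      if "f \<in> closure_ideal Y \<tau>" for f
      unfolding P_eq local_multiplicity_def Let_def by (simp only: prod.case) (rule INF_lower[OF that])
    show ?thesis
    proof (cases "\<tau> = ray p")
      case True
      have xt: "torus_point (range (\<lambda>k. k *s lam)) x" and x0': "\<And>m. m \<notin> range (\<lambda>k. k *s lam) \<Longrightarrow> x m = 0"
        using x True perp_lattice_ray by (auto simp: torus_orbit_def)
      have xk: "x (k *s lam) = x lam powi k" for k
        by (rule torus_point_smult[OF xt]) auto
      have "lam \<in> range (\<lambda>k. k *s lam)" by (rule range_eqI[of _ _ 1]) simp
      then have xl: "x lam \<noteq> 0" using xt unfolding torus_point_def by blast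
      have iff: "P = P0 \<longleftrightarrow> x lam = \<rho>"
      proof
        assume "P = P0"
        then have "x = x0" by (simp add: P_eq P0_def)
        then show "x lam = \<rho>" using x0l[of 1] by simp
      next
        assume r: "x lam = \<rho>"
        have "x m = x0 m" for m
        proof (cases "m \<in> range (\<lambda>k. k *s lam)")
          case True
          then show ?thesis using xk x0l r by auto
        next
          case False
          then show ?thesis using x0' x0orb perp_lattice_ray by (auto simp: torus_orbit_def)
        qed
        then show "P = P0" using True by (auto simp: P_eq P0_def)
      qed
      have le0: "local_multiplicity Y (ray p) P \<le> (if P = P0 then enat n else 0)"
        using le[of f0] f0 True upper[OF xl] iff lam by simp
      moreover have "enat n \<le> local_multiplicity Y (ray p) P" if "P = P0"
        unfolding P_eq local_multiplicity_def Let_def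
        using lower iff that True lam by (auto intro!: INF_greatest)
      ultimately show ?thesis by (auto intro: antisym)
    next
      case False
      from fixed[OF \<tau> False] obtain f where f: "f \<in> closure_ideal Y \<tau>"
        "curve_order (curve_coordinate (ray p) \<tau>) f 0 = 0" "curve_coordinate (ray p) \<tau> \<notin> perp_lattice \<tau>"
        by blast
      have "x (curve_coordinate (ray p) \<tau>) = 0" using f(3) x by (auto simp: torus_orbit_def)
      then have "local_multiplicity Y (ray p) P \<le> 0" using le[OF f(1)] f(2) by simp
      moreover have "P \<noteq> P0" using False by (simp add: P_eq P0_def)
      ultimately show ?thesis by simp
    qed
  qed
  have sum: "(\<Sum>P\<in>S. local_multiplicity Y (ray p) P) = (if P0 \<in> S then enat n else 0)"
    if "finite S" "S \<subseteq> toric_curve q (ray p)" for S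
  proof -
    have "(\<Sum>P\<in>S. local_multiplicity Y (ray p) P) = (\<Sum>P\<in>S. if P = P0 then enat n else 0)"
      using that loc by (intro sum.cong) auto
    then show ?thesis using that by simp
  qed
  show ?thesis unfolding intersection_number_def
  proof (rule antisym)
    show "(SUP P\<in>{P. finite P \<and> P \<subseteq> toric_curve q (ray p)}. \<Sum>p'\<in>P. local_multiplicity Y (ray p) p') \<le> enat n"
      by (rule SUP_least) (use sum in auto)
    have "(\<Sum>p'\<in>{P0}. local_multiplicity Y (ray p) p') = enat n" using sum[of "{P0}"] P0 by simp
    then show "enat n \<le> (SUP P\<in>{P. finite P \<and> P \<subseteq> toric_curve q (ray p)}. \<Sum>p'\<in>P. local_multiplicity Y (ray p) p')"
      using P0 by (intro SUP_upper2[of "{P0}"]) auto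
  qed
qed

lemma cpair_coordinates:
  assumes m: "pairing p m \<noteq> 0"
  shows "\<exists>s1 s2. \<forall>v. cpair v s = of_int (pairing v lam) * s1 + of_int (pairing v m) * s2"
proof -
  let ?e = "\<lambda>j. axis j 1 :: int ^ 'r"
  define t1 where "t1 = (\<Sum>j\<in>UNIV. of_int (lam_coord (?e j)) * s $ j)"
  define t2 where "t2 = (\<Sum>j\<in>UNIV. of_int (pairing p (?e j)) * s $ j)"
  have e: "v $ j = pairing v (?e j)" for v :: "int ^ 'r" and j
    by (simp add: pairing_def axis_def if_distrib cong: if_cong)
  have mu: "cpair v s = of_int (pairing v lam) * t1 + of_int (pairing v mu) * t2" for v
  proof -
    have "v $ j = lam_coord (?e j) * pairing v lam + pairing p (?e j) * pairing v mu" for j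
      unfolding e by (rule pairing_coordinates)
    then show ?thesis
      by (simp add: cpair_def t1_def t2_def algebra_simps sum.distrib sum_distrib_left)
  qed
  let ?b = "of_int (pairing p m) :: complex" and ?k = "of_int (lam_coord m) :: complex"
  have b: "?b \<noteq> 0" using m by simp
  define w where "w = t2 / ?b"
  have t2: "t2 = ?b * w" using b by (simp add: w_def)
  have "cpair v s = of_int (pairing v lam) * (t1 - ?k * w) + of_int (pairing v m) * w" for v
  proof -
    have "of_int (pairing v m) = ?k * of_int (pairing v lam) + ?b * of_int (pairing v mu)"
      by (subst pairing_coordinates) simp
    then show ?thesis unfolding mu t2 by (simp add: algebra_simps)
  qed
  then show ?thesis by blast
qed

end

lemma cpair_combination:
  "cpair v (\<chi> j. s1 * of_int (l $ j) + s2 * of_int (m $ j)) = of_int (pairing v l) * s1 + of_int (pairing v m) * s2"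
  by (simp add: cpair_def pairing_def algebra_simps sum.distrib sum_distrib_left)

context plane_coordinates
begin

lemma lam_coord_eq:
  assumes "l = k *s lam + b *s mu"
  shows "lam_coord l = k" "pairing p l = b"
proof -
  show b: "pairing p l = b" using assms by (simp add: pairing_add_right pairing_smult_right p_lam p_mu)
  have "lam_coord l *s lam + b *s mu = k *s lam + b *s mu" using lam_coord[of l] b assms by metis
  then have "(lam_coord l - k) *s lam = 0" by (simp add: vec_eq_iff algebra_simps)
  then show "lam_coord l = k" using lam_nonzero by (auto simp: vec_eq_iff)
qed

lemma lam_coord_add: "lam_coord (l + m) = lam_coord l + lam_coord m"
proof (rule lam_coord_eq)
  have "l + m = (lam_coord l *s lam + pairing p l *s mu) + (lam_coord m *s lam + pairing p m *s mu)"
    using lam_coord by metis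
  then show "l + m = (lam_coord l + lam_coord m) *s lam + (pairing p l + pairing p m) *s mu"
    by (simp add: vec_eq_iff algebra_simps)
qed

lemma exists_torus_point:
  assumes "u \<noteq> 0" "v \<noteq> 0"
  obtains y where "torus_point UNIV y" "y lam = u" "y mu = v"
proof
  define y where "y l = u powi lam_coord l * v powi pairing p l" for l
  show "torus_point UNIV y"
    using assms by (simp add: torus_point_def y_def lam_coord_add pairing_add_right power_int_add)
  show "y lam = u" using lam_coord_eq[of lam 1 0] by (simp add: y_def)
  show "y mu = v" using lam_coord_eq[of mu 0 1] by (simp add: y_def)
qed

end

section \<open>Intersecting the discriminants with the toric curve\<close>
lemma laurent_of_bipoly_in_closure_ideal:
  assumes "l \<in> dual_monoid \<tau>" "m \<in> dual_monoid \<tau>"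
    and "\<And>y. y \<in> Y \<Longrightarrow> torus_point UNIV y \<and> bipoly G (y l) (y m) = 0"
  shows "laurent_of_bipoly l m G \<in> closure_ideal Y \<tau>"
proof -
  have "int i *s l + int j *s m \<in> dual_monoid \<tau>" for i j
    using assms(1,2) by (auto simp: dual_monoid_def rvec_add rvec_smult inner_add_left)
  then show ?thesis using assms(3)
    by (auto simp: closure_ideal_def laurent_eval_of_bipoly elim!: keys_laurent_of_bipoly)
qed

lemma order_monic_linear: "order s [:-c, 1:] = (if s = c then 1 else 0)" for s c :: complex
proof -
  have "order s [:-c, 1:] = count (proots [:-c, 1:]) s" by (subst count_proots) auto
  then show ?thesis by simp
qed

lemma is_hypersurfaceI:
  assumes f: "f \<noteq> 0" and Y: "Y \<noteq> {}" and van: "\<And>z. z \<in> Y \<Longrightarrow> torus_point UNIV z \<and> laurent_eval f z = 0"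
    and closed: "\<And>y. torus_point UNIV y \<Longrightarrow> laurent_eval f y = 0 \<Longrightarrow> y \<in> torus_closure Y"
  shows "is_hypersurface Y"
proof -
  obtain z where "z \<in> Y" using Y by blast
  then have "\<not> f dvd 1" using van not_unit_if_laurent_zero by blast
  moreover have "torus_closure Y = {y. torus_point UNIV y \<and> laurent_eval f y = 0}"
  proof (intro equalityI subsetI)
    fix y assume "y \<in> torus_closure Y"
    then have 1: "torus_point UNIV y" and 2: "(\<forall>z\<in>Y. laurent_eval f z = 0) \<longrightarrow> laurent_eval f y = 0"
      unfolding torus_closure_def by blast+
    then show "y \<in> {y. torus_point UNIV y \<and> laurent_eval f y = 0}" using van by simp
  qed (use closed in auto)
  ultimately show ?thesis unfolding is_hypersurface_def using f by blast
qed

text \<open>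
  A Calabi-Yau problem together with coordinates adapted to a ray. The weights on the line of \<open>p\<close>
  are those with \<open>wt lam i = 0\<close>, and \<open>wall_degree\<close> is the multiple of \<open>p\<close> that they add up to.
\<close>
locale toric_wall = plane_coordinates p lam mu
  for p lam mu :: "int ^ 'r::finite" +
  fixes q :: "'n::finite \<Rightarrow> int ^ 'r"
  assumes weight_nonzero: "\<And>i. q i \<noteq> 0" and sum_weights: "(\<Sum>i\<in>UNIV. q i) = 0"
begin

abbreviation wt :: "int ^ 'r \<Rightarrow> 'n \<Rightarrow> int" where
  "wt l \<equiv> \<lambda>i. pairing (q i) l"

text \<open>
  The coordinate of the point at which the discriminants meet the toric curve. The weights on the
  line contribute the factor \<open>0 powi 0 = 1\<close>.
\<close>
definition wall_value :: complex where
  "wall_value = (\<Prod>i\<in>UNIV. of_int (pairing (q i) lam) powi pairing (q i) lam)"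

definition wall_degree :: int where
  "wall_degree = (\<Sum>i | pairing (q i) lam = 0. pairing (q i) mu)"

lemma wall_value_nonzero: "wall_value \<noteq> 0"
  by (auto simp: wall_value_def)

lemma sum_pairing: "(\<Sum>i\<in>UNIV. pairing (q i) l) = 0"
  using sum_weights by (simp flip: pairing_sum_left)

lemma weight_coordinates_nonzero:
  assumes "pairing p m \<noteq> 0"
  shows "pairing (q i) lam \<noteq> 0 \<or> pairing (q i) m \<noteq> 0"
proof (rule ccontr)
  assume "\<not> ?thesis"
  then have 1: "pairing (q i) lam = 0" and 2: "pairing (q i) m = 0" by auto
  have qi: "q i = pairing (q i) mu *s p" using dual_coordinates[OF 1] .
  then have "pairing (q i) mu * pairing p m = 0" using 2 by (metis pairing_smult_left)
  then have "q i = 0" using assms qi by (metis mult_eq_0_iff vector_smult_lzero)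
  then show False using weight_nonzero by blast
qed

lemma reverse_wall: "toric_wall p (- lam) mu q"
  by (intro toric_wall.intro toric_wall_axioms.intro reverse_generator weight_nonzero sum_weights)

lemma horn_locus_torus_point: "y \<in> horn_locus q \<Longrightarrow> torus_point UNIV y"
  by (simp add: horn_locus_def)

text \<open>
  Besides \<open>lam\<close> any \<open>m\<close> transversal to \<open>p\<close> may serve as second coordinate. At the torus-fixed points
  \<open>m\<close> is adapted to the other edge of the sector and need not extend \<open>lam\<close> to a lattice basis.
\<close>
lemma horn_locus_coordinates:
  assumes y: "y \<in> horn_locus q" and m: "pairing p m \<noteq> 0"
  obtains s1 s2 where
    "\<And>i. weight_form (wt lam) (wt m) i s1 s2 \<noteq> 0"
    "\<And>l. y l = horn (wt lam) (wt m) (wt l) s1 s2"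
proof -
  obtain s where s: "\<forall>i. cpair (q i) s \<noteq> 0" "\<forall>l. y l = (\<Prod>i\<in>UNIV. cpair (q i) s powi pairing (q i) l)"
    using y by (auto simp: horn_locus_def)
  obtain s1 s2 where "\<forall>v. cpair v s = of_int (pairing v lam) * s1 + of_int (pairing v m) * s2"
    using cpair_coordinates[OF m] by blast
  then show thesis using s by (intro that[of s1 s2]) (auto simp: weight_form_def horn_def)
qed

lemma horn_locus_point:
  assumes s: "\<And>i. weight_form (wt lam) (wt m) i s1 s2 \<noteq> 0"
  shows "(\<lambda>l. horn (wt lam) (wt m) (wt l) s1 s2) \<in> horn_locus q"
proof -
  define s where "s = (\<chi> j. s1 * of_int (lam $ j) + s2 * of_int (m $ j))"
  have c: "cpair (q i) s = weight_form (wt lam) (wt m) i s1 s2" for i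
    unfolding s_def cpair_combination weight_form_def ..
  show ?thesis unfolding horn_locus_def horn_def c[symmetric] using assms
    by (auto simp: torus_point_def pairing_add_right power_int_add prod.distrib c intro!: exI[of _ s])
qed

text \<open>
  For positive degree the path \<open>s = lam + t mu\<close> runs into the toric curve at \<open>t = 0\<close>. There
  \<open>y mu\<close> vanishes to order \<open>wall_degree\<close> and \<open>y lam\<close> is a local parameter.
\<close>
lemma horn_locus_lower_bound:
  assumes f: "f \<in> closure_ideal (horn_locus q) (ray p)"
  shows "enat (nat wall_degree) \<le> curve_order lam f wall_value"
proof (cases "wall_degree > 0")
  case False
  then show ?thesis by (simp add: zero_enat_def[symmetric])
next
  case True
  let ?x = "wt lam" and ?y = "wt mu"
  have nz: "?x i \<noteq> 0 \<or> ?y i \<noteq> 0" for i by (rule weight_coordinates_nonzero) (simp add: p_mu)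
  have K: "Poly_Mapping.keys f \<subseteq> dual_monoid (ray p)" and van: "\<And>y. y \<in> horn_locus q \<Longrightarrow> laurent_eval f y = 0"
    using f by (auto simp: closure_ideal_def)
  have deg: "(\<Sum>i | ?x i = 0. ?y i) \<ge> 0" using True by (simp add: wall_degree_def)
  note path = horn_path[where x="?x" and y="?y", OF nz sum_pairing deg,
      folded wall_value_def wall_degree_def]
  obtain v0 where v0: "((\<lambda>t. horn ?x ?y ?y 1 t / t ^ nat wall_degree) \<longlongrightarrow> v0) (at 0)"
    using path(2) by blast
  show ?thesis
  proof (rule curve_order_ge_of_path[OF lam_nonzero wall_value_nonzero path(1) _ v0])
    show "- wall_value * of_int wall_degree \<noteq> 0" using wall_value_nonzero True by simp
    show "finite {m\<in>Poly_Mapping.keys f. pairing p m > 0}" by simp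
    show "0 < nat (pairing p m)" if "m \<in> {m\<in>Poly_Mapping.keys f. pairing p m > 0}" for m
      using that by simp
    show "\<forall>\<^sub>F t in at 0. curve_restriction lam f (horn ?x ?y ?x 1 t) +
        (\<Sum>m\<in>{m\<in>Poly_Mapping.keys f. pairing p m > 0}. Poly_Mapping.lookup f m *
          horn ?x ?y ?x 1 t powi lam_coord m * horn ?x ?y ?y 1 t ^ nat (pairing p m)) = 0"
      using path(3)
    proof eventually_elim
      case (elim t)
      define Y where "Y = (\<lambda>l. horn ?x ?y (wt l) 1 t)"
      have Y: "Y \<in> horn_locus q" unfolding Y_def by (rule horn_locus_point) (use elim in blast)
      have "laurent_eval f Y = 0" by (rule van[OF Y])
      then show ?case
        unfolding laurent_eval_split[OF horn_locus_torus_point[OF Y] K] by (simp add: Y_def)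
    qed
  qed
qed

text \<open>
  The last claim shows that for positive degree the zero set of the eliminant in the torus is the
  Zariski closure of the curve: a zero is a limit of points of the curve, and Laurent polynomials are continuous.
\<close>
lemma horn_locus_equation:
  obtains G where "coeff G 0 \<noteq> 0"
    "\<And>y. y \<in> horn_locus q \<Longrightarrow> bipoly G (y lam) (y mu) = 0"
    "\<And>s. s \<noteq> 0 \<Longrightarrow> order s (coeff G 0) = (if s = wall_value then nat wall_degree else 0)"
    "\<And>y. wall_degree > 0 \<Longrightarrow> torus_point UNIV y \<Longrightarrow> bipoly G (y lam) (y mu) = 0 \<Longrightarrow>
      y \<in> torus_closure (horn_locus q)"
proof -
  let ?x = "wt lam" and ?y = "wt mu"
  have nz: "?x i \<noteq> 0 \<or> ?y i \<noteq> 0" for i by (rule weight_coordinates_nonzero) (simp add: p_mu)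
  obtain G where G: "coeff G 0 \<noteq> 0"
    "\<And>s1 s2. (\<And>i. weight_form ?x ?y i s1 s2 \<noteq> 0) \<Longrightarrow> bipoly G (horn ?x ?y ?x s1 s2) (horn ?x ?y ?y s1 s2) = 0"
    "\<And>s. s \<noteq> 0 \<Longrightarrow> order s (coeff G 0) = (if s = wall_value then nat wall_degree else 0)"
    "(\<And>i. \<not> (?x i > 0 \<and> ?y i > 0)) \<Longrightarrow> poly (coeff G 0) 0 \<noteq> 0"
    "\<And>U V. wall_degree > 0 \<Longrightarrow> U \<noteq> 0 \<Longrightarrow> V \<noteq> 0 \<Longrightarrow> bipoly G U V = 0 \<Longrightarrow>
       \<exists>s1 s2 (t0::complex). (\<forall>\<^sub>F t in at t0. \<forall>i. weight_form ?x ?y i (s1 t) (s2 t) \<noteq> 0) \<and>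
         ((\<lambda>t. horn ?x ?y ?x (s1 t) (s2 t)) \<longlongrightarrow> U) (at t0) \<and> ((\<lambda>t. horn ?x ?y ?y (s1 t) (s2 t)) \<longlongrightarrow> V) (at t0)"
  proof (rule horn_elimination[where x="?x" and y="?y", OF nz sum_pairing sum_pairing,
        folded wall_value_def wall_degree_def])
    fix G :: "complex poly poly" assume "coeff G 0 \<noteq> 0"
      and "\<And>s1 s2. (\<And>i. weight_form ?x ?y i s1 s2 \<noteq> 0) \<Longrightarrow> bipoly G (horn ?x ?y ?x s1 s2) (horn ?x ?y ?y s1 s2) = 0"
      and "\<And>s. s \<noteq> 0 \<Longrightarrow> order s (coeff G 0) = (if s = wall_value then nat wall_degree else 0)"
      and "(\<And>i. \<not> (?x i > 0 \<and> ?y i > 0)) \<Longrightarrow> poly (coeff G 0) 0 \<noteq> 0"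
      and "\<And>U V. wall_degree > 0 \<Longrightarrow> U \<noteq> 0 \<Longrightarrow> V \<noteq> 0 \<Longrightarrow> bipoly G U V = 0 \<Longrightarrow>
       \<exists>s1 s2 (t0::complex). (\<forall>\<^sub>F t in at t0. \<forall>i. weight_form ?x ?y i (s1 t) (s2 t) \<noteq> 0) \<and>
         ((\<lambda>t. horn ?x ?y ?x (s1 t) (s2 t)) \<longlongrightarrow> U) (at t0) \<and> ((\<lambda>t. horn ?x ?y ?y (s1 t) (s2 t)) \<longlongrightarrow> V) (at t0)"
    then show thesis by (rule that)
  qed
  show thesis
  proof (rule that[OF G(1)])
    show "bipoly G (y lam) (y mu) = 0" if y: "y \<in> horn_locus q" for y
    proof -
      have "pairing p mu \<noteq> 0" by (simp add: p_mu)
      from horn_locus_coordinates[OF y this] show ?thesis using G(2) by metis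
    qed
    show "order s (coeff G 0) = (if s = wall_value then nat wall_degree else 0)" if "s \<noteq> 0" for s
      by (rule G(3)[OF that])
    fix y assume pos: "wall_degree > 0" and y: "torus_point UNIV y" and "bipoly G (y lam) (y mu) = 0"
    from G(5)[OF pos torus_point_UNIV_nonzero[OF y] torus_point_UNIV_nonzero[OF y] this(3)]
    obtain s1 s2 and t0 :: complex where
      ev: "\<forall>\<^sub>F t in at t0. \<forall>i. weight_form ?x ?y i (s1 t) (s2 t) \<noteq> 0" and
      lim: "((\<lambda>t. horn ?x ?y ?x (s1 t) (s2 t)) \<longlongrightarrow> y lam) (at t0)"
        "((\<lambda>t. horn ?x ?y ?y (s1 t) (s2 t)) \<longlongrightarrow> y mu) (at t0)" by blast
    show "y \<in> torus_closure (horn_locus q)"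
      unfolding torus_closure_def
    proof (intro CollectI conjI allI impI y)
      fix f assume van: "\<forall>z\<in>horn_locus q. laurent_eval f z = 0"
      let ?val = "\<lambda>u v. \<Sum>m\<in>Poly_Mapping.keys f. Poly_Mapping.lookup f m * (u powi lam_coord m * v powi pairing p m)"
      have val: "laurent_eval f z = ?val (z lam) (z mu)" if z: "torus_point UNIV z" for z
        unfolding laurent_eval_def
      proof (rule sum.cong)
        fix m show "Poly_Mapping.lookup f m * z m
            = Poly_Mapping.lookup f m * (z lam powi lam_coord m * z mu powi pairing p m)"
          by (subst torus_point_coordinates[OF z, of m]) (rule refl)
      qed simp
      have l1: "((\<lambda>t. ?val (horn ?x ?y ?x (s1 t) (s2 t)) (horn ?x ?y ?y (s1 t) (s2 t))) \<longlongrightarrow> ?val (y lam) (y mu)) (at t0)"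
        by (intro tendsto_intros lim torus_point_UNIV_nonzero[OF y])
      have eq: "\<forall>\<^sub>F t in at t0. ?val (horn ?x ?y ?x (s1 t) (s2 t)) (horn ?x ?y ?y (s1 t) (s2 t)) = 0"
        using ev
      proof eventually_elim
        case (elim t)
        define Y where "Y = (\<lambda>l. horn ?x ?y (wt l) (s1 t) (s2 t))"
        have Y: "Y \<in> horn_locus q" unfolding Y_def by (rule horn_locus_point) (use elim in blast)
        have "laurent_eval f Y = 0" using van Y by blast
        then show ?case unfolding val[OF horn_locus_torus_point[OF Y]] by (simp add: Y_def)
      qed
      have "?val (y lam) (y mu) = 0"
        by (rule tendsto_unique[OF _ Lim_transform_eventually[OF l1 eq] tendsto_const]) simp
      then show "laurent_eval f y = 0" unfolding val[OF y] .
    qed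
  qed
qed

lemma horn_locus_nonempty: "horn_locus q \<noteq> {}"
proof -
  let ?x = "wt lam" and ?y = "wt mu"
  have nz: "?x i \<noteq> 0 \<or> ?y i \<noteq> 0" for i by (rule weight_coordinates_nonzero) (simp add: p_mu)
  have "\<forall>\<^sub>F t in at (0::complex). \<forall>i. weight_form ?x ?y i 1 t \<noteq> 0"
    by (rule weight_forms_eventually_nonzero[OF nz])
  then obtain t :: complex where "\<forall>i. weight_form ?x ?y i 1 t \<noteq> 0"
    using eventually_happens[of _ "at (0::complex)"] by auto
  then have "weight_form ?x ?y i 1 t \<noteq> 0" for i by blast
  from horn_locus_point[OF this] show ?thesis by blast
qed

text \<open>
  Elimination with the two edges of the dual cone as coordinates gives a regular function with
  non-zero constant term.
\<close>
lemma horn_locus_misses_fixed_point: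
  assumes lam: "lam \<in> dual_monoid \<tau>" and m: "m \<in> dual_monoid \<tau>" "pairing p m > 0"
    and no: "\<And>i. \<not> (pairing (q i) lam > 0 \<and> pairing (q i) m > 0)"
  shows "\<exists>f\<in>closure_ideal (horn_locus q) \<tau>. curve_order lam f 0 = 0"
proof -
  let ?x = "wt lam" and ?y = "wt m"
  have m0: "pairing p m \<noteq> 0" using m by simp
  have nz: "?x i \<noteq> 0 \<or> ?y i \<noteq> 0" for i by (rule weight_coordinates_nonzero[OF m0])
  obtain G where G: "coeff G 0 \<noteq> 0"
    "\<And>s1 s2. (\<And>i. weight_form ?x ?y i s1 s2 \<noteq> 0) \<Longrightarrow> bipoly G (horn ?x ?y ?x s1 s2) (horn ?x ?y ?y s1 s2) = 0"
    "(\<And>i. \<not> (?x i > 0 \<and> ?y i > 0)) \<Longrightarrow> poly (coeff G 0) 0 \<noteq> 0"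
  proof (rule horn_elimination[where x="?x" and y="?y", OF nz sum_pairing sum_pairing])
    fix G assume "coeff G 0 \<noteq> 0"
      and "\<And>s1 s2. (\<And>i. weight_form ?x ?y i s1 s2 \<noteq> 0) \<Longrightarrow> bipoly G (horn ?x ?y ?x s1 s2) (horn ?x ?y ?y s1 s2) = 0"
      and "(\<And>i. \<not> (?x i > 0 \<and> ?y i > 0)) \<Longrightarrow> poly (coeff G 0) 0 \<noteq> 0"
    then show thesis by (rule that)
  qed
  let ?f = "laurent_of_bipoly lam m G"
  have "?f \<in> closure_ideal (horn_locus q) \<tau>"
  proof (rule laurent_of_bipoly_in_closure_ideal[OF lam m(1)])
    fix y assume y: "y \<in> horn_locus q"
    from horn_locus_coordinates[OF y m0] have "bipoly G (y lam) (y m) = 0" using G(2) by metis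
    then show "torus_point UNIV y \<and> bipoly G (y lam) (y m) = 0"
      using horn_locus_torus_point[OF y] by blast
  qed
  moreover have "curve_order lam ?f 0 = 0"
    using curve_order_laurent_of_bipoly[where l=lam and m=m and G=G and s=0, OF independent[OF m0] G(1)]
      order_0I[OF G(3)[OF no]] by (simp add: zero_enat_def)
  ultimately show ?thesis by blast
qed

text \<open>
  What is needed of a chamber adjacent to the ray: \<open>\<epsilon>\<close> and \<open>m\<close> vanish on one edge each of a sector
  containing the chamber, and no weight lies in the interior of that sector.
\<close>
definition isolates_fixed_point :: "(real ^ 'r) set \<Rightarrow> bool" where
  "isolates_fixed_point \<tau> \<longleftrightarrow> perp_lattice \<tau> = {0} \<and>
     (\<exists>\<epsilon> m. \<epsilon> \<in> {lam, - lam} \<and> \<epsilon> \<in> dual_monoid \<tau> \<and> m \<in> dual_monoid \<tau> \<and> pairing p m > 0 \<and>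
       (\<forall>i. \<not> (pairing (q i) \<epsilon> > 0 \<and> pairing (q i) m > 0)))"

lemma isolates_fixed_pointE:
  assumes "isolates_fixed_point \<tau>"
  obtains \<epsilon> m where "perp_lattice \<tau> = {0}" "\<epsilon> \<in> {lam, - lam}" "\<epsilon> \<in> dual_monoid \<tau>"
    "m \<in> dual_monoid \<tau>" "pairing p m > 0" "\<forall>i. \<not> (pairing (q i) \<epsilon> > 0 \<and> pairing (q i) m > 0)"
proof -
  have 1: "perp_lattice \<tau> = {0}" and 2: "\<exists>\<epsilon> m. \<epsilon> \<in> {lam, - lam} \<and> \<epsilon> \<in> dual_monoid \<tau> \<and>
      m \<in> dual_monoid \<tau> \<and> pairing p m > 0 \<and> (\<forall>i. \<not> (pairing (q i) \<epsilon> > 0 \<and> pairing (q i) m > 0))"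
    using assms unfolding isolates_fixed_point_def by (rule conjunct1 conjunct2)+
  from 2 show thesis
  proof (elim exE conjE)
    fix \<epsilon> m assume a: "\<epsilon> \<in> {lam, - lam}" "\<epsilon> \<in> dual_monoid \<tau>" "m \<in> dual_monoid \<tau>" "pairing p m > 0"
      "\<forall>i. \<not> (pairing (q i) \<epsilon> > 0 \<and> pairing (q i) m > 0)"
    show thesis by (rule that[OF 1 a])
  qed
qed

text \<open>
  The convention \<open>0\<close> for sets that are not hypersurfaces does not interfere: for positive degree
  the locus is a hypersurface, and otherwise the intersection number is \<open>0\<close> anyway.
\<close>
theorem horn_locus_intersection:
  assumes lam: "lam = curve_coordinate (ray p) (ray p)"
    and ray: "ray p \<in> secondary_fan q UNIV"
    and fan: "\<And>\<tau>. \<tau> \<in> secondary_fan q UNIV \<Longrightarrow> ray p \<subseteq> \<tau> \<Longrightarrow> \<tau> \<noteq> ray p \<Longrightarrow> isolates_fixed_point \<tau>"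
  shows "(if is_hypersurface (horn_locus q) then intersection_number q (horn_locus q) (ray p) else 0)
    = enat (nat wall_degree)"
proof -
  obtain G where G: "coeff G 0 \<noteq> 0"
    "\<And>y. y \<in> horn_locus q \<Longrightarrow> bipoly G (y lam) (y mu) = 0"
    "\<And>s. s \<noteq> 0 \<Longrightarrow> order s (coeff G 0) = (if s = wall_value then nat wall_degree else 0)"
    "\<And>y. wall_degree > 0 \<Longrightarrow> torus_point UNIV y \<Longrightarrow> bipoly G (y lam) (y mu) = 0 \<Longrightarrow>
      y \<in> torus_closure (horn_locus q)"
  proof (rule horn_locus_equation)
    fix G :: "complex poly poly" assume "coeff G 0 \<noteq> 0"
      and "\<And>y. y \<in> horn_locus q \<Longrightarrow> bipoly G (y lam) (y mu) = 0"
      and "\<And>s. s \<noteq> 0 \<Longrightarrow> order s (coeff G 0) = (if s = wall_value then nat wall_degree else 0)"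
      and "\<And>y. wall_degree > 0 \<Longrightarrow> torus_point UNIV y \<Longrightarrow> bipoly G (y lam) (y mu) = 0 \<Longrightarrow>
      y \<in> torus_closure (horn_locus q)"
    then show thesis by (rule that)
  qed
  let ?f = "laurent_of_bipoly lam mu G"
  have mu0: "pairing p mu \<noteq> 0" by (simp add: p_mu)
  have "intersection_number q (horn_locus q) (ray p) = enat (nat wall_degree)"
  proof (rule intersection_number_eqI[OF lam ray wall_value_nonzero horn_locus_lower_bound, where ?f0.0="?f"])
    show "?f \<in> closure_ideal (horn_locus q) (ray p)"
      by (rule laurent_of_bipoly_in_closure_ideal)
        (use G(2) horn_locus_torus_point in \<open>auto simp: dual_monoid_ray p_lam p_mu\<close>)
    show "curve_order lam ?f s = (if s = wall_value then enat (nat wall_degree) else 0)" if "s \<noteq> 0" for s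
      using curve_order_laurent_of_bipoly[where l=lam and m=mu and G=G and s=s, OF independent[OF mu0] G(1)]
        G(3)[OF that] by (simp add: zero_enat_def)
    fix \<tau> assume \<tau>: "\<tau> \<in> secondary_fan q UNIV" "ray p \<subseteq> \<tau>" "\<tau> \<noteq> ray p"
    obtain \<epsilon> m where em: "perp_lattice \<tau> = {0}" "\<epsilon> \<in> {lam, - lam}" "\<epsilon> \<in> dual_monoid \<tau>"
      "m \<in> dual_monoid \<tau>" "pairing p m > 0" "\<forall>i. \<not> (pairing (q i) \<epsilon> > 0 \<and> pairing (q i) m > 0)"
      by (rule isolates_fixed_pointE[OF fan[OF \<tau>]])
    have c: "curve_coordinate (ray p) \<tau> = \<epsilon>" by (rule curve_coordinate_chamber[OF em(2,3,1)])
    interpret E: toric_wall p \<epsilon> mu q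
      using em(2) reverse_wall toric_wall_axioms by auto
    show "curve_coordinate (ray p) \<tau> \<notin> perp_lattice \<tau> \<and>
      (\<exists>f\<in>closure_ideal (horn_locus q) \<tau>. curve_order (curve_coordinate (ray p) \<tau>) f 0 = 0)"
      using E.horn_locus_misses_fixed_point[OF em(3,4,5) em(6)[rule_format]] E.lam_nonzero em(1) by (simp add: c)
  qed
  moreover have "is_hypersurface (horn_locus q)" if pos: "wall_degree > 0"
  proof (rule is_hypersurfaceI[OF laurent_of_bipoly_nonzero[OF independent[OF mu0] G(1)] horn_locus_nonempty])
    show "torus_point UNIV z \<and> laurent_eval ?f z = 0" if "z \<in> horn_locus q" for z
      using horn_locus_torus_point[OF that] G(2)[OF that] by (simp add: laurent_eval_of_bipoly)
    show "y \<in> torus_closure (horn_locus q)" if y: "torus_point UNIV y" "laurent_eval ?f y = 0" for y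
      using G(4)[OF pos y(1)] y(2) laurent_eval_of_bipoly[OF y(1)] by simp
  qed
  ultimately show ?thesis by (cases "wall_degree > 0") (auto simp: zero_enat_def)
qed

text \<open>
  A translate of a one-dimensional subtorus, transversal to the toric curve of the ray.
\<close>
definition coset_locus :: "(int ^ 'r \<Rightarrow> complex) set" where
  "coset_locus = {y. torus_point UNIV y \<and> y lam = wall_value}"

theorem coset_locus_intersection:
  assumes lam: "lam = curve_coordinate (ray p) (ray p)"
    and ray: "ray p \<in> secondary_fan q UNIV"
    and fan: "\<And>\<tau>. \<tau> \<in> secondary_fan q UNIV \<Longrightarrow> ray p \<subseteq> \<tau> \<Longrightarrow> \<tau> \<noteq> ray p \<Longrightarrow> isolates_fixed_point \<tau>"
  shows "is_hypersurface coset_locus" "intersection_number q coset_locus (ray p) = 1"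
proof -
  define G where "G c = [:[:-c, 1:]:]" for c :: complex
  have biG: "bipoly (G c) U V = U - c" for c U V by (simp add: G_def bipoly_def)
  have G0: "coeff (G c) 0 = [:-c, 1:]" for c by (simp add: G_def)
  have G0': "coeff (G c) 0 \<noteq> 0" for c by (simp add: G0)
  let ?f = "laurent_of_bipoly lam mu (G wall_value)"
  have mu0: "pairing p mu \<noteq> 0" by (simp add: p_mu)
  have tor: "torus_point UNIV y" if "y \<in> coset_locus" for y using that by (simp add: coset_locus_def)
  have eval: "laurent_eval ?f y = y lam - wall_value" if "torus_point UNIV y" for y
    by (simp add: laurent_eval_of_bipoly[OF that] biG)
  show "is_hypersurface coset_locus"
  proof (rule is_hypersurfaceI[OF laurent_of_bipoly_nonzero[OF independent[OF mu0] G0'[of wall_value]]])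
    obtain y where "torus_point UNIV y" "y lam = wall_value"
      using exists_torus_point[OF wall_value_nonzero, of 1] by auto
    then show "coset_locus \<noteq> {}" by (auto simp: coset_locus_def)
    show "torus_point UNIV z \<and> laurent_eval ?f z = 0" if "z \<in> coset_locus" for z
      using tor[OF that] that eval by (simp add: coset_locus_def)
    show "y \<in> torus_closure coset_locus" if "torus_point UNIV y" "laurent_eval ?f y = 0" for y
      using that eval[OF that(1)] by (simp add: torus_closure_def coset_locus_def)
  qed
  have "intersection_number q coset_locus (ray p) = enat 1"
  proof (rule intersection_number_eqI[OF lam ray wall_value_nonzero, where ?f0.0="?f"])
    show "?f \<in> closure_ideal coset_locus (ray p)"
    proof (rule laurent_of_bipoly_in_closure_ideal)
      show "lam \<in> dual_monoid (ray p)" "mu \<in> dual_monoid (ray p)"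
        by (simp_all add: dual_monoid_ray p_lam p_mu)
      show "torus_point UNIV y \<and> bipoly (G wall_value) (y lam) (y mu) = 0" if "y \<in> coset_locus" for y
        using that by (simp add: coset_locus_def biG)
    qed
    show "curve_order lam ?f s = (if s = wall_value then enat 1 else 0)" for s
      using curve_order_laurent_of_bipoly[where l=lam and m=mu and G="G wall_value" and s=s, OF independent[OF mu0] G0']
      by (simp add: G0 order_monic_linear zero_enat_def)
    show "enat 1 \<le> curve_order lam f wall_value" if f: "f \<in> closure_ideal coset_locus (ray p)" for f
    proof (cases "\<exists>k. k *s lam \<in> Poly_Mapping.keys f")
      case False
      then show ?thesis by (auto simp: curve_order_def)
    next
      case True
      have K: "Poly_Mapping.keys f \<subseteq> dual_monoid (ray p)" and van: "\<And>y. y \<in> coset_locus \<Longrightarrow> laurent_eval f y = 0"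
        using f by (auto simp: closure_ideal_def)
      let ?B = "{m\<in>Poly_Mapping.keys f. pairing p m > 0}"
      let ?r = "\<lambda>v. curve_restriction lam f wall_value +
          (\<Sum>m\<in>?B. Poly_Mapping.lookup f m * wall_value powi lam_coord m * v ^ nat (pairing p m))"
      have "\<forall>\<^sub>F v in at (0::complex). v \<noteq> 0" by (simp add: eventually_at_filter)
      then have ev: "\<forall>\<^sub>F v in at 0. ?r v = 0"
      proof eventually_elim
        case (elim v)
        obtain y where y: "torus_point UNIV y" "y lam = wall_value" "y mu = v"
          using exists_torus_point[OF wall_value_nonzero elim] by metis
        then have "laurent_eval f y = 0" by (intro van) (simp add: coset_locus_def)
        then show ?case using laurent_eval_split[OF y(1) K] y by simp
      qed
      \<comment> \<open>the free coordinate \<open>v\<close> of the coset tends to \<open>0\<close>\<close>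
      have lim: "(?r \<longlongrightarrow> ?r 0) (at 0)" by (intro tendsto_intros)
      have "?r 0 = 0"
        by (rule tendsto_unique[OF _ Lim_transform_eventually[OF lim ev] tendsto_const]) simp
      moreover have "(\<Sum>m\<in>?B. Poly_Mapping.lookup f m * wall_value powi lam_coord m * 0 ^ nat (pairing p m)) = 0"
        by (intro sum.neutral) auto
      ultimately have zero: "curve_restriction lam f wall_value = 0" by simp
      obtain P N where P: "P \<noteq> 0" "\<And>s. s \<noteq> 0 \<Longrightarrow> curve_restriction lam f s = poly P s / s ^ N"
        "\<And>s. s \<noteq> 0 \<Longrightarrow> curve_order lam f s = enat (order s P)"
        using curve_restriction_as_poly[OF lam_nonzero True] by metis
      have "poly P wall_value = 0" using zero P(2)[OF wall_value_nonzero] wall_value_nonzero by simp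
      then have "order wall_value P \<noteq> 0" using P(1) order_root by blast
      then show ?thesis using P(3)[OF wall_value_nonzero] by simp
    qed
    fix \<tau> assume \<tau>: "\<tau> \<in> secondary_fan q UNIV" "ray p \<subseteq> \<tau>" "\<tau> \<noteq> ray p"
    obtain \<epsilon> m where em: "perp_lattice \<tau> = {0}" "\<epsilon> \<in> {lam, - lam}" "\<epsilon> \<in> dual_monoid \<tau>"
      "m \<in> dual_monoid \<tau>" "pairing p m > 0" "\<forall>i. \<not> (pairing (q i) \<epsilon> > 0 \<and> pairing (q i) m > 0)"
      by (rule isolates_fixed_pointE[OF fan[OF \<tau>]])
    have c: "curve_coordinate (ray p) \<tau> = \<epsilon>" by (rule curve_coordinate_chamber[OF em(2,3,1)])
    interpret E: toric_wall p \<epsilon> mu q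
      using em(2) reverse_wall toric_wall_axioms by auto
    have m0: "pairing p m \<noteq> 0" using em by simp
    \<comment> \<open>on the chart with coordinate \<open>- lam\<close> the equation is inverted\<close>
    define r where "r = (if \<epsilon> = lam then wall_value else inverse wall_value)"
    have r: "y \<epsilon> = r" if "y \<in> coset_locus" for y
    proof -
      have "- lam = (-1) *s lam" by (simp add: vec_eq_iff)
      then have "y (- lam) = inverse (y lam)"
        using torus_point_UNIV_smult[OF tor[OF that], of "-1" lam] by (simp add: power_int_minus)
      then show ?thesis using em(2) that by (auto simp: r_def coset_locus_def)
    qed
    have r0: "r \<noteq> 0" using wall_value_nonzero by (simp add: r_def)
    let ?g = "laurent_of_bipoly \<epsilon> m (G r)"
    have "?g \<in> closure_ideal coset_locus \<tau>"
      by (rule laurent_of_bipoly_in_closure_ideal[OF em(3,4)]) (simp add: tor biG r)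
    moreover have "curve_order \<epsilon> ?g 0 = 0"
      using curve_order_laurent_of_bipoly[where l=\<epsilon> and m=m and G="G r" and s=0, OF E.independent[OF m0] G0']
      by (simp add: G0 order_monic_linear zero_enat_def r0)
    ultimately show "curve_coordinate (ray p) \<tau> \<notin> perp_lattice \<tau> \<and>
      (\<exists>f\<in>closure_ideal coset_locus \<tau>. curve_order (curve_coordinate (ray p) \<tau>) f 0 = 0)"
      using E.lam_nonzero em(1) by (auto simp: c)
  qed
  then show "intersection_number q coset_locus (ray p) = 1" by (simp add: one_enat_def)
qed

end

section \<open>Gale duality and the discriminants of minimal faces\<close>
lemma lincomb_component: "lincomb b k $ j = (\<Sum>i\<in>UNIV. k $ i * b i $ j)"
  by (simp add: lincomb_def)

lemma lincomb_add: "lincomb b (k + k') = lincomb b k + lincomb b k'"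
  by (simp add: vec_eq_iff lincomb_component algebra_simps sum.distrib)

lemma lincomb_smult: "lincomb b (c *s k) = c *s lincomb b k"
  by (simp add: vec_eq_iff lincomb_component algebra_simps sum_distrib_left)

lemma lincomb_axis: "lincomb b (axis i c) = c *s b i"
  by (simp add: vec_eq_iff lincomb_component axis_def if_distrib[where f="\<lambda>x. x * _"] cong: if_cong)

lemma coweights_relation:
  assumes "is_rays q a"
  shows "lincomb a (coweights q l) = 0"
proof -
  have "\<exists>m>0. \<exists>l'. m *s coweights q l = coweights q l'"
    by (intro exI[of _ 1] conjI exI[of _ l]) (simp_all add: vec_eq_iff)
  then show ?thesis using assms unfolding is_rays_def by blast
qed

text \<open>
  Gale duality over the complex numbers. Sections \<open>B j\<close> of the surjection \<open>lincomb a\<close> split any relation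
  \<open>z\<close> as a complex combination of the integral relations \<open>K i\<close>, and a multiple of each of those is
  given by an element of \<open>L\<close>.
\<close>
lemma complex_relation_from_weights:
  fixes q :: "'n::finite \<Rightarrow> int ^ 'r::finite" and a :: "'n \<Rightarrow> int ^ 'd::finite"
  assumes rays: "is_rays q a"
    and z: "\<And>j. (\<Sum>i\<in>UNIV. z i * of_int (a i $ j)) = (0 :: complex)"
  obtains s where "\<forall>i. z i = cpair (q i) s"
proof -
  have surj: "surj (lincomb a)" using rays by (simp add: is_rays_def)
  \<comment> \<open>\<open>K i\<close> corrects the basis vector \<open>e_i\<close> by sections to an integral relation\<close>
  define B where "B j = (SOME k. lincomb a k = axis j 1)" for j
  have B: "lincomb a (B j) = axis j 1" for j
    unfolding B_def by (rule someI_ex) (metis surj surjD)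
  define K where "K i = axis i 1 - (\<Sum>j\<in>UNIV. a i $ j *s B j)" for i
  have lc_sum: "lincomb a (\<Sum>j\<in>A. f j) = (\<Sum>j\<in>A. lincomb a (f j))" for A :: "'d set" and f
  proof (induction A rule: infinite_finite_induct)
    case empty
    show ?case using lincomb_smult[of a 0 0] by simp
  next
    case (infinite A)
    then show ?case using lincomb_smult[of a 0 0] by simp
  qed (simp add: lincomb_add)
  have "lincomb a (K i) = 0" for i
  proof -
    have "lincomb a (axis i 1) = lincomb a (K i + (\<Sum>j\<in>UNIV. a i $ j *s B j))" by (simp add: K_def)
    also have "\<dots> = lincomb a (K i) + (\<Sum>j\<in>UNIV. a i $ j *s axis j 1)"
      by (simp add: lincomb_add lc_sum lincomb_smult B)
    also have "(\<Sum>j\<in>UNIV. a i $ j *s axis j 1) = a i"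
      by (simp add: vec_eq_iff axis_def if_distrib cong: if_cong)
    finally show ?thesis by (simp add: lincomb_axis)
  qed
  then have "\<exists>m>0. \<exists>l. m *s K i = coweights q l" for i
    using rays by (simp add: is_rays_def)
  then obtain m l where ml: "\<And>i. m i > 0" "\<And>i. m i *s K i = coweights q (l i)" by metis
  have K: "of_int (K i $ k) = (of_int (pairing (q k) (l i)) / of_int (m i) :: complex)" for i k
  proof -
    have "m i * K i $ k = pairing (q k) (l i)"
      using arg_cong[OF ml(2)[of i], of "\<lambda>v. v $ k"] by (simp add: coweights_def)
    then have "of_int (m i) * of_int (K i $ k) = (of_int (pairing (q k) (l i)) :: complex)"
      by (metis of_int_mult)
    then show ?thesis using ml(1)[of i] by (simp add: field_simps)
  qed
  \<comment> \<open>the correction terms cancel because \<open>z\<close> is a relation\<close>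
  have zk: "z k = (\<Sum>i\<in>UNIV. z i * of_int (K i $ k))" for k
  proof -
    have "(\<Sum>i\<in>UNIV. z i * of_int (K i $ k))
      = (\<Sum>i\<in>UNIV. z i * of_int (axis i 1 $ k)) - (\<Sum>i\<in>UNIV. \<Sum>j\<in>UNIV. z i * of_int (a i $ j) * of_int (B j $ k))"
      by (simp add: K_def algebra_simps sum_subtractf sum_distrib_left)
    also have "(\<Sum>i\<in>UNIV. \<Sum>j\<in>UNIV. z i * of_int (a i $ j) * of_int (B j $ k))
      = (\<Sum>j\<in>UNIV. (\<Sum>i\<in>UNIV. z i * of_int (a i $ j)) * of_int (B j $ k))"
      by (subst sum.swap) (simp add: sum_distrib_right)
    also have "\<dots> = 0" using z by simp
    also have "(\<Sum>i\<in>UNIV. z i * of_int (axis i 1 $ k)) = z k"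
      by (simp add: axis_def if_distrib cong: if_cong)
    finally show ?thesis by simp
  qed
  show thesis
  proof (rule that, rule allI)
    fix k
    show "z k = cpair (q k) (\<chi> j. \<Sum>i\<in>UNIV. z i / of_int (m i) * of_int (l i $ j))"
    proof -
      have "z k = (\<Sum>i\<in>UNIV. \<Sum>j\<in>UNIV. z i / of_int (m i) * of_int (l i $ j) * of_int (q k $ j))"
        by (subst zk) (simp add: K pairing_def sum_distrib_left sum_divide_distrib algebra_simps)
      also have "\<dots> = (\<Sum>j\<in>UNIV. \<Sum>i\<in>UNIV. z i / of_int (m i) * of_int (l i $ j) * of_int (q k $ j))"
        by (rule sum.swap)
      also have "\<dots> = cpair (q k) (\<chi> j. \<Sum>i\<in>UNIV. z i / of_int (m i) * of_int (l i $ j))"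
        by (simp add: cpair_def sum_distrib_left algebra_simps)
      finally show ?thesis .
    qed
  qed
qed

lemma face_lattice_zero: "0 \<in> face_lattice a \<Gamma>"
  unfolding face_lattice_def using lincomb_smult[of a 0 0] by (intro CollectI exI[of _ 0]) auto

lemma face_lattice_add: "u \<in> face_lattice a \<Gamma> \<Longrightarrow> v \<in> face_lattice a \<Gamma> \<Longrightarrow> u + v \<in> face_lattice a \<Gamma>"
  unfolding face_lattice_def by clarify (metis (no_types, lifting) lincomb_add vector_add_component add_0)

lemma face_lattice_smult: "i \<in> \<Gamma> \<Longrightarrow> k *s a i \<in> face_lattice a \<Gamma>"
  unfolding face_lattice_def by (intro CollectI exI[of _ "axis i k"] conjI) (simp only: lincomb_axis, auto simp: axis_def)

lemma face_lattice_sum: "A \<subseteq> \<Gamma> \<Longrightarrow> (\<Sum>i\<in>A. k i *s a i) \<in> face_lattice a \<Gamma>"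
  by (induction A rule: infinite_finite_induct) (auto simp: face_lattice_zero face_lattice_add face_lattice_smult)

lemma torus_point_face_sum:
  assumes x: "torus_point (face_lattice a \<Gamma>) x" and A: "finite A" "A \<subseteq> \<Gamma>"
  shows "x (\<Sum>i\<in>A. k i *s a i) = (\<Prod>i\<in>A. x (a i) powi k i)"
  using A
proof induction
  case empty
  then show ?case using torus_point_zero[OF x face_lattice_zero] by simp
next
  case (insert i A)
  have "x (k i *s a i + (\<Sum>i\<in>A. k i *s a i)) = x (k i *s a i) * x (\<Sum>i\<in>A. k i *s a i)"
    using x insert.prems by (simp add: torus_point_def face_lattice_sum face_lattice_smult)
  moreover have "x (k i *s a i) = x (a i) powi k i"
    by (rule torus_point_smult[OF x]) (use insert.prems in \<open>auto intro: face_lattice_smult\<close>)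
  ultimately show ?case using insert by simp
qed

lemma additive_face_sum:
  fixes \<phi> :: "int ^ 'd::finite \<Rightarrow> complex"
  assumes add: "\<forall>u\<in>face_lattice a \<Gamma>. \<forall>v\<in>face_lattice a \<Gamma>. \<phi> (u + v) = \<phi> u + \<phi> v"
    and A: "finite A" "A \<subseteq> \<Gamma>"
  shows "\<phi> (\<Sum>i\<in>A. k i *s a i) = (\<Sum>i\<in>A. of_int (k i) * \<phi> (a i))"
proof -
  have zero: "\<phi> 0 = 0" using add face_lattice_zero[of a \<Gamma>] by force
  have sm: "\<phi> (k *s a i) = of_int k * \<phi> (a i)" if i: "i \<in> \<Gamma>" for i k
  proof -
    have step: "\<phi> ((k + 1) *s a i) = \<phi> (k *s a i) + \<phi> (a i)" for k
    proof -
      have "(k + 1) *s a i = k *s a i + 1 *s a i" by (simp add: vec_eq_iff algebra_simps)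
      then have "\<phi> ((k + 1) *s a i) = \<phi> (k *s a i) + \<phi> (1 *s a i)"
        using add face_lattice_smult[OF i] by metis
      then show ?thesis by simp
    qed
    show ?thesis
    proof (induction k rule: int_induct[where k=0])
      case base then show ?case using zero by simp
    next
      case (step1 k) then show ?case using step[of k] by (simp add: algebra_simps)
    next
      case (step2 k) then show ?case using step[of "k - 1"] by (simp add: algebra_simps)
    qed
  qed
  show ?thesis using A
  proof induction
    case empty then show ?case using zero by simp
  next
    case (insert i A)
    have "\<phi> (k i *s a i + (\<Sum>i\<in>A. k i *s a i)) = \<phi> (k i *s a i) + \<phi> (\<Sum>i\<in>A. k i *s a i)"
      using add insert.prems by (simp add: face_lattice_sum face_lattice_smult)
    then show ?case using insert by (simp add: sm)
  qed
qed

lemma face_relation_sum: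
  assumes rays: "is_rays q a" and l: "l \<in> face_relations q \<Gamma>"
  shows "(\<Sum>i\<in>\<Gamma>. pairing (q i) l *s a i) = 0"
proof -
  have "(\<Sum>i\<in>\<Gamma>. pairing (q i) l *s a i) = lincomb a (coweights q l)"
    unfolding lincomb_def by (intro sum.mono_neutral_cong_left) (use l in \<open>auto simp: coweights_def face_relations_def\<close>)
  then show ?thesis using coweights_relation[OF rays] by simp
qed

lemma potential_derivative:
  "((\<lambda>t. potential a \<Gamma> c (\<lambda>u. x u * exp (t * \<phi> u))) has_field_derivative
     (\<Sum>i\<in>\<Gamma>. c i * x (a i) * \<phi> (a i))) (at 0)"
  unfolding potential_def by (auto intro!: derivative_eq_intros sum.cong)

text \<open>
  At a critical point \<open>x\<close> of the potential the vector of the \<open>c i * x (a i)\<close> is a relation among the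
  rays, so it has the form \<open>\<langle>q i, s\<rangle>\<close>. The unknown \<open>x\<close> disappears from monomials with exponents
  in \<open>L_\<Gamma>\<close> since these exponents are relations as well. This is the Horn-Kapranov argument.
\<close>
lemma discriminant_locus_critical:
  assumes rays: "is_rays q a" and c: "c \<in> discriminant_locus a \<Gamma>" and nz: "\<forall>i\<in>\<Gamma>. c i \<noteq> 0"
  obtains s where "\<forall>i. i \<in> \<Gamma> \<longleftrightarrow> cpair (q i) s \<noteq> 0"
    "\<forall>l\<in>face_relations q \<Gamma>.
      (\<Prod>i\<in>\<Gamma>. c i powi pairing (q i) l) = (\<Prod>i\<in>\<Gamma>. cpair (q i) s powi pairing (q i) l)"
proof -
  obtain x where x: "torus_point (face_lattice a \<Gamma>) x"
    and d: "\<And>\<phi>. (\<forall>u\<in>face_lattice a \<Gamma>. \<forall>v\<in>face_lattice a \<Gamma>. \<phi> (u + v) = \<phi> u + \<phi> v) \<Longrightarrow>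
            ((\<lambda>t. potential a \<Gamma> c (\<lambda>u. x u * exp (t * \<phi> u))) has_field_derivative 0) (at 0)"
    using c unfolding discriminant_locus_def by blast
  define z where "z i = (if i \<in> \<Gamma> then c i * x (a i) else 0)" for i
  have xa: "x (a i) \<noteq> 0" if "i \<in> \<Gamma>" for i
    using x face_lattice_smult[OF that, of 1 a] by (simp add: torus_point_def)
  have "(\<Sum>i\<in>UNIV. z i * of_int (a i $ j)) = 0" for j
  proof -
    have "(\<Sum>i\<in>\<Gamma>. c i * x (a i) * of_int (a i $ j)) = 0"
      using DERIV_unique[OF potential_derivative d[of "\<lambda>u. of_int (u $ j)"]] by simp
    moreover have "(\<Sum>i\<in>UNIV. z i * of_int (a i $ j)) = (\<Sum>i\<in>\<Gamma>. c i * x (a i) * of_int (a i $ j))"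
      by (intro sum.mono_neutral_cong_right) (auto simp: z_def)
    ultimately show ?thesis by simp
  qed
  then obtain s where "\<forall>i. z i = cpair (q i) s" by (rule complex_relation_from_weights[OF rays])
  then have s: "\<And>i. z i = cpair (q i) s" by blast
  show thesis
  proof (rule that)
    show "\<forall>i. i \<in> \<Gamma> \<longleftrightarrow> cpair (q i) s \<noteq> 0"
      using nz xa by (auto simp: s[symmetric] z_def)
    show "\<forall>l\<in>face_relations q \<Gamma>.
      (\<Prod>i\<in>\<Gamma>. c i powi pairing (q i) l) = (\<Prod>i\<in>\<Gamma>. cpair (q i) s powi pairing (q i) l)"
    proof
    fix l assume l: "l \<in> face_relations q \<Gamma>"
    have "(\<Prod>i\<in>\<Gamma>. x (a i) powi pairing (q i) l) = x (\<Sum>i\<in>\<Gamma>. pairing (q i) l *s a i)"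
      by (rule torus_point_face_sum[OF x, symmetric]) auto
    also have "\<dots> = 1"
      using face_relation_sum[OF rays l] torus_point_zero[OF x face_lattice_zero] by simp
    finally have one: "(\<Prod>i\<in>\<Gamma>. x (a i) powi pairing (q i) l) = 1" .
    have "(\<Prod>i\<in>\<Gamma>. cpair (q i) s powi pairing (q i) l) = (\<Prod>i\<in>\<Gamma>. c i powi pairing (q i) l * x (a i) powi pairing (q i) l)"
      by (rule prod.cong) (auto simp: s[symmetric] z_def power_int_mult_distrib)
    then show "(\<Prod>i\<in>\<Gamma>. c i powi pairing (q i) l) = (\<Prod>i\<in>\<Gamma>. cpair (q i) s powi pairing (q i) l)"
      using one by (simp add: prod.distrib)
    qed
  qed
qed

text \<open>
  Conversely a combination of elements of \<open>L_\<Gamma>\<close> gives coefficients with a critical point at the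
  unit of the torus. The potential vanishes there by the Calabi-Yau condition.
\<close>
lemma relation_in_discriminant_locus:
  assumes rays: "is_rays q a" and cy: "(\<Sum>i\<in>UNIV. q i) = 0"
    and l: "\<And>k. k \<in> K \<Longrightarrow> l k \<in> face_relations q \<Gamma>"
    and c: "\<And>i. c i = (\<Sum>k\<in>K. t k * of_int (pairing (q i) (l k)))"
  shows "c \<in> discriminant_locus a \<Gamma>"
proof -
  have torus: "torus_point (face_lattice a \<Gamma>) (\<lambda>_. 1)" by (simp add: torus_point_def)
  have swap: "(\<Sum>i\<in>\<Gamma>. c i * g i) = (\<Sum>k\<in>K. t k * (\<Sum>i\<in>\<Gamma>. of_int (pairing (q i) (l k)) * g i))" for g
    unfolding c sum_distrib_right sum_distrib_left by (subst sum.swap) (simp add: mult.assoc)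
  have "(\<Sum>i\<in>\<Gamma>. pairing (q i) (l k)) = 0" if "k \<in> K" for k
  proof -
    have "(\<Sum>i\<in>\<Gamma>. pairing (q i) (l k)) = (\<Sum>i\<in>UNIV. pairing (q i) (l k))"
      by (rule sum.mono_neutral_left) (use l[OF that] in \<open>auto simp: face_relations_def coweights_def\<close>)
    then show ?thesis using cy by (simp flip: pairing_sum_left)
  qed
  then have "(\<Sum>i\<in>\<Gamma>. of_int (pairing (q i) (l k)) * 1) = (0::complex)" if "k \<in> K" for k
    using that by (simp flip: of_int_sum)
  then have pot: "potential a \<Gamma> c (\<lambda>_. 1) = 0"
    unfolding potential_def swap by (simp cong: sum.cong)
  have "((\<lambda>t. potential a \<Gamma> c (\<lambda>u. 1 * exp (t * \<phi> u))) has_field_derivative 0) (at 0)"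
    if add: "\<forall>u\<in>face_lattice a \<Gamma>. \<forall>v\<in>face_lattice a \<Gamma>. \<phi> (u + v) = \<phi> u + \<phi> v" for \<phi>
  proof -
    have zero: "\<phi> 0 = 0" using add face_lattice_zero[of a \<Gamma>] by force
    have "(\<Sum>i\<in>\<Gamma>. of_int (pairing (q i) (l k)) * \<phi> (a i)) = 0" if "k \<in> K" for k
      using additive_face_sum[OF add, of \<Gamma> "\<lambda>i. pairing (q i) (l k)"] face_relation_sum[OF rays l[OF that]] zero
      by simp
    then have "(\<Sum>i\<in>\<Gamma>. c i * \<phi> (a i)) = 0" unfolding swap by simp
    then show ?thesis using potential_derivative[of a \<Gamma> c "\<lambda>_. 1" \<phi>] by simp
  qed
  then show ?thesis unfolding discriminant_locus_def using torus pot
    by (intro CollectI exI[of _ "\<lambda>_. 1"]) simp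
qed

lemma face_relations_UNIV: "face_relations q UNIV = UNIV"
  by (simp add: face_relations_def)

theorem nabla_UNIV:
  assumes rays: "is_rays q a" and cy: "(\<Sum>i\<in>UNIV. q i) = 0"
  shows "nabla q a UNIV = horn_locus q"
proof (intro equalityI subsetI)
  fix y assume "y \<in> nabla q a UNIV"
  then obtain c where y: "torus_point UNIV y" and c: "c \<in> discriminant_locus a UNIV" "\<forall>i\<in>UNIV. c i \<noteq> 0"
    and yl: "y = (\<lambda>l. \<Prod>i\<in>UNIV. c i powi pairing (q i) l)"
    unfolding nabla_def nabla'_def by (auto simp: face_relations_UNIV coweights_def restrict_UNIV)
  obtain s where
    "\<forall>i. i \<in> UNIV \<longleftrightarrow> cpair (q i) s \<noteq> 0" "\<forall>l\<in>face_relations q UNIV.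
      (\<Prod>i\<in>UNIV. c i powi pairing (q i) l) = (\<Prod>i\<in>UNIV. cpair (q i) s powi pairing (q i) l)"
    by (rule discriminant_locus_critical[OF rays c])
  then show "y \<in> horn_locus q" using y unfolding horn_locus_def yl face_relations_UNIV by auto
next
  fix y assume "y \<in> horn_locus q"
  then obtain s where y: "torus_point UNIV y" and s: "\<And>i. cpair (q i) s \<noteq> 0"
    and yl: "y = (\<lambda>l. \<Prod>i\<in>UNIV. cpair (q i) s powi pairing (q i) l)"
    unfolding horn_locus_def by blast
  have e: "pairing v (axis j 1) = v $ j" for v :: "int ^ 'b" and j
    by (simp add: pairing_def axis_def if_distrib cong: if_cong)
  have "(\<lambda>i. cpair (q i) s) \<in> discriminant_locus a UNIV"
    by (rule relation_in_discriminant_locus[OF rays cy, where K=UNIV and t="\<lambda>j. s $ j" and l="\<lambda>j. axis j 1"])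
      (auto simp: face_relations_UNIV e cpair_def mult.commute)
  then show "y \<in> nabla q a UNIV" using y s unfolding nabla_def nabla'_def
    by (auto simp: face_relations_UNIV coweights_def yl restrict_UNIV intro!: exI[of _ "\<lambda>i. cpair (q i) s"])
qed

text \<open>
  The defining inequality of a face, evaluated at the rays, is a linear relation among the weights
  that is positive exactly off the face.
\<close>
lemma face_positive_relation:
  assumes rays: "is_rays q a" and cy: "(\<Sum>i\<in>UNIV. q i) = 0" and face: "is_face a \<Gamma>"
  obtains b :: "'n::finite \<Rightarrow> real"
  where "\<forall>i\<in>\<Gamma>. b i = 0" "\<forall>i. i \<notin> \<Gamma> \<longrightarrow> b i > 0"
    "\<forall>l. (\<Sum>i\<in>UNIV. b i * of_int (pairing (q i) l)) = 0"
proof -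
  obtain F where F: "F face_of ray_polytope a" and \<Gamma>: "\<Gamma> = {i. rvec (a i) \<in> F}"
    using face by (auto simp: is_face_def)
  have "polyhedron (ray_polytope a)"
    unfolding ray_polytope_def by (intro polytope_imp_polyhedron polytope_convex_hull) simp
  then have "F exposed_face_of ray_polytope a" using F exposed_face_of_polyhedron by blast
  then obtain c \<beta> where sub: "ray_polytope a \<subseteq> {x. c \<bullet> x \<le> \<beta>}" and Feq: "F = ray_polytope a \<inter> {x. c \<bullet> x = \<beta>}"
    unfolding exposed_face_of_def by blast
  have mem: "rvec (a i) \<in> ray_polytope a" for i
    unfolding ray_polytope_def by (rule hull_inc) simp
  show thesis
  proof (rule that[of "\<lambda>i. \<beta> - c \<bullet> rvec (a i)"])
    show "\<forall>i\<in>\<Gamma>. \<beta> - c \<bullet> rvec (a i) = 0" by (simp add: \<Gamma> Feq)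
    show "\<forall>i. i \<notin> \<Gamma> \<longrightarrow> \<beta> - c \<bullet> rvec (a i) > 0"
    proof (intro allI impI)
      fix i assume "i \<notin> \<Gamma>"
      then show "\<beta> - c \<bullet> rvec (a i) > 0" using sub mem[of i] by (force simp: \<Gamma> Feq)
    qed
    show "\<forall>l. (\<Sum>i\<in>UNIV. (\<beta> - c \<bullet> rvec (a i)) * of_int (pairing (q i) l)) = 0"
    proof
    fix l
    have 1: "(\<Sum>i\<in>UNIV. pairing (q i) l) = 0" using cy by (simp flip: pairing_sum_left)
    have "(\<Sum>i\<in>UNIV. of_int (pairing (q i) l) *\<^sub>R rvec (a i)) = rvec (lincomb a (coweights q l))"
      by (simp add: lincomb_def rvec_sum rvec_smult coweights_def)
    then have 2: "(\<Sum>i\<in>UNIV. of_int (pairing (q i) l) *\<^sub>R rvec (a i)) = 0"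
      using coweights_relation[OF rays] by simp
    have "(\<Sum>i\<in>UNIV. (\<beta> - c \<bullet> rvec (a i)) * of_int (pairing (q i) l))
      = \<beta> * of_int (\<Sum>i\<in>UNIV. pairing (q i) l) - c \<bullet> (\<Sum>i\<in>UNIV. of_int (pairing (q i) l) *\<^sub>R rvec (a i))"
      by (simp add: inner_sum_right sum_subtractf sum_distrib_left algebra_simps)
    then show "(\<Sum>i\<in>UNIV. (\<beta> - c \<bullet> rvec (a i)) * of_int (pairing (q i) l)) = 0"
      using 1 2 by simp
    qed
  qed
qed

lemma (in plane_coordinates) rvec_in_span_ray: "rvec v \<in> span (ray p) \<longleftrightarrow> pairing v lam = 0"
proof
  assume "rvec v \<in> span (ray p)"
  moreover have "pairing lam p = 0" using p_lam pairing_commute by metis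
  then have "span (ray p) \<subseteq> {w. rvec lam \<bullet> w = 0}"
    by (intro span_minimal subspace_hyperplane) (auto simp: ray_def rvec_inner)
  ultimately show "pairing v lam = 0" by (auto simp: rvec_inner pairing_commute)
next
  assume "pairing v lam = 0"
  then have "rvec v = of_int (pairing v mu) *\<^sub>R rvec p" using dual_coordinates[of v] rvec_smult by metis
  then show "rvec v \<in> span (ray p)" by (simp add: span_base span_scale generator_in_ray)
qed

text \<open>
  Minimality provides a relation supported on the face that involves \<open>i\<close>.
\<close>
lemma minimal_face_relation:
  assumes rays: "is_rays q a" and inj: "inj a" and min: "minimal_face a \<Gamma>" and i: "i \<in> \<Gamma>"
  obtains s where "cpair (q i) s \<noteq> 0" "\<forall>j. j \<notin> \<Gamma> \<longrightarrow> cpair (q j) s = 0"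
proof -
  let ?r = "\<lambda>j. rvec (a j)"
  have "?r i \<in> span (?r ` (\<Gamma> - {i}))" using min i by (auto simp: minimal_face_def)
  then obtain u where "?r i = (\<Sum>v\<in>?r ` (\<Gamma> - {i}). u v *\<^sub>R v)" by (subst (asm) span_finite) auto
  also have "\<dots> = (\<Sum>j\<in>\<Gamma> - {i}. u (?r j) *\<^sub>R ?r j)"
    by (subst sum.reindex) (use inj in \<open>auto simp: inj_on_def inj_def\<close>)
  finally have u: "?r i = (\<Sum>j\<in>\<Gamma> - {i}. u (?r j) *\<^sub>R ?r j)" .
  define z where "z j = (if j = i then 1 else if j \<in> \<Gamma> then - complex_of_real (u (?r j)) else 0)" for j
  have "(\<Sum>j\<in>UNIV. z j * of_int (a j $ k)) = 0" for k
  proof -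
    have "real_of_int (a i $ k) = (\<Sum>j\<in>\<Gamma> - {i}. u (?r j) * of_int (a j $ k))"
      using arg_cong[OF u, of "\<lambda>v. v $ k"] by (simp add: rvec_def)
    then have "complex_of_real (real_of_int (a i $ k))
        = complex_of_real (\<Sum>j\<in>\<Gamma> - {i}. u (?r j) * of_int (a j $ k))" by (rule arg_cong)
    then have "complex_of_int (a i $ k) = (\<Sum>j\<in>\<Gamma> - {i}. complex_of_real (u (?r j)) * of_int (a j $ k))"
      by simp
    moreover have "(\<Sum>j\<in>UNIV. z j * of_int (a j $ k)) = z i * of_int (a i $ k) + (\<Sum>j\<in>UNIV - {i}. z j * of_int (a j $ k))"
      by (rule sum.remove) auto
    moreover have "(\<Sum>j\<in>UNIV - {i}. z j * of_int (a j $ k)) = (\<Sum>j\<in>\<Gamma> - {i}. - (complex_of_real (u (?r j)) * of_int (a j $ k)))"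
      by (rule sum.mono_neutral_cong_right) (auto simp: z_def)
    ultimately show ?thesis by (simp add: z_def sum_negf)
  qed
  then obtain s where "\<forall>j. z j = cpair (q j) s" by (rule complex_relation_from_weights[OF rays])
  then have s: "\<And>j. z j = cpair (q j) s" by blast
  show thesis by (rule that[of s]) (use i in \<open>auto simp: s[symmetric] z_def\<close>)
qed

context toric_wall
begin

text \<open>
  A relation supported on the face is given by some \<open>s\<close> annihilating the weights off the face, which
  span the line; so no weight of the face lies on the line. The positive relation among the
  weights off the face forces them to lie on both sides of the origin.
\<close>
lemma face_outside_line:
  assumes rays: "is_rays q a" and inj: "inj a" and min: "minimal_face a \<Gamma>"
    and sub: "face_subspace q \<Gamma> \<subseteq> span (ray p)" and ne: "\<Gamma> \<noteq> UNIV"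
  shows "\<Gamma> = {i. pairing (q i) lam \<noteq> 0}" "face_subspace q \<Gamma> = span (ray p)"
    "\<exists>i. pairing (q i) lam = 0 \<and> pairing (q i) mu < 0"
proof -
  have out: "pairing (q i) lam = 0" if "i \<notin> \<Gamma>" for i
  proof -
    have "rvec (q i) \<in> face_subspace q \<Gamma>" unfolding face_subspace_def using that by (intro span_base) auto
    then show ?thesis using sub rvec_in_span_ray by blast
  qed
  obtain i0 where i0: "i0 \<notin> \<Gamma>" using ne by blast
  have q0: "q i0 = pairing (q i0) mu *s p" using dual_coordinates[OF out[OF i0]] .
  have k0: "pairing (q i0) mu \<noteq> 0" using q0 weight_nonzero[of i0] by auto
  have "pairing (q i) lam \<noteq> 0" if i: "i \<in> \<Gamma>" for i
  proof
    assume "pairing (q i) lam = 0"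
    then have qi: "q i = pairing (q i) mu *s p" by (rule dual_coordinates)
    obtain s where s: "cpair (q i) s \<noteq> 0" "\<forall>j. j \<notin> \<Gamma> \<longrightarrow> cpair (q j) s = 0"
      by (rule minimal_face_relation[OF rays inj min i])
    have cp: "cpair (k *s p) s = of_int k * cpair p s" for k
      by (simp add: cpair_def sum_distrib_left algebra_simps)
    have "cpair p s = 0" using s(2) i0 k0 cp[of "pairing (q i0) mu"] q0 by simp
    then show False using s(1) cp[of "pairing (q i) mu"] qi by simp
  qed
  then show "\<Gamma> = {i. pairing (q i) lam \<noteq> 0}" using out by blast
  show "face_subspace q \<Gamma> = span (ray p)"
  proof (rule equalityI[OF sub])
    have "rvec (q i0) \<in> face_subspace q \<Gamma>" unfolding face_subspace_def using i0 by (intro span_base) auto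
    then have "(1 / of_int (pairing (q i0) mu)) *\<^sub>R rvec (q i0) \<in> face_subspace q \<Gamma>"
      unfolding face_subspace_def by (rule span_scale)
    moreover have "(1 / of_int (pairing (q i0) mu)) *\<^sub>R rvec (q i0) = rvec p"
    proof -
      have "rvec (q i0) = of_int (pairing (q i0) mu) *\<^sub>R rvec p" using q0 rvec_smult by metis
      then show ?thesis using k0 by simp
    qed
    ultimately show "span (ray p) \<subseteq> face_subspace q \<Gamma>"
      unfolding span_ray by (intro span_minimal) (auto simp: face_subspace_def)
  qed
  have "is_face a \<Gamma>" using min by (simp add: minimal_face_def)
  then obtain b :: "'n \<Rightarrow> real" where b': "\<forall>i\<in>\<Gamma>. b i = 0" "\<forall>i. i \<notin> \<Gamma> \<longrightarrow> b i > 0"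
    "\<forall>l. (\<Sum>i\<in>UNIV. b i * of_int (pairing (q i) l)) = 0"
    by (rule face_positive_relation[OF rays sum_weights])
  then have b: "\<And>i. i \<in> \<Gamma> \<Longrightarrow> b i = 0" "\<And>i. i \<notin> \<Gamma> \<Longrightarrow> b i > 0"
    "(\<Sum>i\<in>UNIV. b i * of_int (pairing (q i) mu)) = 0" by simp_all
  \<comment> \<open>a sum of non-negative terms with a non-zero one would not vanish\<close>
  have "\<exists>i. i \<notin> \<Gamma> \<and> pairing (q i) mu < 0"
  proof (rule ccontr)
    assume "\<not> ?thesis"
    then have nn: "b i * of_int (pairing (q i) mu) \<ge> 0" for i
      using b(1,2)[of i] by (cases "i \<in> \<Gamma>") (auto simp: not_less)
    then have "b i0 * of_int (pairing (q i0) mu) = 0"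
      using b(3) sum_nonneg_eq_0_iff[of UNIV "\<lambda>i. b i * of_int (pairing (q i) mu)"] by simp
    then show False using b(2)[OF i0] k0 by simp
  qed
  then show "\<exists>i. pairing (q i) lam = 0 \<and> pairing (q i) mu < 0" using out by blast
qed

text \<open>
  Here \<open>L_\<Gamma>\<close> is generated by \<open>lam\<close>, and the vector \<open>s\<close> of a critical point is a multiple of \<open>lam\<close>. The multiple cancels
  because the weights have sum zero, so the reduced discriminant is a single point.
\<close>
theorem nabla_outside_line:
  assumes rays: "is_rays q a" and \<Gamma>: "\<Gamma> = {i. pairing (q i) lam \<noteq> 0}" and ne: "\<Gamma> \<noteq> UNIV"
  shows "nabla q a \<Gamma> = coset_locus"
proof -
  obtain i0 where i0: "i0 \<notin> \<Gamma>" using ne by blast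
  then have l0: "pairing (q i0) lam = 0" by (simp add: \<Gamma>)
  have q0: "q i0 = pairing (q i0) mu *s p" using dual_coordinates[OF l0] .
  have k0: "pairing (q i0) mu \<noteq> 0" using q0 weight_nonzero[of i0] by auto
  have rel: "face_relations q \<Gamma> = range (\<lambda>k. k *s lam)"
  proof (intro equalityI subsetI)
    fix l assume "l \<in> face_relations q \<Gamma>"
    then have "pairing (q i0) l = 0" using i0 by (simp add: face_relations_def coweights_def)
    then have "pairing (q i0) mu * pairing p l = 0" using q0 pairing_smult_left by metis
    then have "pairing p l = 0" using k0 by simp
    then have "l = lam_coord l *s lam" using lam_coord[of l] by simp
    then show "l \<in> range (\<lambda>k. k *s lam)" by blast
  qed (auto simp: face_relations_def coweights_def \<Gamma> pairing_smult_right)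
  have lam_rel: "lam \<in> face_relations q \<Gamma>" unfolding rel by (rule range_eqI[of _ _ 1]) simp
  have wv: "wall_value = (\<Prod>i\<in>\<Gamma>. of_int (pairing (q i) lam) powi pairing (q i) lam)"
    unfolding wall_value_def by (rule prod.mono_neutral_right) (auto simp: \<Gamma>)
  have sum\<Gamma>: "(\<Sum>i\<in>\<Gamma>. pairing (q i) lam) = 0"
  proof -
    have "(\<Sum>i\<in>\<Gamma>. pairing (q i) lam) = (\<Sum>i\<in>UNIV. pairing (q i) lam)"
      by (rule sum.mono_neutral_left) (auto simp: \<Gamma>)
    then show ?thesis using sum_pairing by simp
  qed
  have "y \<in> coset_locus" if "y \<in> nabla q a \<Gamma>" for y
  proof -
    obtain c where y: "torus_point UNIV y" and c: "c \<in> discriminant_locus a \<Gamma>" "\<forall>i\<in>\<Gamma>. c i \<noteq> 0"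
      and yl: "restrict y (face_relations q \<Gamma>) = restrict (\<lambda>l. \<Prod>i\<in>\<Gamma>. c i powi pairing (q i) l) (face_relations q \<Gamma>)"
      using \<open>y \<in> nabla q a \<Gamma>\<close> unfolding nabla_def nabla'_def by (auto simp: coweights_def)
    obtain s where
      s: "\<forall>i. i \<in> \<Gamma> \<longleftrightarrow> cpair (q i) s \<noteq> 0" "\<forall>l\<in>face_relations q \<Gamma>.
        (\<Prod>i\<in>\<Gamma>. c i powi pairing (q i) l) = (\<Prod>i\<in>\<Gamma>. cpair (q i) s powi pairing (q i) l)"
      by (rule discriminant_locus_critical[OF rays c])
    have "y lam = (\<Prod>i\<in>\<Gamma>. c i powi pairing (q i) lam)"
      using fun_cong[OF yl, of lam] lam_rel by simp
    then have ylam: "y lam = (\<Prod>i\<in>\<Gamma>. cpair (q i) s powi pairing (q i) lam)" using s(2) lam_rel by simp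
    have "pairing p mu \<noteq> 0" by (simp add: p_mu)
    from cpair_coordinates[OF this] obtain s1 s2 where
      st: "\<And>v. cpair v s = of_int (pairing v lam) * s1 + of_int (pairing v mu) * s2" by blast
    \<comment> \<open>a weight on the line is off the face, so the form of \<open>s\<close> vanishes on it\<close>
    have "s2 = 0" using spec[OF s(1), of i0] i0 st[of "q i0"] l0 k0 by simp
    then have st': "cpair v s = of_int (pairing v lam) * s1" for v using st by simp
    have "(\<Prod>i\<in>\<Gamma>. s1 powi pairing (q i) lam) = 1"
    proof (cases "\<Gamma> = {}")
      case False
      then obtain i where "i \<in> \<Gamma>" by blast
      then have s1: "s1 \<noteq> 0" using spec[OF s(1), of i] st'[of "q i"] by auto
      have "(\<Prod>i\<in>A. s1 powi pairing (q i) lam) = s1 powi (\<Sum>i\<in>A. pairing (q i) lam)" if "finite A" for A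
        using that by induction (auto simp: power_int_add s1)
      then show ?thesis using sum\<Gamma> by simp
    qed simp
    then have "y lam = wall_value"
      unfolding ylam st' wv power_int_mult_distrib prod.distrib by simp
    then show ?thesis using y by (simp add: coset_locus_def)
  qed
  moreover have "y \<in> nabla q a \<Gamma>" if "y \<in> coset_locus" for y
  proof -
    have y: "torus_point UNIV y" "y lam = wall_value" using that by (auto simp: coset_locus_def)
    define c where "c i = (of_int (pairing (q i) lam) :: complex)" for i
    have "c \<in> discriminant_locus a \<Gamma>"
      by (rule relation_in_discriminant_locus[OF rays sum_weights, where K="{()}" and t="\<lambda>_. 1" and l="\<lambda>_. lam"])
        (auto simp: lam_rel c_def)
    moreover have "\<forall>i\<in>\<Gamma>. c i \<noteq> 0" by (simp add: c_def \<Gamma>)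
    moreover have "y l = (\<Prod>i\<in>\<Gamma>. c i powi pairing (q i) l)" if l: "l \<in> face_relations q \<Gamma>" for l
    proof -
      obtain k where k: "l = k *s lam" using l rel by auto
      have pow: "(\<Prod>i\<in>A. f i powi k) = (\<Prod>i\<in>A. f i) powi k" if "finite A" for A :: "'n set" and f :: "'n \<Rightarrow> complex"
        using that by induction (auto simp: power_int_mult_distrib)
      have "(\<Prod>i\<in>\<Gamma>. c i powi pairing (q i) l) = (\<Prod>i\<in>\<Gamma>. (c i powi pairing (q i) lam) powi k)"
        by (simp add: k pairing_smult_right mult.commute[of k] power_int_mult)
      also have "\<dots> = wall_value powi k" unfolding wv c_def by (rule pow) simp
      finally show ?thesis using torus_point_UNIV_smult[OF y(1), of k lam] y(2) k by simp
    qed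
    then have "restrict y (face_relations q \<Gamma>) = restrict (\<lambda>l. \<Prod>i\<in>\<Gamma>. c i powi pairing (q i) l) (face_relations q \<Gamma>)"
      by (intro restrict_ext) auto
    ultimately show ?thesis using y(1) unfolding nabla_def nabla'_def
      by (auto simp: coweights_def intro!: exI[of _ c])
  qed
  ultimately show ?thesis by blast
qed

end

section \<open>The secondary fan of a plane\<close>
lemma weight_cone_iff:
  fixes q :: "'n::finite \<Rightarrow> int ^ 'r::finite"
  shows "v \<in> weight_cone q I \<longleftrightarrow> (\<exists>c. (\<forall>i. c i \<ge> 0) \<and> v = (\<Sum>i\<in>I. c i *\<^sub>R rvec (q i)))"
proof
  let ?S = "{(\<Sum>i\<in>I. c i *\<^sub>R rvec (q i)) | c. \<forall>i. c i \<ge> 0}"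
  assume "v \<in> weight_cone q I"
  moreover have "weight_cone q I \<subseteq> ?S"
    unfolding weight_cone_def
  proof (rule hull_minimal)
    show "(\<lambda>i. rvec (q i)) ` I \<subseteq> ?S"
    proof (clarify)
      fix i assume i: "i \<in> I"
      have "rvec (q i) = (\<Sum>k\<in>I. (if k = i then 1 else 0) *\<^sub>R rvec (q k))"
        using i by (simp add: if_distrib[where f="\<lambda>x. x *\<^sub>R _"] cong: if_cong)
      then show "\<exists>c. rvec (q i) = (\<Sum>i\<in>I. c i *\<^sub>R rvec (q i)) \<and> (\<forall>i. (c i :: real) \<ge> 0)"
        by (intro exI[of _ "\<lambda>k. if k = i then 1 else 0"]) auto
    qed
    have 0: "0 \<in> ?S" by (intro CollectI exI[of _ "\<lambda>_. 0"]) simp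
    have add: "x + y \<in> ?S" if xy: "x \<in> ?S" "y \<in> ?S" for x y
    proof -
      obtain c d where "x = (\<Sum>i\<in>I. c i *\<^sub>R rvec (q i))" "\<forall>i. c i \<ge> 0"
        "y = (\<Sum>i\<in>I. d i *\<^sub>R rvec (q i))" "\<forall>i. d i \<ge> 0" using xy by blast
      then show ?thesis
        by (intro CollectI exI[of _ "\<lambda>i. c i + d i"]) (simp add: scaleR_add_left sum.distrib)
    qed
    have scale: "t *\<^sub>R x \<in> ?S" if x: "x \<in> ?S" "t \<ge> 0" for x t
    proof -
      obtain c where "x = (\<Sum>i\<in>I. c i *\<^sub>R rvec (q i))" "\<forall>i. c i \<ge> 0" using x by blast
      then show ?thesis using x(2)
        by (intro CollectI exI[of _ "\<lambda>i. t * c i"]) (simp add: scaleR_sum_right)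
    qed
    have "?S \<noteq> {}" using 0 by blast
    moreover have "conic ?S" unfolding conic_def by (intro allI impI scale)
    moreover have "convex ?S" unfolding convex_def by (intro ballI allI impI add scale)
    ultimately show "convex_cone ?S" by (simp add: convex_cone_def)
  qed
  ultimately show "\<exists>c. (\<forall>i. c i \<ge> 0) \<and> v = (\<Sum>i\<in>I. c i *\<^sub>R rvec (q i))" by blast
next
  assume "\<exists>c. (\<forall>i. c i \<ge> 0) \<and> v = (\<Sum>i\<in>I. c i *\<^sub>R rvec (q i))"
  then obtain c where c: "\<And>i. c i \<ge> 0" "v = (\<Sum>i\<in>I. c i *\<^sub>R rvec (q i))" by blast
  have "(\<Sum>i\<in>A. c i *\<^sub>R rvec (q i)) \<in> weight_cone q I" if "finite A" "A \<subseteq> I" for A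
    using that
  proof induction
    case empty then show ?case by (simp add: weight_cone_def convex_cone_hull_contains_0)
  next
    case (insert i A)
    have "c i *\<^sub>R rvec (q i) \<in> weight_cone q I" unfolding weight_cone_def
      using insert.prems c(1) by (intro convex_cone_hull_mul hull_inc) auto
    then show ?case using insert unfolding weight_cone_def
      by (simp add: convex_cone_hull_add)
  qed
  from this[of I] show "v \<in> weight_cone q I" by (simp add: c(2))
qed

lemma weight_cone_pair:
  fixes q :: "'n::finite \<Rightarrow> int ^ 'r::finite"
  assumes "v \<in> weight_cone q {i, j}"
  obtains s t where "s \<ge> 0" "t \<ge> 0" "v = s *\<^sub>R rvec (q i) + t *\<^sub>R rvec (q j)"
proof -
  obtain c where c: "\<forall>i. c i \<ge> 0" "v = (\<Sum>k\<in>{i, j}. c k *\<^sub>R rvec (q k))"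
    using assms weight_cone_iff by blast
  show thesis
  proof (cases "i = j")
    case True
    then show thesis using c by (intro that[of "c i" 0]) auto
  next
    case False
    then show thesis using c by (intro that[of "c i" "c j"]) auto
  qed
qed

lemma pair_in_weight_cone:
  fixes q :: "'n::finite \<Rightarrow> int ^ 'r::finite"
  assumes "i \<in> I" "j \<in> I" "s \<ge> 0" "t \<ge> 0"
  shows "s *\<^sub>R rvec (q i) + t *\<^sub>R rvec (q j) \<in> weight_cone q I"
  unfolding weight_cone_def using assms
  by (intro convex_cone_hull_add convex_cone_hull_mul hull_inc) auto

lemma weight_cone_scale: "v \<in> weight_cone q I \<Longrightarrow> t \<ge> 0 \<Longrightarrow> t *\<^sub>R v \<in> weight_cone q I"
  unfolding weight_cone_def by (rule convex_cone_hull_mul)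

text \<open>
  The rotated vector \<open>g\<close> spans the orthogonal complement of \<open>\<theta>\<close>.
\<close>
lemma orthogonal_in_plane:
  fixes \<theta> :: "real ^ 'r::finite"
  assumes card: "CARD('r) = 2" and \<theta>: "\<theta> \<noteq> 0"
  obtains g where "\<theta> \<bullet> g = 0" "\<forall>v. v \<bullet> g = 0 \<longrightarrow> v = ((v \<bullet> \<theta>) / (\<theta> \<bullet> \<theta>)) *\<^sub>R \<theta>"
proof -
  obtain i j :: 'r where ij: "UNIV = {i, j}" "i \<noteq> j" using card by (auto simp: card_2_iff)
  have inner: "u \<bullet> v = u $ i * v $ i + u $ j * v $ j" for u v :: "real ^ 'r"
    by (simp add: inner_vec_def ij(1) ij(2))
  have eqI: "u = v" if "u $ i = v $ i" "u $ j = v $ j" for u v :: "real ^ 'r"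
    unfolding vec_eq_iff
  proof
    fix k :: 'r
    have "k \<in> {i, j}" using ij(1) by blast
    then show "u $ k = v $ k" using that by auto
  qed
  define g :: "real ^ 'r" where "g = (\<chi> k. if k = i then - \<theta> $ j else \<theta> $ i)"
  have g: "g $ i = - \<theta> $ j" "g $ j = \<theta> $ i" using ij(2) by (auto simp: g_def)
  have N: "\<theta> \<bullet> \<theta> \<noteq> 0" using \<theta> by simp
  show thesis
  proof (rule that[of g])
    show "\<theta> \<bullet> g = 0" by (simp add: inner g)
    show "\<forall>v. v \<bullet> g = 0 \<longrightarrow> v = ((v \<bullet> \<theta>) / (\<theta> \<bullet> \<theta>)) *\<^sub>R \<theta>"
    proof (intro allI impI)
      fix v assume "v \<bullet> g = 0"
      then have v: "v $ j * \<theta> $ i = v $ i * \<theta> $ j" by (simp add: inner g)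
      have "(\<theta> \<bullet> \<theta>) *\<^sub>R v = (v \<bullet> \<theta>) *\<^sub>R \<theta>"
      proof (rule eqI)
        have "(\<theta> \<bullet> \<theta>) * v $ i = \<theta> $ i * \<theta> $ i * v $ i + \<theta> $ j * (v $ i * \<theta> $ j)"
          by (simp add: inner algebra_simps)
        also have "\<dots> = (v \<bullet> \<theta>) * \<theta> $ i" unfolding v[symmetric] by (simp add: inner algebra_simps)
        finally show "((\<theta> \<bullet> \<theta>) *\<^sub>R v) $ i = ((v \<bullet> \<theta>) *\<^sub>R \<theta>) $ i" by simp
        have "(\<theta> \<bullet> \<theta>) * v $ j = \<theta> $ i * (v $ j * \<theta> $ i) + \<theta> $ j * \<theta> $ j * v $ j"
          by (simp add: inner algebra_simps)
        also have "\<dots> = (v \<bullet> \<theta>) * \<theta> $ j" unfolding v by (simp add: inner algebra_simps)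
        finally show "((\<theta> \<bullet> \<theta>) *\<^sub>R v) $ j = ((v \<bullet> \<theta>) *\<^sub>R \<theta>) $ j" by simp
      qed
      then have "(1 / (\<theta> \<bullet> \<theta>)) *\<^sub>R (\<theta> \<bullet> \<theta>) *\<^sub>R v = (1 / (\<theta> \<bullet> \<theta>)) *\<^sub>R (v \<bullet> \<theta>) *\<^sub>R \<theta>" by simp
      then show "v = ((v \<bullet> \<theta>) / (\<theta> \<bullet> \<theta>)) *\<^sub>R \<theta>" using N by simp
    qed
  qed
qed

lemma dual_basis_in_plane:
  fixes u v :: "real ^ 'r::finite"
  assumes card: "CARD('r) = 2" and u: "u \<noteq> 0" and uv: "\<And>c. v \<noteq> c *\<^sub>R u"
  obtains f1 f2 where "u \<bullet> f1 = 1" "u \<bullet> f2 = 0" "v \<bullet> f1 = 0" "v \<bullet> f2 = 1"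
    "\<forall>w. w = (w \<bullet> f1) *\<^sub>R u + (w \<bullet> f2) *\<^sub>R v"
proof -
  have v: "v \<noteq> 0" using uv[of 0] by simp
  obtain gu where gu: "u \<bullet> gu = 0" "\<forall>w. w \<bullet> gu = 0 \<longrightarrow> w = ((w \<bullet> u) / (u \<bullet> u)) *\<^sub>R u"
    by (rule orthogonal_in_plane[OF card u])
  obtain gv where gv: "v \<bullet> gv = 0" "\<forall>w. w \<bullet> gv = 0 \<longrightarrow> w = ((w \<bullet> v) / (v \<bullet> v)) *\<^sub>R v"
    by (rule orthogonal_in_plane[OF card v])
  have 1: "v \<bullet> gu \<noteq> 0" using gu(2) uv by metis
  have 2: "u \<bullet> gv \<noteq> 0"
  proof
    assume "u \<bullet> gv = 0"
    then obtain c where c: "u = c *\<^sub>R v" using gv(2) by blast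
    then have "c \<noteq> 0" using u by auto
    then have "v = (1 / c) *\<^sub>R u" using c by simp
    then show False using uv by blast
  qed
  define f1 f2 where "f1 = (1 / (u \<bullet> gv)) *\<^sub>R gv" and "f2 = (1 / (v \<bullet> gu)) *\<^sub>R gu"
  show thesis
  proof (rule that[of f1 f2])
    show f: "u \<bullet> f1 = 1" "u \<bullet> f2 = 0" "v \<bullet> f1 = 0" "v \<bullet> f2 = 1"
      using 1 2 gu(1) gv(1) by (simp_all add: f1_def f2_def)
    show "\<forall>w. w = (w \<bullet> f1) *\<^sub>R u + (w \<bullet> f2) *\<^sub>R v"
    proof
      fix w
      define x where "x = w - ((w \<bullet> f1) *\<^sub>R u + (w \<bullet> f2) *\<^sub>R v)"
      have "x \<bullet> f1 = 0" "x \<bullet> f2 = 0" by (simp_all add: x_def inner_diff_left inner_add_left f)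
      then have "x \<bullet> gu = 0" and xv: "x \<bullet> gv = 0" using 1 2 by (simp_all add: f1_def f2_def)
      then obtain c where c: "x = c *\<^sub>R u" using gu(2) by blast
      then have "c * (u \<bullet> gv) = 0" using xv by simp
      then have "x = 0" using 2 c by simp
      then show "w = (w \<bullet> f1) *\<^sub>R u + (w \<bullet> f2) *\<^sub>R v" by (simp add: x_def)
    qed
  qed
qed

text \<open>
  Bezout coefficients of the primitive vector give \<open>mu\<close>, and rotation gives \<open>lam\<close>.
\<close>
lemma primitive_coordinates:
  fixes v :: "int ^ 'r::finite"
  assumes card: "CARD('r) = 2" and v: "v \<noteq> 0"
  obtains n p lam mu where "n > 0" "v = n *s p" "plane_coordinates p lam mu"
proof -
  obtain i j :: 'r where ij: "UNIV = {i, j}" "i \<noteq> j" using card by (auto simp: card_2_iff)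
  have pair: "pairing u w = u $ i * w $ i + u $ j * w $ j" for u w :: "int ^ 'r"
    by (simp add: pairing_def ij(1) ij(2))
  have eqI: "u = w" if "u $ i = w $ i" "u $ j = w $ j" for u w :: "int ^ 'r"
    unfolding vec_eq_iff
  proof
    fix k :: 'r
    have "k \<in> {i, j}" using ij(1) by blast
    then show "u $ k = w $ k" using that by auto
  qed
  define n where "n = gcd (v $ i) (v $ j)"
  have "v $ i \<noteq> 0 \<or> v $ j \<noteq> 0" using v eqI[of v 0] by auto
  then have n: "n > 0" unfolding n_def by simp
  define p1 p2 where "p1 = v $ i div n" and "p2 = v $ j div n"
  have "coprime p1 p2" unfolding p1_def p2_def n_def
    using \<open>v $ i \<noteq> 0 \<or> v $ j \<noteq> 0\<close> by (intro div_gcd_coprime) auto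
  then obtain x y where xy: "x * p1 + y * p2 = 1" using bezout_int[of p1 p2] by auto
  define p lam mu :: "int ^ 'r" where "p = (\<chi> k. if k = i then p1 else p2)"
    and "lam = (\<chi> k. if k = i then - p2 else p1)" and "mu = (\<chi> k. if k = i then x else y)"
  have c: "p $ i = p1" "p $ j = p2" "lam $ i = - p2" "lam $ j = p1" "mu $ i = x" "mu $ j = y"
    using ij(2) by (auto simp: p_def lam_def mu_def)
  show thesis
  proof (rule that[of n p lam mu])
    show "n > 0" by fact
    show "v = n *s p"
      by (rule eqI) (simp_all add: c p1_def p2_def n_def)
    show "plane_coordinates p lam mu"
    proof
      show "pairing p lam = 0" by (simp add: pair c)
      show "pairing p mu = 1" using xy by (simp add: pair c algebra_simps)
      show "lam \<noteq> 0"
      proof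
        assume "lam = 0"
        then have "p1 = 0" "p2 = 0" using c(3,4) by simp_all
        then show False using xy by simp
      qed
      fix l
      have "l = (x * l $ j - y * l $ i) *s lam + pairing p l *s mu"
      proof (rule eqI)
        have "((x * l $ j - y * l $ i) *s lam + pairing p l *s mu) $ i = (x * p1 + y * p2) * l $ i"
          by (simp add: c pair algebra_simps)
        then show "l $ i = ((x * l $ j - y * l $ i) *s lam + pairing p l *s mu) $ i" using xy by simp
        have "((x * l $ j - y * l $ i) *s lam + pairing p l *s mu) $ j = (x * p1 + y * p2) * l $ j"
          by (simp add: c pair algebra_simps)
        then show "l $ j = ((x * l $ j - y * l $ i) *s lam + pairing p l *s mu) $ j" using xy by simp
      qed
      then show "\<exists>k. l = k *s lam + pairing p l *s mu" by blast
    next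
      fix u :: "int ^ 'r" assume "pairing u lam = 0"
      then have u: "u $ j * p1 = u $ i * p2" by (simp add: pair c)
      show "u = pairing u mu *s p"
      proof (rule eqI)
        have "(pairing u mu *s p) $ i = u $ i * (x * p1) + y * (u $ j * p1)"
          by (simp add: c pair algebra_simps)
        also have "\<dots> = u $ i * (x * p1 + y * p2)" unfolding u by (simp add: algebra_simps)
        finally show "u $ i = (pairing u mu *s p) $ i" using xy by simp
        have "(pairing u mu *s p) $ j = x * (u $ i * p2) + u $ j * (y * p2)"
          by (simp add: c pair algebra_simps)
        also have "\<dots> = u $ j * (x * p1 + y * p2)" unfolding u[symmetric] by (simp add: algebra_simps)
        finally show "u $ j = (pairing u mu *s p) $ j" using xy by simp
      qed
    qed
  qed
qed

definition on_weight_ray :: "('n \<Rightarrow> int ^ 'r::finite) \<Rightarrow> real ^ 'r \<Rightarrow> bool" where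
  "on_weight_ray q \<theta> \<longleftrightarrow> (\<exists>i c. c \<ge> 0 \<and> \<theta> = c *\<^sub>R rvec (q i))"

text \<open>
  Membership in the open sector spanned by two weights.
\<close>
definition between :: "('n \<Rightarrow> int ^ 'r::finite) \<Rightarrow> 'n \<Rightarrow> 'n \<Rightarrow> real ^ 'r \<Rightarrow> bool" where
  "between q i j v \<longleftrightarrow> (\<exists>s>0. \<exists>t>0. v = s *\<^sub>R rvec (q i) + t *\<^sub>R rvec (q j))"

text \<open>
  Caratheodory in the plane. Split a positive combination representing \<open>\<theta>\<close> by the sign of \<open>g\<close>, the
  coordinate orthogonal to \<open>\<theta>\<close>. If no pair from opposite sides had \<open>\<theta>\<close> in its sector, all the
  determinants \<open>g i * h j - g j * h i\<close> would be non-positive, and so would be their average with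
  the coefficients of the combination. That average factors, and its sign contradicts that the
  coordinates \<open>h\<close> along \<open>\<theta>\<close> add up to \<open>1\<close>: weights with \<open>g = 0\<close> cannot help, because
  \<open>\<theta>\<close> is not on a weight ray.
\<close>
lemma generic_between:
  fixes q :: "'n::finite \<Rightarrow> int ^ 'r::finite"
  assumes card: "CARD('r) = 2" and \<theta>: "\<theta> \<in> weight_cone q I" and gen: "\<not> on_weight_ray q \<theta>"
    and nz: "\<theta> \<noteq> 0"
  obtains i j where "i \<in> I" "j \<in> I" "between q i j \<theta>" "\<forall>c. rvec (q j) \<noteq> c *\<^sub>R rvec (q i)"
proof -
  obtain gg where gg: "\<theta> \<bullet> gg = 0" "\<forall>v. v \<bullet> gg = 0 \<longrightarrow> v = ((v \<bullet> \<theta>) / (\<theta> \<bullet> \<theta>)) *\<^sub>R \<theta>"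
    by (rule orthogonal_in_plane[OF card nz])
  obtain c where c: "\<And>i. c i \<ge> 0" "\<theta> = (\<Sum>i\<in>I. c i *\<^sub>R rvec (q i))"
    using \<theta> weight_cone_iff by blast
  define g h where "g i = rvec (q i) \<bullet> gg" and "h i = (rvec (q i) \<bullet> \<theta>) / (\<theta> \<bullet> \<theta>)" for i
  have N: "\<theta> \<bullet> \<theta> > 0" using nz by simp
  define P M Z where "P = {i\<in>I. g i > 0}" and "M = {i\<in>I. g i < 0}" and "Z = {i\<in>I. g i = 0}"
  have split: "(\<Sum>i\<in>I. f i) = (\<Sum>i\<in>P. f i) + (\<Sum>i\<in>M. f i) + (\<Sum>i\<in>Z. f i)" for f :: "'n \<Rightarrow> real"
  proof -
    have "I = P \<union> M \<union> Z" by (auto simp: P_def M_def Z_def)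
    moreover have "(\<Sum>i\<in>P \<union> M \<union> Z. f i) = (\<Sum>i\<in>P \<union> M. f i) + (\<Sum>i\<in>Z. f i)"
      by (rule sum.union_disjoint) (auto simp: P_def M_def Z_def)
    moreover have "(\<Sum>i\<in>P \<union> M. f i) = (\<Sum>i\<in>P. f i) + (\<Sum>i\<in>M. f i)"
      by (rule sum.union_disjoint) (auto simp: P_def M_def Z_def)
    ultimately show ?thesis by simp
  qed
  have sumg: "(\<Sum>i\<in>I. c i * g i) = 0"
    using arg_cong[OF c(2), of "\<lambda>v. v \<bullet> gg"] by (simp add: gg(1) g_def inner_sum_left)
  have sumh: "(\<Sum>i\<in>I. c i * h i) = 1"
  proof -
    have "\<theta> \<bullet> \<theta> = (\<Sum>i\<in>I. c i * (rvec (q i) \<bullet> \<theta>))"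
      using arg_cong[OF c(2), of "\<lambda>v. v \<bullet> \<theta>"] by (simp add: inner_sum_left)
    then have "(\<Sum>i\<in>I. c i * (rvec (q i) \<bullet> \<theta>)) / (\<theta> \<bullet> \<theta>) = 1" using N by simp
    then show ?thesis by (simp add: h_def sum_divide_distrib)
  qed
  have hZ: "c i * h i \<le> 0" if "i \<in> Z" for i
  proof (rule ccontr)
    assume "\<not> ?thesis"
    then have "h i > 0" using c(1)[of i] by (metis less_eq_real_def mult_nonneg_nonpos not_le)
    moreover have "rvec (q i) = h i *\<^sub>R \<theta>" using gg(2) that by (simp add: Z_def g_def h_def)
    ultimately have "\<theta> = (1 / h i) *\<^sub>R rvec (q i)" "1 / h i \<ge> 0" by simp_all
    then show False using gen unfolding on_weight_ray_def by blast
  qed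
  have "\<exists>i\<in>P. \<exists>j\<in>M. g i * h j - g j * h i > 0"
  proof (rule ccontr)
    assume "\<not> ?thesis"
    then have all: "g i * h j - g j * h i \<le> 0" if "i \<in> P" "j \<in> M" for i j using that by force
    have "(\<Sum>i\<in>P. \<Sum>j\<in>M. c i * c j * (g i * h j - g j * h i)) \<le> 0"
      using all c(1) by (intro sum_nonpos mult_nonneg_nonpos) auto
    moreover have "(\<Sum>i\<in>P. \<Sum>j\<in>M. c i * c j * (g i * h j - g j * h i))
      = (\<Sum>i\<in>P. c i * g i) * (\<Sum>j\<in>M. c j * h j) - (\<Sum>j\<in>M. c j * g j) * (\<Sum>i\<in>P. c i * h i)"
    proof -
      have "(\<Sum>i\<in>P. c i * g i) * (\<Sum>j\<in>M. c j * h j) = (\<Sum>i\<in>P. \<Sum>j\<in>M. (c i * g i) * (c j * h j))"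
        by (rule sum_product)
      moreover have "(\<Sum>i\<in>P. c i * h i) * (\<Sum>j\<in>M. c j * g j) = (\<Sum>i\<in>P. \<Sum>j\<in>M. (c i * h i) * (c j * g j))"
        by (rule sum_product)
      ultimately show ?thesis by (simp add: sum_subtractf[symmetric] algebra_simps)
    qed
    moreover have GM: "(\<Sum>j\<in>M. c j * g j) = - (\<Sum>i\<in>P. c i * g i)"
    proof -
      have "(\<Sum>i\<in>Z. c i * g i) = 0" by (intro sum.neutral) (simp add: Z_def)
      then show ?thesis using split[of "\<lambda>i. c i * g i"] sumg by simp
    qed
    ultimately have le: "(\<Sum>i\<in>P. c i * g i) * ((\<Sum>j\<in>M. c j * h j) + (\<Sum>i\<in>P. c i * h i)) \<le> 0"
      by (simp add: algebra_simps)
    have "(\<Sum>i\<in>Z. c i * h i) \<le> 0" using hZ by (intro sum_nonpos) auto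
    then have H: "(\<Sum>j\<in>M. c j * h j) + (\<Sum>i\<in>P. c i * h i) \<ge> 1"
      using split[of "\<lambda>i. c i * h i"] sumh by simp
    have G0: "(\<Sum>i\<in>P. c i * g i) \<ge> 0" using c(1) by (intro sum_nonneg) (simp add: P_def)
    have "(\<Sum>i\<in>P. c i * g i) = 0"
    proof (rule ccontr)
      assume "(\<Sum>i\<in>P. c i * g i) \<noteq> 0"
      then have "(\<Sum>i\<in>P. c i * g i) > 0" using G0 by simp
      then have "(\<Sum>i\<in>P. c i * g i) * ((\<Sum>j\<in>M. c j * h j) + (\<Sum>i\<in>P. c i * h i)) > 0"
        using H by (intro mult_pos_pos) auto
      then show False using le by simp
    qed
    then have P0: "\<forall>i\<in>P. c i * g i = 0"
      using c(1) by (subst (asm) sum_nonneg_eq_0_iff) (auto simp: P_def)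
    have "(\<Sum>i\<in>M. c i * - g i) = 0" using GM \<open>(\<Sum>i\<in>P. c i * g i) = 0\<close> by (simp add: sum_negf)
    then have M0: "\<forall>i\<in>M. c i * - g i = 0"
      using c(1) by (subst (asm) sum_nonneg_eq_0_iff) (auto simp: M_def mult_nonneg_nonpos)
    have "c i = 0" if "i \<in> P \<union> M" for i using that P0 M0 by (auto simp: P_def M_def)
    then have "(\<Sum>j\<in>M. c j * h j) + (\<Sum>i\<in>P. c i * h i) = 0" by simp
    then show False using H by simp
  qed
  then obtain i j where ij: "i \<in> P" "j \<in> M" and e: "g i * h j - g j * h i > 0" by blast
  define e where "e = g i * h j - g j * h i"
  let ?w = "(- g j) *\<^sub>R rvec (q i) + g i *\<^sub>R rvec (q j)"
  have "?w \<bullet> gg = 0" by (simp add: inner_add_left inner_diff_left g_def)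
  then have "?w = ((?w \<bullet> \<theta>) / (\<theta> \<bullet> \<theta>)) *\<^sub>R \<theta>" using gg(2) by blast
  also have "(?w \<bullet> \<theta>) / (\<theta> \<bullet> \<theta>) = e"
    by (simp add: inner_add_left inner_diff_left e_def h_def add_divide_distrib diff_divide_distrib)
  finally have w: "?w = e *\<^sub>R \<theta>" .
  have "\<theta> = (1 / e) *\<^sub>R ?w" unfolding w using e by (simp add: e_def)
  then have "\<theta> = (- g j / e) *\<^sub>R rvec (q i) + (g i / e) *\<^sub>R rvec (q j)"
    by (simp add: scaleR_add_right scaleR_diff_right)
  moreover have "e > 0" using e by (simp add: e_def)
  then have "- g j / e > 0" "g i / e > 0"
    using ij by (auto simp: P_def M_def divide_less_0_iff zero_less_divide_iff)
  ultimately have "between q i j \<theta>" unfolding between_def by blast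
  moreover have "rvec (q j) \<noteq> c *\<^sub>R rvec (q i)" for c
  proof
    assume eq: "rvec (q j) = c *\<^sub>R rvec (q i)"
    then have gj: "g j = c * g i" and hj: "h j = c * h i" by (simp_all add: g_def h_def)
    then have "g i * h j - g j * h i = 0" by simp
    then show False using e by simp
  qed
  ultimately show thesis using that ij by (auto simp: P_def M_def)
qed

lemma secondary_cone_contains: "\<theta> \<in> secondary_cone q H \<theta>"
  by (auto simp: secondary_cone_def)

lemma secondary_cone_subset: "I \<subseteq> higgs_weights q H \<Longrightarrow> \<theta> \<in> weight_cone q I \<Longrightarrow> secondary_cone q H \<theta> \<subseteq> weight_cone q I"
  by (auto simp: secondary_cone_def)

lemma secondary_cone_zero: "secondary_cone q H 0 = {0}"
proof
  have "0 \<in> weight_cone q {}" by (simp add: weight_cone_def)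
  then have "secondary_cone q H 0 \<subseteq> weight_cone q {}" by (intro secondary_cone_subset) auto
  then show "secondary_cone q H 0 \<subseteq> {0}" by (simp add: weight_cone_def)
qed (simp add: secondary_cone_contains)

lemma secondary_cone_scale:
  assumes "v \<in> secondary_cone q H \<theta>" "t \<ge> 0"
  shows "t *\<^sub>R v \<in> secondary_cone q H \<theta>"
  using assms by (auto simp: secondary_cone_def intro!: weight_cone_scale)

lemma secondary_cone_on_ray:
  fixes q :: "'n::finite \<Rightarrow> int ^ 'r::finite"
  assumes "i \<in> higgs_weights q H" "c > 0" "\<theta> = c *\<^sub>R rvec (q i)"
  shows "secondary_cone q H \<theta> = ray (q i)"
proof
  have "weight_cone q {i} = ray (q i)"
  proof (intro equalityI subsetI)
    fix v assume "v \<in> weight_cone q {i}"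
    then show "v \<in> ray (q i)" by (auto simp: weight_cone_iff ray_def)
  next
    fix v assume "v \<in> ray (q i)"
    then obtain t where "v = t *\<^sub>R rvec (q i)" "t \<ge> 0" by (auto simp: ray_def)
    then show "v \<in> weight_cone q {i}" unfolding weight_cone_iff by (intro exI[of _ "\<lambda>_. t"]) simp
  qed
  moreover have "\<theta> \<in> ray (q i)" using assms by (auto simp: ray_def intro!: exI[of _ c])
  ultimately show "secondary_cone q H \<theta> \<subseteq> ray (q i)"
    using secondary_cone_subset[of "{i}" q H \<theta>] assms by simp
  show "ray (q i) \<subseteq> secondary_cone q H \<theta>"
  proof
    fix v assume "v \<in> ray (q i)"
    then obtain t where t: "v = t *\<^sub>R rvec (q i)" "t \<ge> 0" by (auto simp: ray_def)
    then have "v = (t / c) *\<^sub>R \<theta>" "t / c \<ge> 0" using assms by simp_all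
    then show "v \<in> secondary_cone q H \<theta>" using secondary_cone_scale[OF secondary_cone_contains] by metis
  qed
qed

lemma higgs_weights_UNIV [simp]: "higgs_weights q UNIV = UNIV"
  by (simp add: higgs_weights_def)

text \<open>
  Off the weight rays \<open>\<theta>\<close> is an interior point of each of the finitely many cones that contain it.
\<close>
lemma generic_secondary_cone_dim:
  fixes q :: "'n::finite \<Rightarrow> int ^ 'r::finite"
  assumes card: "CARD('r) = 2" and gen: "\<not> on_weight_ray q \<theta>" and nz: "\<theta> \<noteq> 0"
  shows "dim (secondary_cone q UNIV \<theta>) = 2"
proof -
  define F where "F = {I. \<theta> \<in> weight_cone q I}"
  have "\<exists>U. open U \<and> \<theta> \<in> U \<and> U \<subseteq> weight_cone q I" if "I \<in> F" for I
  proof -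
    have \<theta>: "\<theta> \<in> weight_cone q I" using that by (simp add: F_def)
    obtain i j where ij: "i \<in> I" "j \<in> I" "between q i j \<theta>" "\<forall>c. rvec (q j) \<noteq> c *\<^sub>R rvec (q i)"
      by (rule generic_between[OF card \<theta> gen nz])
    obtain s t where st: "s > 0" "t > 0" "\<theta> = s *\<^sub>R rvec (q i) + t *\<^sub>R rvec (q j)"
      using ij(3) by (auto simp: between_def)
    have qi: "rvec (q i) \<noteq> 0"
    proof
      assume 0: "rvec (q i) = 0"
      then have "on_weight_ray q \<theta>" using st by (auto simp: on_weight_ray_def intro!: exI[of _ j] exI[of _ t])
      then show False using gen by simp
    qed
    obtain f1 f2 where f: "rvec (q i) \<bullet> f1 = 1" "rvec (q i) \<bullet> f2 = 0" "rvec (q j) \<bullet> f1 = 0" "rvec (q j) \<bullet> f2 = 1"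
      "\<forall>w. w = (w \<bullet> f1) *\<^sub>R rvec (q i) + (w \<bullet> f2) *\<^sub>R rvec (q j)"
      by (rule dual_basis_in_plane[OF card qi ij(4)[rule_format]])
    let ?U = "{w. f1 \<bullet> w > 0} \<inter> {w. f2 \<bullet> w > 0}"
    have "open ?U" by (intro open_Int open_halfspace_gt)
    moreover have "\<theta> \<in> ?U" using st f by (simp add: inner_add_right inner_commute)
    moreover have "?U \<subseteq> weight_cone q I"
    proof
      fix w assume "w \<in> ?U"
      then have "w \<bullet> f1 \<ge> 0" "w \<bullet> f2 \<ge> 0" by (simp_all add: inner_commute)
      then have "(w \<bullet> f1) *\<^sub>R rvec (q i) + (w \<bullet> f2) *\<^sub>R rvec (q j) \<in> weight_cone q I"
        by (intro pair_in_weight_cone ij)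
      then show "w \<in> weight_cone q I" using f(5) by metis
    qed
    ultimately show ?thesis by blast
  qed
  then obtain U where U: "\<And>I. I \<in> F \<Longrightarrow> open (U I) \<and> \<theta> \<in> U I \<and> U I \<subseteq> weight_cone q I" by metis
  define V where "V = (\<Inter>I\<in>F. U I)"
  have "open V" unfolding V_def using U by (intro open_INT) auto
  have "\<theta> \<in> V" using U by (auto simp: V_def)
  have "dim V = dim (UNIV :: (real ^ 'r) set)"
  proof (rule dim_openin)
    show "openin (top_of_set UNIV) V" using \<open>open V\<close> by simp
    show "V \<noteq> {}" using \<open>\<theta> \<in> V\<close> by blast
  qed simp
  moreover have "V \<subseteq> secondary_cone q UNIV \<theta>"
  proof
    fix v assume "v \<in> V"
    then have "v \<in> weight_cone q I" if "\<theta> \<in> weight_cone q I" for I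
      using U[of I] that by (auto simp: V_def F_def)
    then show "v \<in> secondary_cone q UNIV \<theta>" by (auto simp: secondary_cone_def)
  qed
  ultimately have "dim (secondary_cone q UNIV \<theta>) \<ge> 2" using dim_subset[of V "secondary_cone q UNIV \<theta>"] card by simp
  moreover have "dim (secondary_cone q UNIV \<theta>) \<le> 2"
    using dim_subset_UNIV[of "secondary_cone q UNIV \<theta>"] card by simp
  ultimately show ?thesis by simp
qed

theorem walls_are_rays:
  fixes q :: "'n::finite \<Rightarrow> int ^ 'r::finite"
  assumes card: "CARD('r) = 2" and W: "W \<in> walls q UNIV"
  obtains i where "W = ray (q i)"
proof -
  obtain \<theta> where \<theta>: "W = secondary_cone q UNIV \<theta>" using W by (auto simp: walls_def secondary_fan_def)
  have dim: "dim W = 1" using W card by (simp add: walls_def)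
  have nz: "\<theta> \<noteq> 0"
  proof
    assume "\<theta> = 0"
    then show False using dim by (simp add: \<theta> secondary_cone_zero)
  qed
  have "on_weight_ray q \<theta>"
    using generic_secondary_cone_dim[OF card _ nz] dim \<theta> by fastforce
  then obtain i c where ic: "c \<ge> 0" "\<theta> = c *\<^sub>R rvec (q i)" by (auto simp: on_weight_ray_def)
  then have "c > 0" using nz by (cases "c = 0") auto
  then show thesis using that secondary_cone_on_ray[of i q UNIV c \<theta>] ic \<theta> by simp
qed

lemma ray_smult:
  assumes "n > 0"
  shows "ray (n *s p) = ray p"
proof (intro equalityI subsetI)
  fix v assume "v \<in> ray (n *s p)"
  then obtain c where "v = c *\<^sub>R rvec (n *s p)" "c \<ge> 0" by (auto simp: ray_def)
  then show "v \<in> ray p" using assms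
    by (auto simp: ray_def rvec_smult intro!: exI[of _ "c * of_int n"])
next
  fix v assume "v \<in> ray p"
  then obtain c where "v = c *\<^sub>R rvec p" "c \<ge> 0" by (auto simp: ray_def)
  then show "v \<in> ray (n *s p)" using assms
    by (auto simp: ray_def rvec_smult intro!: exI[of _ "c / of_int n"])
qed

lemma between_commute: "between q i j v \<longleftrightarrow> between q j i v"
  unfolding between_def by (metis add.commute)

lemma between_trans:
  assumes k: "between q i j (rvec (q k))" and v: "between q k j v"
  shows "between q i j v"
proof -
  obtain s t where st: "s > 0" "t > 0" "rvec (q k) = s *\<^sub>R rvec (q i) + t *\<^sub>R rvec (q j)"
    using k by (auto simp: between_def)
  obtain x y where xy: "x > 0" "y > 0" "v = x *\<^sub>R rvec (q k) + y *\<^sub>R rvec (q j)"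
    using v by (auto simp: between_def)
  have "v = (x * s) *\<^sub>R rvec (q i) + (x * t + y) *\<^sub>R rvec (q j)"
    by (simp add: xy(3) st(3) scaleR_add_right scaleR_add_left)
  moreover have "x * s > 0" "x * t + y > 0" using xy st by (simp_all add: add_pos_pos)
  ultimately show ?thesis unfolding between_def by blast
qed

lemma not_between_self:
  assumes "\<forall>c. rvec (q j) \<noteq> c *\<^sub>R rvec (q k)"
  shows "\<not> between q k j (rvec (q k))"
proof
  assume "between q k j (rvec (q k))"
  then obtain x y where xy: "y > 0" "rvec (q k) = x *\<^sub>R rvec (q k) + y *\<^sub>R rvec (q j)"
    by (auto simp: between_def)
  then have "y *\<^sub>R rvec (q j) = (1 - x) *\<^sub>R rvec (q k)" by (simp add: scaleR_diff_left algebra_simps)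
  then have "(1 / y) *\<^sub>R (y *\<^sub>R rvec (q j)) = (1 / y) *\<^sub>R ((1 - x) *\<^sub>R rvec (q k))" by simp
  then have "rvec (q j) = ((1 - x) / y) *\<^sub>R rvec (q k)" using xy(1) by simp
  then show False using assms by blast
qed

lemma between_independent:
  assumes ind: "\<forall>c. rvec (q j) \<noteq> c *\<^sub>R rvec (q i)" and nz: "q i \<noteq> 0"
    and k: "between q i j (rvec (q k))"
  shows "\<forall>c. rvec (q j) \<noteq> c *\<^sub>R rvec (q k)"
proof (intro allI notI)
  fix c assume c: "rvec (q j) = c *\<^sub>R rvec (q k)"
  obtain s t where st: "s > 0" "t > 0" "rvec (q k) = s *\<^sub>R rvec (q i) + t *\<^sub>R rvec (q j)"
    using k by (auto simp: between_def)
  have eq: "(1 - c * t) *\<^sub>R rvec (q j) = (c * s) *\<^sub>R rvec (q i)"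
    using c unfolding st(3) by (simp add: scaleR_diff_left scaleR_add_right algebra_simps)
  show False
  proof (cases "c * t = 1")
    case True
    then have "(c * s) *\<^sub>R rvec (q i) = 0" "c \<noteq> 0" using eq by auto
    then show False using nz st(1) by simp
  next
    case False
    have "(1 / (1 - c * t)) *\<^sub>R ((1 - c * t) *\<^sub>R rvec (q j)) = (1 / (1 - c * t)) *\<^sub>R ((c * s) *\<^sub>R rvec (q i))"
      unfolding eq ..
    then have "rvec (q j) = (c * s / (1 - c * t)) *\<^sub>R rvec (q i)" using False by simp
    then show False using ind by blast
  qed
qed

text \<open>
  A weight inside a sector cuts it into two, and \<open>\<theta>\<close> lies in one of the halves.
\<close>
lemma between_split:
  assumes \<theta>: "between q i j \<theta>" and k: "between q i j (rvec (q k))" and gen: "\<not> on_weight_ray q \<theta>"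
  shows "between q k j \<theta> \<or> between q k i \<theta>"
proof -
  obtain s t where st: "s > 0" "t > 0" and qk: "rvec (q k) = s *\<^sub>R rvec (q i) + t *\<^sub>R rvec (q j)"
    using k by (auto simp: between_def)
  obtain \<alpha> \<beta> where ab: "\<alpha> > 0" "\<beta> > 0" and th: "\<theta> = \<alpha> *\<^sub>R rvec (q i) + \<beta> *\<^sub>R rvec (q j)"
    using \<theta> by (auto simp: between_def)
  consider "\<alpha> / s = \<beta> / t" | "\<alpha> / s < \<beta> / t" | "\<alpha> / s > \<beta> / t" by linarith
  then show ?thesis
  proof cases
    case 1
    then have "\<beta> = \<alpha> / s * t" using st by (simp add: field_simps)
    then have "\<theta> = (\<alpha> / s) *\<^sub>R rvec (q k)" using st by (simp add: th qk scaleR_add_right)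
    then have "on_weight_ray q \<theta>" unfolding on_weight_ray_def
      using ab st by (intro exI[of _ k] exI[of _ "\<alpha> / s"]) simp
    then show ?thesis using gen by blast
  next
    case 2
    have "\<theta> = (\<alpha> / s) *\<^sub>R rvec (q k) + (\<beta> - \<alpha> / s * t) *\<^sub>R rvec (q j)"
      using st by (simp add: th qk scaleR_add_right scaleR_diff_left)
    moreover have "\<alpha> / s > 0" "\<beta> - \<alpha> / s * t > 0" using 2 ab st by (simp_all add: field_simps)
    ultimately show ?thesis unfolding between_def by blast
  next
    case 3
    have "\<theta> = (\<beta> / t) *\<^sub>R rvec (q k) + (\<alpha> - \<beta> / t * s) *\<^sub>R rvec (q i)"
      using st by (simp add: th qk scaleR_add_right scaleR_diff_left)
    moreover have "\<beta> / t > 0" "\<alpha> - \<beta> / t * s > 0" using 3 ab st by (simp_all add: field_simps)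
    ultimately show ?thesis unfolding between_def by blast
  qed
qed

text \<open>
  Among the sectors around \<open>\<theta>\<close> one containing the fewest weights contains none, by bisection.
\<close>
lemma empty_sector:
  fixes q :: "'n::finite \<Rightarrow> int ^ 'r::finite"
  assumes card: "CARD('r) = 2" and \<theta>: "\<theta> \<in> weight_cone q UNIV" and gen: "\<not> on_weight_ray q \<theta>"
    and nz: "\<theta> \<noteq> 0" and weights: "\<And>i. q i \<noteq> 0"
  obtains i j where "between q i j \<theta>" "\<forall>c. rvec (q j) \<noteq> c *\<^sub>R rvec (q i)" "\<forall>k. \<not> between q i j (rvec (q k))"
proof -
  define good where "good = (\<lambda>(i, j). between q i j \<theta> \<and> (\<forall>c. rvec (q j) \<noteq> c *\<^sub>R rvec (q i)))"
  define cnt where "cnt = (\<lambda>(i, j). card {k. between q i j (rvec (q k))})"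
  obtain i0 j0 where "between q i0 j0 \<theta>" "\<forall>c. rvec (q j0) \<noteq> c *\<^sub>R rvec (q i0)"
    by (rule generic_between[OF card \<theta> gen nz])
  then have "good (i0, j0)" by (simp add: good_def)
  from ex_has_least_nat[of good "(i0, j0)" cnt, OF this]
  obtain x where x: "good x" and least: "\<forall>y. good y \<longrightarrow> cnt x \<le> cnt y" by blast
  obtain i j where xij: "x = (i, j)" by (cases x)
  have ij: "between q i j \<theta>" and ind: "\<forall>c. rvec (q j) \<noteq> c *\<^sub>R rvec (q i)" using x by (auto simp: good_def xij)
  have ind': "\<forall>c. rvec (q i) \<noteq> c *\<^sub>R rvec (q j)"
  proof (intro allI notI)
    fix c assume c: "rvec (q i) = c *\<^sub>R rvec (q j)"
    then have "c \<noteq> 0" using weights by auto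
    then have "rvec (q j) = (1 / c) *\<^sub>R rvec (q i)" using c by simp
    then show False using ind by blast
  qed
  have "\<not> between q i j (rvec (q k))" for k
  proof
    assume k: "between q i j (rvec (q k))"
    have smaller: False if ind1: "\<forall>c. rvec (q j') \<noteq> c *\<^sub>R rvec (q i')"
      and same: "\<And>v. between q i' j' v \<longleftrightarrow> between q i j v" and b: "between q k j' \<theta>" for i' j'
    proof -
      have k': "between q i' j' (rvec (q k))" using k same by blast
      have ind2: "\<forall>c. rvec (q j') \<noteq> c *\<^sub>R rvec (q k)" by (rule between_independent[OF ind1 weights k'])
      then have "good (k, j')" using b by (simp add: good_def)
      moreover have "\<not> between q k j' (rvec (q k))" by (rule not_between_self) (rule ind2)
      then have "{m. between q k j' (rvec (q m))} \<subset> {m. between q i j (rvec (q m))}"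
        using between_trans[OF k'] same k by blast
      then have "cnt (k, j') < cnt x" by (simp add: cnt_def xij psubset_card_mono)
      ultimately show False using least by fastforce
    qed
    from between_split[OF ij k gen] show False
    proof
      assume "between q k j \<theta>"
      then show False by (rule smaller[OF ind refl])
    next
      assume "between q k i \<theta>"
      then show False by (rule smaller[OF ind' between_commute])
    qed
  qed
  then show thesis using that ij ind by blast
qed

text \<open>
  The chamber lies in an empty sector. The generator \<open>p\<close> belongs to the chamber but, being a weight
  up to scaling, not to the open sector; so it spans one of its two edges. The exponents \<open>\<epsilon>\<close> and \<open>m\<close> are
  integral normals of the two edges.
\<close>
theorem (in toric_wall) chambers_isolate_fixed_points:
  assumes card: "CARD('r) = 2" and i0: "q i0 = n *s p" "n > 0"
    and \<tau>: "\<tau> \<in> secondary_fan q UNIV" "ray p \<subseteq> \<tau>" "\<tau> \<noteq> ray p"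
  shows "isolates_fixed_point \<tau>"
proof -
  obtain \<theta> where \<theta>: "\<tau> = secondary_cone q UNIV \<theta>" "\<theta> \<in> weight_cone q UNIV"
    using \<tau>(1) by (auto simp: secondary_fan_def)
  have p\<tau>: "rvec p \<in> \<tau>" using \<tau>(2) generator_in_ray by blast
  have nz: "\<theta> \<noteq> 0"
  proof
    assume "\<theta> = 0"
    then have "\<tau> = {0}" using \<theta> secondary_cone_zero by blast
    then show False using p\<tau> p_nonzero by simp
  qed
  have gen: "\<not> on_weight_ray q \<theta>"
  proof
    assume "on_weight_ray q \<theta>"
    then obtain i c where ic: "c \<ge> 0" "\<theta> = c *\<^sub>R rvec (q i)" by (auto simp: on_weight_ray_def)
    then have "c > 0" using nz by (cases "c = 0") auto
    then have ti: "\<tau> = ray (q i)" using secondary_cone_on_ray[of i q UNIV c \<theta>] ic \<theta> by simp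
    then obtain d where d: "rvec p = d *\<^sub>R rvec (q i)" "d \<ge> 0" using p\<tau> by (auto simp: ray_def)
    then have d0: "d > 0" using p_nonzero by (cases "d = 0") auto
    have "ray (q i) \<subseteq> ray p"
    proof
      fix v assume "v \<in> ray (q i)"
      then obtain c where "v = c *\<^sub>R rvec (q i)" "c \<ge> 0" by (auto simp: ray_def)
      then have "v = (c / d) *\<^sub>R rvec p" "c / d \<ge> 0" using d d0 by simp_all
      then show "v \<in> ray p" by (auto simp: ray_def)
    qed
    then show False using \<tau>(2,3) ti by simp
  qed
  obtain i1 j1 where b1: "between q i1 j1 \<theta>" "\<forall>c. rvec (q j1) \<noteq> c *\<^sub>R rvec (q i1)" "\<forall>k. \<not> between q i1 j1 (rvec (q k))"
    by (rule empty_sector[OF card \<theta>(2) gen nz weight_nonzero])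
  have "\<tau> \<subseteq> weight_cone q {i1, j1}"
  proof -
    have "\<theta> \<in> weight_cone q {i1, j1}"
      using b1(1) by (auto simp: between_def intro!: pair_in_weight_cone)
    then show ?thesis unfolding \<theta>(1) by (intro secondary_cone_subset) auto
  qed
  then obtain s1 t1 where st1: "s1 \<ge> 0" "t1 \<ge> 0" "rvec p = s1 *\<^sub>R rvec (q i1) + t1 *\<^sub>R rvec (q j1)"
    using weight_cone_pair p\<tau> by blast
  \<comment> \<open>otherwise the weight \<open>q i0\<close> on the ray would lie in the open sector\<close>
  have "s1 = 0 \<or> t1 = 0"
  proof (rule ccontr)
    assume "\<not> ?thesis"
    then have "s1 > 0" "t1 > 0" using st1 by auto
    then have "of_int n * s1 > 0" "of_int n * t1 > 0" using i0(2) by auto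
    moreover have "rvec (q i0) = (of_int n * s1) *\<^sub>R rvec (q i1) + (of_int n * t1) *\<^sub>R rvec (q j1)"
      unfolding i0 rvec_smult st1(3) by (simp add: scaleR_add_right)
    ultimately have "between q i1 j1 (rvec (q i0))" unfolding between_def by blast
    then show False using b1(3) by blast
  qed
  then obtain i j s where ij: "between q i j \<theta>" "\<forall>k. \<not> between q i j (rvec (q k))"
    "\<tau> \<subseteq> weight_cone q {i, j}" "s > 0" "rvec p = s *\<^sub>R rvec (q i)" "\<forall>c. rvec (q j) \<noteq> c *\<^sub>R rvec (q i)"
  proof
    assume t: "t1 = 0"
    then have "s1 > 0" "rvec p = s1 *\<^sub>R rvec (q i1)" using st1 p_nonzero by (cases "s1 = 0"; auto)+
    then show thesis using that b1 \<open>\<tau> \<subseteq> weight_cone q {i1, j1}\<close> by blast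
  next
    assume t: "s1 = 0"
    then have "t1 > 0" "rvec p = t1 *\<^sub>R rvec (q j1)" using st1 p_nonzero by (cases "t1 = 0"; auto)+
    moreover have "\<forall>c. rvec (q i1) \<noteq> c *\<^sub>R rvec (q j1)"
    proof (intro allI notI)
      fix c assume c: "rvec (q i1) = c *\<^sub>R rvec (q j1)"
      then have "c \<noteq> 0" using weight_nonzero by auto
      then have "rvec (q j1) = (1 / c) *\<^sub>R rvec (q i1)" using c by simp
      then show False using b1(2) by blast
    qed
    moreover have "between q j1 i1 \<theta>" "\<forall>k. \<not> between q j1 i1 (rvec (q k))" 
      using b1(1,3) by (simp_all add: between_commute[of q j1 i1])
    moreover have "\<tau> \<subseteq> weight_cone q {j1, i1}" using \<open>\<tau> \<subseteq> weight_cone q {i1, j1}\<close> by (simp add: insert_commute)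
    ultimately show thesis using that by blast
  qed
  define x y where "x = pairing (q j) lam" and "y = pairing (q j) mu"
  define \<sigma> where "\<sigma> = sgn x"
  have qip: "rvec (q i) = (1 / s) *\<^sub>R rvec p" using ij(4,5) by simp
  have x0: "x \<noteq> 0"
  proof
    assume "x = 0"
    then have "q j = y *s p" using dual_coordinates by (simp add: x_def y_def)
    then have "rvec (q j) = of_int y *\<^sub>R rvec p" using rvec_smult by metis
    then have "rvec (q j) = (of_int y * s) *\<^sub>R rvec (q i)" using ij(5) by simp
    then show False using ij(6) by blast
  qed
  have \<sigma>: "\<sigma> = 1 \<or> \<sigma> = -1" "\<sigma> * x > 0" using x0 by (auto simp: \<sigma>_def sgn_if)
  define \<epsilon> where "\<epsilon> = \<sigma> *s lam"
  \<comment> \<open>the normal of \<open>q j\<close>, with the sign that makes it positive on \<open>p\<close>\<close>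
  define m where "m = \<sigma> *s (x *s mu + (- y) *s lam)"
  have pm: "pairing p m = \<sigma> * x"
    by (simp add: m_def pairing_smult_right pairing_add_right p_lam p_mu)
  have qjm: "pairing (q j) m = 0"
    by (simp add: m_def pairing_smult_right pairing_add_right x_def[symmetric] y_def[symmetric])
  have qje: "pairing (q j) \<epsilon> = \<sigma> * x" by (simp add: \<epsilon>_def pairing_smult_right x_def)
  have pe: "pairing p \<epsilon> = 0" by (simp add: \<epsilon>_def pairing_smult_right p_lam)
  have qie: "rvec (q i) \<bullet> rvec \<epsilon> = 0" by (simp add: qip rvec_inner pe)
  have qim: "rvec (q i) \<bullet> rvec m = of_int (\<sigma> * x) / s" by (simp only: qip inner_scaleR_left rvec_inner pm; simp)
  have qjm': "rvec (q j) \<bullet> rvec m = 0" "rvec (q j) \<bullet> rvec \<epsilon> = of_int (\<sigma> * x)"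
    by (simp_all only: rvec_inner qjm qje of_int_0)
  have sx: "(of_int (\<sigma> * x) :: real) > 0" using \<sigma>(2) by (simp only: of_int_0_less_iff)
  have dual: "rvec \<epsilon> \<bullet> v \<ge> 0 \<and> rvec m \<bullet> v \<ge> 0" if v: "v \<in> \<tau>" for v
  proof -
    have "v \<in> weight_cone q {i, j}" using v ij(3) by blast
    then obtain a b where ab: "a \<ge> 0" "b \<ge> 0" "v = a *\<^sub>R rvec (q i) + b *\<^sub>R rvec (q j)"
      by (rule weight_cone_pair)
    have "v \<bullet> rvec \<epsilon> = b * of_int (\<sigma> * x)" by (simp only: ab inner_add_left inner_scaleR_left qie qjm'; simp)
    moreover have "v \<bullet> rvec m = a * (of_int (\<sigma> * x) / s)" by (simp only: ab inner_add_left inner_scaleR_left qim qjm'; simp)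
    moreover have "b * of_int (\<sigma> * x) \<ge> 0" "a * (of_int (\<sigma> * x) / s) \<ge> 0"
      using ab sx ij(4) by (intro mult_nonneg_nonneg divide_nonneg_nonneg; simp)+
    ultimately show ?thesis by (simp add: inner_commute)
  qed
  have qi: "rvec (q i) \<noteq> 0" using weight_nonzero by simp
  obtain f1 f2 where f: "\<forall>w. w = (w \<bullet> f1) *\<^sub>R rvec (q i) + (w \<bullet> f2) *\<^sub>R rvec (q j)"
    by (rule dual_basis_in_plane[OF card qi ij(6)[rule_format]])
  have none: "\<not> (pairing (q k) \<epsilon> > 0 \<and> pairing (q k) m > 0)" for k
  proof
    assume k: "pairing (q k) \<epsilon> > 0 \<and> pairing (q k) m > 0"
    define a b where "a = rvec (q k) \<bullet> f1" and "b = rvec (q k) \<bullet> f2"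
    have qk: "rvec (q k) = a *\<^sub>R rvec (q i) + b *\<^sub>R rvec (q j)" using f unfolding a_def b_def by blast
    have "rvec (q k) \<bullet> rvec \<epsilon> = b * of_int (\<sigma> * x)" by (simp only: qk inner_add_left inner_scaleR_left qie qjm'; simp)
    then have "b * of_int (\<sigma> * x) > 0" using k by (simp add: rvec_inner)
    then have b: "b > 0" using sx zero_less_mult_pos2 by blast
    have "rvec (q k) \<bullet> rvec m = a * (of_int (\<sigma> * x) / s)" by (simp only: qk inner_add_left inner_scaleR_left qim qjm'; simp)
    then have "a * (of_int (\<sigma> * x) / s) > 0" using k by (simp add: rvec_inner)
    moreover have "of_int (\<sigma> * x) / s > 0" using sx ij(4) by (rule divide_pos_pos)
    ultimately have "a > 0" using zero_less_mult_pos2 by blast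
    then have "between q i j (rvec (q k))" using b qk unfolding between_def by blast
    then show False using ij(2) by blast
  qed
  have perp: "perp_lattice \<tau> = {0}"
  proof -
    have "m' = 0" if m': "m' \<in> perp_lattice \<tau>" for m'
    proof -
      have "rvec m' \<bullet> rvec p = 0" using m' p\<tau> by (simp add: perp_lattice_def)
      then have "pairing p m' = 0" by (simp add: rvec_inner pairing_commute)
      then have k: "m' = lam_coord m' *s lam" using lam_coord[of m'] by simp
      obtain a b where ab: "a > 0" "b > 0" "\<theta> = a *\<^sub>R rvec (q i) + b *\<^sub>R rvec (q j)"
        using ij(1) by (auto simp: between_def)
      have "rvec m' \<bullet> \<theta> = 0" using m' secondary_cone_contains[of \<theta> q UNIV] \<theta>(1) by (simp add: perp_lattice_def)
      moreover have "rvec m' = of_int (lam_coord m') *\<^sub>R rvec lam" using k rvec_smult by metis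
      moreover have "rvec lam \<bullet> \<theta> = b * of_int x"
      proof -
        have 1: "rvec lam \<bullet> rvec (q i) = 0"
          by (simp add: qip rvec_inner) (metis p_lam pairing_commute)
        have 2: "rvec lam \<bullet> rvec (q j) = of_int x" unfolding x_def rvec_inner by (simp add: pairing_commute)
        show ?thesis by (simp add: ab(3) inner_add_right 1 2)
      qed
      ultimately have "lam_coord m' = 0" using x0 ab by auto
      then show ?thesis using k by simp
    qed
    then show ?thesis by (auto simp: perp_lattice_def)
  qed
  show ?thesis unfolding isolates_fixed_point_def
  proof (rule conjI[OF perp], rule exI[of _ \<epsilon>], rule exI[of _ m], intro conjI allI none)
    show "\<epsilon> \<in> {lam, - lam}" using \<sigma>(1) by (auto simp: \<epsilon>_def vec_eq_iff)
    show "\<epsilon> \<in> dual_monoid \<tau>" "m \<in> dual_monoid \<tau>" using dual by (auto simp: dual_monoid_def)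
    show "pairing p m > 0" using pm \<sigma>(2) by simp
  qed
qed

section \<open>The algorithm on a line\<close>
lemma ray_closed_add_scale:
  assumes "x \<in> ray p" "y \<in> ray p" "s \<ge> 0" "t \<ge> 0"
  shows "s *\<^sub>R x + t *\<^sub>R y \<in> ray p"
proof -
  obtain c d where "x = c *\<^sub>R rvec p" "c \<ge> 0" "y = d *\<^sub>R rvec p" "d \<ge> 0"
    using assms(1,2) by (auto simp: ray_def)
  then have "s *\<^sub>R x + t *\<^sub>R y = (s * c + t * d) *\<^sub>R rvec p" "s * c + t * d \<ge> 0"
    using assms(3,4) by (simp_all add: scaleR_add_left)
  then show ?thesis unfolding ray_def by blast
qed

lemma convex_ray: "convex (ray p)"
  unfolding convex_def by (intro ballI allI impI ray_closed_add_scale)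

lemma scale_in_ray_iff:
  assumes "p \<noteq> 0"
  shows "c *\<^sub>R rvec p \<in> ray p \<longleftrightarrow> c \<ge> 0"
proof
  assume "c *\<^sub>R rvec p \<in> ray p"
  then obtain d where "c *\<^sub>R rvec p = d *\<^sub>R rvec p" "d \<ge> 0" by (auto simp: ray_def)
  then show "c \<ge> 0" using assms by simp
qed (auto simp: ray_def)

lemma scale_in_opposite_ray_iff:
  assumes "p \<noteq> 0"
  shows "c *\<^sub>R rvec p \<in> ray (- p) \<longleftrightarrow> c \<le> 0"
  using scale_in_ray_iff[of "- p" "- c"] assms by (simp add: rvec_minus)

lemma dim_ray:
  assumes "p \<noteq> 0"
  shows "dim (ray p) = 1"
proof -
  have "dim (ray p) = dim {rvec p}" using span_ray by (metis dim_span)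
  then show ?thesis using assms by simp
qed

lemma aff_dim_ray:
  assumes "p \<noteq> 0"
  shows "aff_dim (ray p) = 1"
proof -
  have "0 \<in> affine hull (ray p)" by (intro hull_inc zero_in_ray)
  then show ?thesis using aff_dim_zero dim_ray[OF assms] by fastforce
qed

lemma zero_facet_of_ray:
  assumes p: "p \<noteq> 0"
  shows "{0} facet_of ray p"
proof -
  have "{0} face_of ray p"
    unfolding face_of_def
  proof (intro conjI ballI impI)
    fix a b x assume a: "a \<in> ray p" and b: "b \<in> ray p" and x: "x \<in> {0}" "x \<in> open_segment a b"
    obtain c d where cd: "a = c *\<^sub>R rvec p" "c \<ge> 0" "b = d *\<^sub>R rvec p" "d \<ge> 0"
      using a b by (auto simp: ray_def)
    obtain u where u: "0 < u" "u < 1" "x = (1 - u) *\<^sub>R a + u *\<^sub>R b" using x(2) by (auto simp: in_segment)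
    then have "((1 - u) * c + u * d) *\<^sub>R rvec p = 0" using x(1) cd by (simp add: scaleR_add_left)
    then have "(1 - u) * c + u * d = 0" using p by simp
    moreover have "(1 - u) * c \<ge> 0" "u * d \<ge> 0" using u cd by simp_all
    ultimately have "(1 - u) * c = 0" "u * d = 0" by linarith+
    then have "c = 0" "d = 0" using u by simp_all
    then show "a \<in> {0}" "b \<in> {0}" using cd by simp_all
  qed (simp_all add: zero_in_ray)
  then show ?thesis unfolding facet_of_def using aff_dim_ray[OF p] by simp
qed

text \<open>
  This distinguishes the ray from its opposite as the chamber containing the relative interior.
\<close>
lemma rel_interior_ray_nonzero:
  assumes p: "p \<noteq> 0"
  shows "\<not> rel_interior (ray p) \<subseteq> {0}"
proof
  assume sub: "rel_interior (ray p) \<subseteq> {0}"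
  have "affine hull (rel_interior (ray p)) = affine hull (ray p)"
    by (rule rel_interior_same_affine_hull[OF convex_ray])
  then have "aff_dim (rel_interior (ray p)) = aff_dim (ray p)" by (metis aff_dim_affine_hull)
  moreover have "aff_dim (rel_interior (ray p)) \<le> aff_dim {0 :: real ^ 'a}"
    using aff_dim_subset[OF sub] by simp
  ultimately show False using aff_dim_ray[OF p] by simp
qed

lemma wall_phase_eqI:
  assumes "Z \<in> chambers q (span W)" "rel_interior W \<subseteq> Z"
    and "\<And>Z'. Z' \<in> chambers q (span W) \<Longrightarrow> rel_interior W \<subseteq> Z' \<Longrightarrow> Z' = Z"
  shows "wall_phase q W = Z"
  unfolding wall_phase_def by (rule the_equality) (use assms in blast)+

lemma decomposes_None: "decomposes q H None M \<longleftrightarrow> M = {#}"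
proof
  assume "decomposes q H None M"
  then show "M = {#}" by (cases rule: decomposes.cases) auto
qed (simp add: decomposes.empty)

lemma decomposes_minimal_iff:
  assumes "C \<in> chambers q H" "- rvec (higgs_det q H) \<in> C"
  shows "decomposes q H (Some C) M \<longleftrightarrow> M = {#H#}"
proof
  assume "decomposes q H (Some C) M"
  then show "M = {#H#}" by (cases rule: decomposes.cases) (use assms in auto)
qed (use assms in \<open>simp add: decomposes.minimal\<close>)

context toric_wall
begin

lemma higgs_weights_zero: "higgs_weights q {0} = {}"
  using weight_nonzero by (simp add: higgs_weights_def)

lemma chambers_zero: "chambers q {0} = {{0}}"
  using secondary_cone_zero[of q "{0}"]
  by (auto simp: chambers_def secondary_fan_def higgs_weights_zero weight_cone_def)

lemma wall_phase_zero: "wall_phase q {0} = {0}"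
  by (rule wall_phase_eqI) (auto simp: chambers_zero)

lemma decomposes_zero: "decomposes q {0} (Some {0}) M \<longleftrightarrow> M = {#{0}#}"
  by (rule decomposes_minimal_iff) (auto simp: chambers_zero higgs_det_def higgs_weights_zero)

lemma higgs_weights_line: "higgs_weights q (span (ray p)) = {i. pairing (q i) lam = 0}"
  by (simp add: higgs_weights_def rvec_in_span_ray)

lemma line_weight: "pairing (q i) lam = 0 \<Longrightarrow> rvec (q i) = of_int (pairing (q i) mu) *\<^sub>R rvec p"
  using dual_coordinates rvec_smult by metis

definition two_sided :: bool where
  "two_sided \<longleftrightarrow> (\<exists>i. pairing (q i) lam = 0 \<and> pairing (q i) mu < 0)"

lemma opposite_ray:
  assumes "pairing (q i) lam = 0" "pairing (q i) mu < 0"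
  shows "ray (q i) = ray (- p)"
proof -
  have "q i = (- pairing (q i) mu) *s (- p)" using dual_coordinates[OF assms(1)] by (simp add: vec_eq_iff)
  then have "ray (q i) = ray ((- pairing (q i) mu) *s (- p))" by (rule arg_cong)
  also have "\<dots> = ray (- p)" using assms(2) by (intro ray_smult) simp
  finally show ?thesis .
qed

lemma secondary_fan_line:
  assumes i0: "q i0 = n *s p" "n > 0"
  shows "secondary_fan q (span (ray p)) = {{0}, ray p} \<union> (if two_sided then {ray (- p)} else {})"
proof -
  let ?H = "span (ray p)"
  have i0H: "i0 \<in> higgs_weights q ?H" by (simp add: higgs_weights_line i0 pairing_smult_left p_lam)
  have r0: "ray (q i0) = ray p" using i0 ray_smult by metis
  have sub: "secondary_cone q ?H \<theta> \<in> {{0}, ray p} \<union> (if two_sided then {ray (- p)} else {})"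
    if \<theta>: "\<theta> \<in> weight_cone q (higgs_weights q ?H)" for \<theta>
  proof -
    obtain c where c: "\<And>i. c i \<ge> 0" "\<theta> = (\<Sum>i\<in>higgs_weights q ?H. c i *\<^sub>R rvec (q i))"
      using \<theta> weight_cone_iff by blast
    define t where "t = (\<Sum>i\<in>higgs_weights q ?H. c i * of_int (pairing (q i) mu))"
    have \<theta>t: "\<theta> = t *\<^sub>R rvec p"
      unfolding c t_def scaleR_sum_left
      by (rule sum.cong) (auto simp: higgs_weights_line line_weight)
    consider "t = 0" | "t > 0" | "t < 0" by linarith
    then show ?thesis
    proof cases
      case 1
      then show ?thesis using \<theta>t by (simp add: secondary_cone_zero)
    next
      case 2
      then have *: "t / of_int n > 0" "\<theta> = (t / of_int n) *\<^sub>R rvec (q i0)"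
        using \<theta>t i0 by (simp_all add: rvec_smult)
      then show ?thesis using secondary_cone_on_ray[OF i0H *] r0 by simp
    next
      case 3
      have "\<exists>i\<in>higgs_weights q ?H. pairing (q i) mu < 0"
      proof (rule ccontr)
        assume "\<not> ?thesis"
        then have "t \<ge> 0" unfolding t_def using c(1) by (intro sum_nonneg mult_nonneg_nonneg) auto
        then show False using 3 by simp
      qed
      then obtain i where i: "i \<in> higgs_weights q ?H" "pairing (q i) mu < 0" by blast
      then have il: "pairing (q i) lam = 0" by (simp add: higgs_weights_line)
      have two: two_sided unfolding two_sided_def using i il by blast
      have 1: "\<theta> = (t / of_int (pairing (q i) mu)) *\<^sub>R rvec (q i)" using \<theta>t line_weight[OF il] i(2) by simp
      have 2: "t / of_int (pairing (q i) mu) > 0" using 3 i(2) by (simp add: divide_neg_neg)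
      have "secondary_cone q ?H \<theta> = ray (- p)"
        using secondary_cone_on_ray[OF i(1) 2 1] opposite_ray[OF il i(2)] by simp
      then show ?thesis using two by simp
    qed
  qed
  have zero: "{0} \<in> secondary_fan q ?H"
    unfolding secondary_fan_def using secondary_cone_zero[of q ?H]
    by (intro image_eqI[of _ _ 0]) (simp_all add: weight_cone_def convex_cone_hull_contains_0)
  have mem: "ray (q i) \<in> secondary_fan q ?H" if i: "i \<in> higgs_weights q ?H" for i
    unfolding secondary_fan_def
  proof (rule image_eqI)
    show "ray (q i) = secondary_cone q ?H (rvec (q i))"
      using secondary_cone_on_ray[OF i, of 1] by simp
    show "rvec (q i) \<in> weight_cone q (higgs_weights q ?H)"
      unfolding weight_cone_def using i by (intro hull_inc) simp
  qed
  have "ray (- p) \<in> secondary_fan q ?H" if two: two_sided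
  proof -
    obtain i where i: "pairing (q i) lam = 0" "pairing (q i) mu < 0" using two by (auto simp: two_sided_def)
    then show ?thesis using mem[of i] opposite_ray[OF i] by (simp add: higgs_weights_line)
  qed
  moreover have "ray p \<in> secondary_fan q ?H" using mem[OF i0H] r0 by simp
  ultimately have "{{0}, ray p} \<union> (if two_sided then {ray (- p)} else {}) \<subseteq> secondary_fan q ?H"
    using zero by simp
  moreover have "secondary_fan q ?H \<subseteq> {{0}, ray p} \<union> (if two_sided then {ray (- p)} else {})"
    using sub unfolding secondary_fan_def by blast
  ultimately show ?thesis by blast
qed

lemma chambers_line:
  assumes i0: "q i0 = n *s p" "n > 0"
  shows "chambers q (span (ray p)) = {ray p} \<union> (if two_sided then {ray (- p)} else {})"
    and "walls q (span (ray p)) = {{0}}"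
proof -
  have d: "dim (ray p) = 1" "dim (ray (- p)) = 1" using p_nonzero by (simp_all add: dim_ray)
  show "chambers q (span (ray p)) = {ray p} \<union> (if two_sided then {ray (- p)} else {})"
    unfolding chambers_def secondary_fan_line[OF i0] using d by (auto simp: zero_in_ray)
  show "walls q (span (ray p)) = {{0}}"
    unfolding walls_def secondary_fan_line[OF i0] using d by (auto simp: zero_in_ray)
qed

lemma opposite_ray_neq: "ray (- p) \<noteq> ray p"
  using scale_in_opposite_ray_iff[OF p_nonzero, of 1] generator_in_ray[of p] by auto

lemma wall_phase_ray:
  assumes i0: "q i0 = n *s p" "n > 0"
  shows "wall_phase q (ray p) = ray p"
proof (rule wall_phase_eqI)
  show "ray p \<in> chambers q (span (ray p))" by (simp add: chambers_line(1)[OF i0])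
  show "rel_interior (ray p) \<subseteq> ray p" by (rule rel_interior_subset)
  fix Z assume Z: "Z \<in> chambers q (span (ray p))" "rel_interior (ray p) \<subseteq> Z"
  have "Z \<noteq> ray (- p)"
  proof
    assume "Z = ray (- p)"
    then have "rel_interior (ray p) \<subseteq> ray p \<inter> ray (- p)" using Z rel_interior_subset by blast
    moreover have "ray p \<inter> ray (- p) \<subseteq> {0}"
    proof
      fix x assume "x \<in> ray p \<inter> ray (- p)"
      then obtain c where c: "x = c *\<^sub>R rvec p" "c \<ge> 0" "x \<in> ray (- p)" by (auto simp: ray_def)
      then have "c \<le> 0" using scale_in_opposite_ray_iff[OF p_nonzero] by blast
      then show "x \<in> {0}" using c by simp
    qed
    ultimately show False using rel_interior_ray_nonzero[OF p_nonzero] by blast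
  qed
  then show "Z = ray p" using Z(1) unfolding chambers_line(1)[OF i0] by (auto split: if_splits)
qed

text \<open>
  The phase on the other side of the origin is non-empty iff there are weights on that side.
\<close>
lemma phase_across_ray:
  assumes i0: "q i0 = n *s p" "n > 0"
  shows "phase_across q (span (ray p)) (ray p) {0} = (if two_sided then Some (ray (- p)) else None)"
proof -
  have ch: "C' \<in> chambers q (span (ray p)) \<and> C' \<noteq> ray p \<and> {0} facet_of C' \<longleftrightarrow> two_sided \<and> C' = ray (- p)" for C'
    using opposite_ray_neq zero_facet_of_ray[of "- p"] p_nonzero
    unfolding chambers_line(1)[OF i0] by auto
  have ex: "(\<exists>C'\<in>chambers q (span (ray p)). C' \<noteq> ray p \<and> {0} facet_of C') \<longleftrightarrow> two_sided"
  proof -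
    have "(\<exists>C'\<in>chambers q (span (ray p)). C' \<noteq> ray p \<and> {0} facet_of C')
        \<longleftrightarrow> (\<exists>C'. two_sided \<and> C' = ray (- p))" unfolding Bex_def ch ..
    then show ?thesis by simp
  qed
  show ?thesis unfolding phase_across_def ex ch by simp
qed

lemma higgs_det_line: "higgs_det q (span (ray p)) = wall_degree *s p"
proof -
  have "higgs_det q (span (ray p)) = (\<Sum>i | pairing (q i) lam = 0. pairing (q i) mu *s p)"
    unfolding higgs_det_def higgs_weights_line by (rule sum.cong) (auto intro: dual_coordinates)
  then show ?thesis by (simp add: wall_degree_def vec_eq_iff sum_distrib_right)
qed

lemma minus_det_line: "- rvec (higgs_det q (span (ray p))) = (- of_int wall_degree) *\<^sub>R rvec p"
  by (simp add: higgs_det_line rvec_smult)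

text \<open>
  The normal is represented by an element of \<open>L\<close>, determined only up to multiples of \<open>lam\<close>; its value
  on \<open>p\<close> is all that matters.
\<close>
lemma primitive_normal_line:
  "primitive_normal (span (ray p)) (ray p) {0} l \<longleftrightarrow> pairing p l = 1"
proof -
  have lat: "(\<lambda>v. pairing v l) ` {v. rvec v \<in> span (ray p)} = range (\<lambda>k. k * pairing p l)"
  proof -
    have "{v. rvec v \<in> span (ray p)} = range (\<lambda>k. k *s p)"
    proof (intro equalityI subsetI)
      fix v assume "v \<in> {v. rvec v \<in> span (ray p)}"
      then have "v = pairing v mu *s p" using dual_coordinates by (simp add: rvec_in_span_ray)
      then show "v \<in> range (\<lambda>k. k *s p)" by blast
    qed (auto simp: rvec_in_span_ray pairing_smult_left p_lam)
    then show ?thesis by (simp add: image_image pairing_smult_left)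
  qed
  show ?thesis
  proof
    assume "primitive_normal (span (ray p)) (ray p) {0} l"
    then have pos: "rvec l \<bullet> rvec p \<ge> 0" and u: "range (\<lambda>k. k * pairing p l) = UNIV"
      using lat generator_in_ray[of p] by (auto simp: primitive_normal_def)
    have "1 \<in> range (\<lambda>k. k * pairing p l)" using u by simp
    then obtain k where k: "k * pairing p l = 1" by auto
    have "pairing l p \<ge> 0" using pos by (simp add: rvec_inner)
    then have "pairing p l \<ge> 0" by (simp only: pairing_commute[of l p])
    moreover have "pairing p l dvd 1" using k by (metis dvd_triv_right)
    ultimately show "pairing p l = 1" by (simp add: zdvd1_eq)
  next
    assume l: "pairing p l = 1"
    then have l': "pairing l p = 1" by (simp only: pairing_commute[of l p])
    have "\<forall>v\<in>ray p. rvec l \<bullet> v \<ge> 0" by (auto simp: ray_def rvec_inner l')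
    then show "primitive_normal (span (ray p)) (ray p) {0} l"
      unfolding primitive_normal_def lat l by simp
  qed
qed

text \<open>
  The algorithm has no choices on a line. For positive degree it crosses the origin once, which
  splits off as many copies of the factor of the zero subspace as the degree says, and what
  remains is the minimal phase on the opposite ray, or nothing.
\<close>
theorem decomposes_wall_phase:
  assumes i0: "q i0 = n *s p" "n > 0"
  shows "decomposes q (span (ray p)) (Some (wall_phase q (ray p))) M \<longleftrightarrow>
    M = (if wall_degree \<le> 0 then {#span (ray p)#}
         else (if two_sided then {#span (ray p)#} else {#}) + repeat_mset (nat wall_degree) {#{0}#})"
proof -
  let ?H = "span (ray p)"
  have C: "ray p \<in> chambers q ?H" by (simp add: chambers_line(1)[OF i0])
  have det: "- rvec (higgs_det q ?H) \<in> ray p \<longleftrightarrow> wall_degree \<le> 0"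
    unfolding minus_det_line scale_in_ray_iff[OF p_nonzero] by simp
  show ?thesis
  proof (cases "wall_degree \<le> 0")
    case True
    then show ?thesis using decomposes_minimal_iff[OF C] det by (simp add: wall_phase_ray[OF i0])
  next
    case False
    have op: "decomposes q ?H (Some (ray (- p))) M \<longleftrightarrow> M = {#?H#}" if two_sided for M
    proof (rule decomposes_minimal_iff)
      show "ray (- p) \<in> chambers q ?H" using that by (simp add: chambers_line(1)[OF i0])
      show "- rvec (higgs_det q ?H) \<in> ray (- p)"
        unfolding minus_det_line scale_in_opposite_ray_iff[OF p_nonzero] using False by simp
    qed
    have across: "decomposes q ?H (phase_across q ?H (ray p) {0}) M \<longleftrightarrow> M = (if two_sided then {#?H#} else {#})" for M
      unfolding phase_across_ray[OF i0] using op by (simp add: decomposes_None)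
    have side: "decomposes q (span {0}) (Some (wall_phase q {0})) M \<longleftrightarrow> M = {#{0}#}" for M
      by (simp add: wall_phase_zero decomposes_zero)
    have kappa: "pairing (higgs_det q ?H) l = wall_degree" if "pairing p l = 1" for l
      using that by (simp add: higgs_det_line pairing_smult_left)
    let ?M = "(if two_sided then {#?H#} else {#}) + repeat_mset (nat wall_degree) {#{0}#}"
    have "decomposes q ?H (Some (ray p)) ?M"
    proof (rule decomposes.cross[where W="{0}" and l=mu])
      show "{0} \<in> walls q ?H" by (simp add: chambers_line(2)[OF i0])
      show "{0} facet_of ray p" by (rule zero_facet_of_ray[OF p_nonzero])
      show "primitive_normal ?H (ray p) {0} mu" by (simp add: primitive_normal_line p_mu)
      show "wall_degree = pairing (higgs_det q ?H) mu" by (simp add: kappa p_mu)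
    qed (use C det False across side in auto)
    moreover have "M = ?M" if "decomposes q ?H (Some (ray p)) M"
      using that
    proof (cases rule: decomposes.cases)
      case minimal
      then show ?thesis using det False by simp
    next
      case (cross W l \<kappa> M1 M2)
      have W: "W = {0}" using cross chambers_line(2)[OF i0] by simp
      have "pairing p l = 1" using cross W primitive_normal_line by simp
      then have "\<kappa> = wall_degree" using cross kappa by simp
      then show ?thesis using cross W across side by simp
    qed
    ultimately show ?thesis using False by (auto simp: wall_phase_ray[OF i0])
  qed
qed

lemma multiplicity_in_wall_phase:
  assumes i0: "q i0 = n *s p" "n > 0"
  shows "multiplicity_in_phase q (span (ray p)) (Some (wall_phase q (ray p))) K
    = count (if wall_degree \<le> 0 then {#span (ray p)#}
         else (if two_sided then {#span (ray p)#} else {#}) + repeat_mset (nat wall_degree) {#{0}#}) K"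
  unfolding multiplicity_in_phase_def decomposes_wall_phase[OF i0] by simp

lemma span_ray_nonzero: "span (ray p) \<noteq> {0}"
proof
  assume eq: "span (ray p) = {0}"
  have "rvec p \<in> span (ray p)" by (intro span_base generator_in_ray)
  then show False unfolding eq using p_nonzero by simp
qed

lemma multiplicity_of_origin:
  assumes i0: "q i0 = n *s p" "n > 0"
  shows "multiplicity_in_phase q (span (ray p)) (Some (wall_phase q (ray p))) {0} = nat wall_degree"
  unfolding multiplicity_in_wall_phase[OF i0] using span_ray_nonzero by simp

lemma multiplicity_of_line:
  assumes i0: "q i0 = n *s p" "n > 0" and two_sided
  shows "multiplicity_in_phase q (span (ray p)) (Some (wall_phase q (ray p))) (span (ray p)) = 1"
  unfolding multiplicity_in_wall_phase[OF i0] using span_ray_nonzero assms(3) by simp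

end

text \<open>
  Let \<open>p\<close> be the primitive vector on the wall. The coordinate \<open>lam\<close> is taken to be the one chosen in
  the definition of the local multiplicity, so that its sign needs no further discussion.
\<close>
theorem theorem3:
  fixes q :: "'n::finite \<Rightarrow> int ^ 'r::finite"
    and a :: "'n \<Rightarrow> int ^ 'd::finite"
    and W :: "(real ^ 'r) set"
    and \<Gamma> :: "'n set"
  assumes "CARD('r) = 2"
    and "toric_git_problem q"
    and "calabi_yau q"
    and "\<And>i. q i \<noteq> 0"
    and "is_rays q a"
    and "inj a"
    and "W \<in> walls q UNIV"
    and "minimal_face a \<Gamma>"
    and "face_subspace q \<Gamma> \<subseteq> span W"
  shows "enat (n_mult q \<Gamma> W) = m_mult q a \<Gamma> W"
proof -
  note card = assms(1) and rays = assms(5)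
  have cy: "(\<Sum>i\<in>UNIV. q i) = 0" using assms(3) by (simp add: calabi_yau_def)
  obtain i0 where i0: "W = ray (q i0)" by (rule walls_are_rays[OF card assms(7)])
  obtain n p lam0 mu where n: "n > 0" "q i0 = n *s p" and pl: "plane_coordinates p lam0 mu"
    by (rule primitive_coordinates[OF card assms(4)])
  have W: "W = ray p" using i0 n ray_smult by metis
  interpret P: plane_coordinates p lam0 mu by (rule pl)
  define lam where "lam = curve_coordinate (ray p) (ray p)"
  have "lam0 \<in> dual_monoid (ray p)" by (simp add: P.dual_monoid_ray P.p_lam)
  then have "perp_lattice (ray p) = range (\<lambda>k. k *s lam)"
    unfolding lam_def by (intro P.curve_coordinate_ray(1)[of lam0]) auto
  then have "lam = lam0 \<or> lam = - lam0" by (rule P.generator_unique)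
  then have "plane_coordinates p lam mu" using pl P.reverse_generator by auto
  then interpret T: toric_wall p lam mu q
    by (intro toric_wall.intro toric_wall_axioms.intro assms(4) cy)
  have fan: "ray p \<in> secondary_fan q UNIV" using assms(7) W by (simp add: walls_def)
  note iso = T.chambers_isolate_fixed_points[OF card n(2,1)]
  show ?thesis
  proof (cases "\<Gamma> = UNIV")
    case True
    have "face_subspace q \<Gamma> = {0}" by (simp add: face_subspace_def True)
    then have "n_mult q \<Gamma> W = nat T.wall_degree"
      unfolding n_mult_def W using T.multiplicity_of_origin[OF n(2,1)] by simp
    moreover have "m_mult q a \<Gamma> W = enat (nat T.wall_degree)"
      unfolding m_mult_def True nabla_UNIV[OF rays cy] W
      by (rule T.horn_locus_intersection[OF lam_def fan iso])
    ultimately show ?thesis by simp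
  next
    case False
    note face = T.face_outside_line[OF rays assms(6,8) assms(9)[unfolded W] False]
    have nab: "nabla q a \<Gamma> = T.coset_locus" by (rule T.nabla_outside_line[OF rays face(1) False])
    have "n_mult q \<Gamma> W = 1"
      unfolding n_mult_def face(2) W
      by (rule T.multiplicity_of_line[OF n(2,1)]) (use face(3) in \<open>simp add: T.two_sided_def\<close>)
    moreover have "m_mult q a \<Gamma> W = 1"
      unfolding m_mult_def nab W
      using T.coset_locus_intersection[OF lam_def fan iso] by simp
    ultimately show ?thesis by (simp add: one_enat_def)
  qed
qed

end
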